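(* Let $F(x,y)\in\mathbb{Z}[x,y]$ be a diagonalizable form of degree $r\geq 5$ with discriminant $\Delta$. Let $h$ be an integer such that $\gcd(h,\Delta)=1$. If $$|\Delta|\geq 2^{r^2-r}\,r^{\,r+7r(r-1)/(r-4)},$$ then the number of primitive solutions $(x,y)\in\mathbb{Z}^2$ of the equation $|F(x,y)|=h$ is bounded by $$\begin{cases} 3r^{1+\omega(h)} & \text{if } D<0,\\ 6r^{\omega(h)} & \text{if } D>0,\ r \text{ is even and } F \text{ is indefinite},\\ 3r^{\omega(h)} & \text{if } D>0,\ r \text{ is odd and } F \text{ is indefinite},\\ r^{\omega(h)} & \text{if } D>0 \text{ and } F \text{ is definite},\end{cases}$$ where $\omega(h)$ denotes the number of prime divisors of $h$.
   Context: A binary form $F(x,y)\in\mathbb{Z}[x,y]$ of degree $r$ is called diagonalizable if it can be written as $F(x,y)=(\alpha x+\beta y)^r-(\gamma x+\delta y)^r$ with (complex) constants $\alpha,\beta,\gamma,\delta$ satisfying $j=\alpha\delta-\beta\gamma\neq 0$. For such a form one can write $(\alpha x+\beta y)(\gamma x+\delta y)=\chi(Ax^2+Bxy+Cy^2)$ with $A,B,C\in\mathbb{Z}$ and a constant $\chi$; put $D=D(F)=B^2-4AC$ (which is nonzero). $F$ is definite if $F(x,y)$ takes values of only one strict sign for real $(x,y)\neq(0,0)$, and indefinite if it takes both signs. A solution $(x,y)\in\mathbb{Z}^2$ is primitive if $\gcd(x,y)=1$; $(x,y)$ and $(-x,-y)$ are counted as one solution. $\omega(h)$ counts distinct primes.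 *)

theory Defs
  imports Complex_Main "HOL-Computational_Algebra.Primes"
begin

text \<open>
  A binary form of degree r with integer coefficients is given by its coefficient sequence F,
  standing for the homogeneous polynomial F(0) x^r + F(1) x^(r-1) y + ... + F(r) y^r;
  values F(i) with i > r are irrelevant.
\<close>

definition form_eval :: "nat \<Rightarrow> (nat \<Rightarrow> int) \<Rightarrow> 'a::comm_ring_1 \<Rightarrow> 'a \<Rightarrow> 'a" where
  "form_eval r F x y = (\<Sum>i\<le>r. of_int (F i) * x ^ (r - i) * y ^ i)"

text \<open>
  Over the complex numbers an identity of polynomial functions in x, y is the same as
  an identity of polynomials.
\<close>

definition diagonalization ::
    "nat \<Rightarrow> (nat \<Rightarrow> int) \<Rightarrow> complex \<Rightarrow> complex \<Rightarrow> complex \<Rightarrow> complex \<Rightarrow> bool" where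
  "diagonalization r F \<alpha> \<beta> \<gamma> \<delta> \<longleftrightarrow>
     \<alpha> * \<delta> - \<beta> * \<gamma> \<noteq> 0 \<and>
     (\<forall>x y. form_eval r F x y = (\<alpha> * x + \<beta> * y) ^ r - (\<gamma> * x + \<delta> * y) ^ r)"

definition diagonalizable :: "nat \<Rightarrow> (nat \<Rightarrow> int) \<Rightarrow> bool" where
  "diagonalizable r F \<longleftrightarrow> (\<exists>\<alpha> \<beta> \<gamma> \<delta>. diagonalization r F \<alpha> \<beta> \<gamma> \<delta>)"

text \<open>
  The discriminant of F = (a(0) x + b(0) y) ... (a(r-1) x + b(r-1) y) is the product of
  (a(i) b(j) - a(j) b(i))^2 over i < j. It does not depend on the factorization into
  complex linear forms, and it is an integer for F with integer coefficients. Linear factors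
  with a(i) = 0 are allowed, so no assumption on the leading coefficient is needed.
\<close>

definition is_discriminant :: "nat \<Rightarrow> (nat \<Rightarrow> int) \<Rightarrow> int \<Rightarrow> bool" where
  "is_discriminant r F \<Delta> \<longleftrightarrow>
     (\<exists>a b :: nat \<Rightarrow> complex.
        (\<forall>x y. form_eval r F x y = (\<Prod>i<r. a i * x + b i * y)) \<and>
        of_int \<Delta> = (\<Prod>j<r. \<Prod>i<j. (a i * b j - a j * b i)\<^sup>2))"

text \<open>
  D(F) is the discriminant of an integral quadratic form proportional to the product of the two
  linear forms of a diagonalization. The quadratic form is determined only up to a rational factor,
  so D(F) is determined up to a nonzero rational square; in particular its sign is well defined.
  Existence for every diagonalizable F is lemma \<open>ex_is_quadratic_discriminant\<close> below.
\<close>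

definition is_quadratic_discriminant :: "nat \<Rightarrow> (nat \<Rightarrow> int) \<Rightarrow> int \<Rightarrow> bool" where
  "is_quadratic_discriminant r F D \<longleftrightarrow>
     (\<exists>\<alpha> \<beta> \<gamma> \<delta> \<chi>. \<exists>A B C :: int.
        diagonalization r F \<alpha> \<beta> \<gamma> \<delta> \<and>
        (\<forall>x y. (\<alpha> * x + \<beta> * y) * (\<gamma> * x + \<delta> * y) =
                 \<chi> * (of_int A * x\<^sup>2 + of_int B * x * y + of_int C * y\<^sup>2)) \<and>
        D = B\<^sup>2 - 4 * A * C)"

definition definite_form :: "nat \<Rightarrow> (nat \<Rightarrow> int) \<Rightarrow> bool" where
  "definite_form r F \<longleftrightarrow>
     (\<forall>x y :: real. (x, y) \<noteq> (0, 0) \<longrightarrow> form_eval r F x y > 0) \<or>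
     (\<forall>x y :: real. (x, y) \<noteq> (0, 0) \<longrightarrow> form_eval r F x y < 0)"

definition indefinite_form :: "nat \<Rightarrow> (nat \<Rightarrow> int) \<Rightarrow> bool" where
  "indefinite_form r F \<longleftrightarrow>
     (\<exists>x y :: real. form_eval r F x y > 0) \<and> (\<exists>x y :: real. form_eval r F x y < 0)"

text \<open>
  Solutions are counted up to sign: one element is a pair of opposite solutions
  (x, y), (-x, -y).
\<close>

definition primitive_solutions :: "nat \<Rightarrow> (nat \<Rightarrow> int) \<Rightarrow> int \<Rightarrow> (int \<times> int) set set" where
  "primitive_solutions r F h =
     (\<lambda>(x, y). {(x, y), (- x, - y)}) ` {(x, y). gcd x y = 1 \<and> \<bar>form_eval r F x y\<bar> = h}"

definition omega :: "int \<Rightarrow> nat" where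
  "omega h = card (prime_factors h)"

lemma diagonalization_coeff:
  assumes "diagonalization r F \<alpha> \<beta> \<gamma> \<delta>" "i \<le> r"
  shows "of_int (F i) =
    of_nat (r choose i) * (\<alpha> ^ (r - i) * \<beta> ^ i - \<gamma> ^ (r - i) * \<delta> ^ i)"
proof -
  have "(\<Sum>i\<le>r. of_int (F i) * y ^ i) =
      (\<Sum>i\<le>r. (of_nat (r choose i) * (\<alpha> ^ (r - i) * \<beta> ^ i - \<gamma> ^ (r - i) * \<delta> ^ i)) * y ^ i)" for y
  proof -
    have "(\<Sum>i\<le>r. of_int (F i) * y ^ i) = (\<beta> * y + \<alpha>) ^ r - (\<delta> * y + \<gamma>) ^ r"
      using assms(1)[unfolded diagonalization_def form_eval_def, THEN conjunct2, rule_format, of 1 y]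
      by (simp add: add.commute)
    then show ?thesis
      unfolding binomial_ring sum_subtractf[symmetric]
      by (simp add: sum_subtractf[symmetric] power_mult_distrib mult_ac right_diff_distrib)
  qed
  then have "\<forall>i\<le>r. of_int (F i) =
      of_nat (r choose i) * (\<alpha> ^ (r - i) * \<beta> ^ i - \<gamma> ^ (r - i) * \<delta> ^ i)"
    by (intro polyfun_eq_coeffs[THEN iffD1] allI)
  then show ?thesis
    using assms(2) by simp
qed

lemma ex_is_quadratic_discriminant:
  assumes "diagonalizable r F" "r \<ge> 3"
  shows "\<exists>D. is_quadratic_discriminant r F D"
proof -
  obtain \<alpha> \<beta> \<gamma> \<delta> where d: "diagonalization r F \<alpha> \<beta> \<gamma> \<delta>"
    using assms(1) by (auto simp: diagonalizable_def)
  have j: "\<alpha> * \<delta> - \<beta> * \<gamma> \<noteq> 0"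
    using d by (simp add: diagonalization_def)
  obtain n where n: "r = n + 3"
    using assms(2) by (metis add.commute le_Suc_ex)
  have "\<exists>\<chi>. \<exists>A B C :: int. \<alpha> * \<gamma> = \<chi> * of_int A \<and>
          \<alpha> * \<delta> + \<beta> * \<gamma> = \<chi> * of_int B \<and> \<beta> * \<delta> = \<chi> * of_int C"
  proof (cases "\<alpha> * \<gamma> = 0")
    case True
    define w where "w = (if \<alpha> = 0 then \<delta> / \<gamma> else \<beta> / \<alpha>)"
    have F0: "of_int (F 0) = \<alpha> ^ r - \<gamma> ^ r"
      using diagonalization_coeff[OF d, of 0] by simp
    have F1: "of_int (F 1) = of_nat r * (\<alpha> ^ (r - 1) * \<beta> - \<gamma> ^ (r - 1) * \<delta>)"
      using diagonalization_coeff[OF d, of 1] n by simp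
    have F0n: "complex_of_int (F 0) \<noteq> 0"
      using True j n by (cases "\<alpha> = 0"; cases "\<gamma> = 0") (auto simp: F0 zero_power)
    have pw: "t ^ r = t * t ^ (r - 1)" for t :: complex
      using n power_eq_if[of t r] by auto
    have rw: "of_int (F 1) = w * (of_nat r * of_int (F 0))"
    proof (cases "\<alpha> = 0")
      case True
      with j have "\<gamma> \<noteq> 0" by auto
      with True n show ?thesis unfolding F0 F1 w_def pw by simp
    next
      case False
      with \<open>\<alpha> * \<gamma> = 0\<close> have "\<gamma> = 0" by simp
      with False n show ?thesis unfolding F0 F1 w_def pw by simp
    qed
    have nz: "of_nat r * complex_of_int (F 0) \<noteq> 0"
      using F0n assms(2) by simp
    show ?thesis
    proof (intro exI conjI)
      show "\<alpha> * \<gamma> = (\<alpha> * \<delta> + \<beta> * \<gamma>) / (of_nat r * of_int (F 0)) * of_int 0"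
        using True by simp
      show "\<alpha> * \<delta> + \<beta> * \<gamma> = (\<alpha> * \<delta> + \<beta> * \<gamma>) / (of_nat r * of_int (F 0)) * of_int (int r * F 0)"
        using nz by simp
      show "\<beta> * \<delta> = (\<alpha> * \<delta> + \<beta> * \<gamma>) / (of_nat r * of_int (F 0)) * of_int (F 1)"
        unfolding rw using nz True j by (auto simp: w_def)
    qed
  next
    case False
    define c where "c i = int (r choose i)" for i
    define s where "s i = \<alpha> ^ (r - i) * \<beta> ^ i - \<gamma> ^ (r - i) * \<delta> ^ i" for i
    have Fi: "of_int (F i) = of_int (c i) * s i" if "i \<le> 3" for i
      using diagonalization_coeff[OF d, of i] that n by (simp add: c_def s_def)
    have c: "complex_of_int (c i) \<noteq> 0" if "i \<le> 3" for i
      using that n by (simp add: c_def)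
    define S where "S i = (if i = 0 then F 0 * c 1 * c 2 * c 3 else if i = 1 then F 1 * c 0 * c 2 * c 3
      else if i = 2 then F 2 * c 0 * c 1 * c 3 else F 3 * c 0 * c 1 * c 2)" for i :: nat
    define M where "M = complex_of_int (c 0 * c 1 * c 2 * c 3)"
    have S: "complex_of_int (S 0) = M * s 0" "complex_of_int (S 1) = M * s 1"
      "complex_of_int (S 2) = M * s 2" "complex_of_int (S 3) = M * s 3"
      by (simp_all add: S_def M_def Fi)
    have M: "M \<noteq> 0" using c by (simp add: M_def)
    define K where "K = - (M\<^sup>2 * (\<alpha> * \<gamma>) ^ n * (\<alpha> * \<delta> - \<beta> * \<gamma>)\<^sup>2)"
    have K: "K \<noteq> 0" using M j False by (simp add: K_def)
    have s: "s 0 = \<alpha> ^ n * \<alpha> ^ 3 - \<gamma> ^ n * \<gamma> ^ 3" "s 1 = \<alpha> ^ n * \<alpha>\<^sup>2 * \<beta> - \<gamma> ^ n * \<gamma>\<^sup>2 * \<delta>"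
      "s 2 = \<alpha> ^ n * \<alpha> * \<beta>\<^sup>2 - \<gamma> ^ n * \<gamma> * \<delta>\<^sup>2" "s 3 = \<alpha> ^ n * \<beta> ^ 3 - \<gamma> ^ n * \<delta> ^ 3"
      by (simp_all add: s_def n power_add eval_nat_numeral)
    have K': "K = - (M\<^sup>2 * (\<alpha> ^ n * \<gamma> ^ n) * (\<alpha> * \<delta> - \<beta> * \<gamma>)\<^sup>2)"
      by (simp add: K_def power_mult_distrib)
    have A: "complex_of_int (S 0 * S 2 - (S 1)\<^sup>2) = K * (\<alpha> * \<gamma>)"
      unfolding of_int_diff of_int_mult of_int_power S K' s
      by (simp add: algebra_simps power2_eq_square power3_eq_cube)
    have B: "complex_of_int (S 0 * S 3 - S 1 * S 2) = K * (\<alpha> * \<delta> + \<beta> * \<gamma>)"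
      unfolding of_int_diff of_int_mult of_int_power S K' s
      by (simp add: algebra_simps power2_eq_square power3_eq_cube)
    have C: "complex_of_int (S 1 * S 3 - (S 2)\<^sup>2) = K * (\<beta> * \<delta>)"
      unfolding of_int_diff of_int_mult of_int_power S K' s
      by (simp add: algebra_simps power2_eq_square power3_eq_cube)
    show ?thesis
    proof (intro exI conjI)
      show "\<alpha> * \<gamma> = 1 / K * complex_of_int (S 0 * S 2 - (S 1)\<^sup>2)" unfolding A using K by simp
      show "\<alpha> * \<delta> + \<beta> * \<gamma> = 1 / K * complex_of_int (S 0 * S 3 - S 1 * S 2)" unfolding B using K by simp
      show "\<beta> * \<delta> = 1 / K * complex_of_int (S 1 * S 3 - (S 2)\<^sup>2)" unfolding C using K by simp
    qed
  qed
  then obtain \<chi> and A B C :: int where ABC: "\<alpha> * \<gamma> = \<chi> * of_int A"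
      "\<alpha> * \<delta> + \<beta> * \<gamma> = \<chi> * of_int B" "\<beta> * \<delta> = \<chi> * of_int C"
    by blast
  have "(\<alpha> * x + \<beta> * y) * (\<gamma> * x + \<delta> * y) =
      \<chi> * (of_int A * x\<^sup>2 + of_int B * x * y + of_int C * y\<^sup>2)" for x y
  proof -
    have "(\<alpha> * x + \<beta> * y) * (\<gamma> * x + \<delta> * y) =
        (\<alpha> * \<gamma>) * x\<^sup>2 + (\<alpha> * \<delta> + \<beta> * \<gamma>) * (x * y) + (\<beta> * \<delta>) * y\<^sup>2"
      by (simp add: algebra_simps power2_eq_square)
    then show ?thesis unfolding ABC by (simp add: algebra_simps)
  qed
  with d show ?thesis unfolding is_quadratic_discriminant_def by blast
qed

end

theory Submission
  imports Defs "HOL-Analysis.Complex_Transcendental" "HOL-Computational_Algebra.Formal_Power_Series"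
    "HOL-Computational_Algebra.Polynomial"
begin

text \<open>
  Write \<open>F = \<xi> ^ r - \<eta> ^ r\<close> and \<open>j = \<alpha> * \<delta> - \<beta> * \<gamma>\<close>. Then \<open>\<bar>\<Delta>\<bar> = r ^ r * \<bar>j\<bar> ^ (r * (r - 1))\<close>,
  and the hypothesis on \<open>\<Delta>\<close> says \<open>\<bar>j\<bar> \<ge> 2 * r powr (7 / (r - 4))\<close>.

  \<^emph>\<open>Reduction to \<open>\<bar>F\<bar> = 1\<close>.\<close> For a prime \<open>p\<close> dividing \<open>h\<close>, extend the \<open>p\<close>-adic valuation to the complex
  numbers. As \<open>p\<close> does not divide \<open>\<Delta>\<close>, exactly one of the \<open>r\<close> normalized linear factors of \<open>F\<close>
  is a non-unit at a given solution. Solutions with the same factor for every \<open>p\<close> have determinants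
  divisible by \<open>h\<close>, so each of the \<open>r ^ omega h\<close> classes lies in a lattice of index \<open>h\<close>, on which
  \<open>F / h\<close> is again an integral diagonalizable form, with a larger \<open>\<bar>j\<bar>\<close>.

  \<^emph>\<open>Hypergeometric method.\<close> If \<open>\<eta> / \<xi>\<close> is close to the same \<open>r\<close>-th root of unity at four solutions of
  \<open>\<bar>F\<bar> = 1\<close>, then \<open>\<bar>\<xi> * \<eta>' - \<xi>' * \<eta>\<bar> \<ge> \<bar>j\<bar>\<close> makes their heights \<open>max \<bar>\<xi>\<bar> \<bar>\<eta>\<bar>\<close> grow like
  \<open>H' \<ge> \<bar>j\<bar> / 2 * H ^ (r - 1)\<close>. The Pade approximants of \<open>w powr (1 / r)\<close>, evaluated at the third
  solution, give linear forms that are integer multiples of \<open>j\<close> up to a controlled factor, but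
  too small at the fourth solution. The remainder of the Pade approximation is a divided difference of
  exponentials, which makes its size evident.

  The number of roots of unity that can be approximated is \<open>r\<close> if \<open>D < 0\<close>, and at most two
  if \<open>D > 0\<close>, since then \<open>\<xi>\<close> and \<open>\<eta>\<close> are real up to constants.
\<close>

section \<open>Divided differences of the exponential function\<close>

text \<open>The hypergeometric step loses a factor \<open>8 * r ^ 3 * \<bar>s\<bar>\<close> per
  degree of the approximants: \<open>r ^ 2\<close> clears the denominators of their coefficients,
  \<open>2 * r * s\<close> makes the \<open>r\<close>-th powers of \<xi> and \<eta> integral, and
  \<open>4\<close> bounds the approximants on the unit disc. Here \<open>s\<close> is a square root
  of the discriminant of the quadratic form, a quantity that the hypothesis on \<Delta> does not
  mention. Controlling it is the main obstacle: for a primitive quadratic form the largeness of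
  \<open>j\<close> implies \<open>\<bar>s\<bar> \<le> \<bar>j\<bar> ^ 2\<close>, and then
  \<open>r ^ 7 \<le> (\<bar>j\<bar> / 2) ^ (r - 4)\<close> makes the loss smaller than the height of
  the third solution.

  No number fields occur. Galois conjugation is replaced by pairs \<open>a + b * s\<close>,
  \<open>a - b * s\<close>, and a prime ideal above \<open>p\<close> by a valuation ring inside the
  complex numbers. Reducible forms and a rational \<open>s\<close> therefore need no separate
  treatment.\<close>

definition exp_divided_difference :: "real set \<Rightarrow> complex \<Rightarrow> complex" where
  "exp_divided_difference S z =
     (\<Sum>e\<in>S. exp (of_real e * z) / of_real (\<Prod>e'\<in>S - {e}. e - e'))"

text \<open>The weight \<open>e - a\<close> cancels the factor of \<open>a\<close> in each
  denominator and kills the term of \<open>a\<close> itself. Such weights arise in the recursion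
  over the nodes and also on differentiating after multiplication by
  \<open>exp (- a * z)\<close>.\<close>

lemma exp_divided_difference_remove:
  assumes "finite S" "a \<in> S"
  shows "exp_divided_difference (S - {a}) z =
    (\<Sum>e\<in>S. of_real (e - a) * (exp (of_real e * z) / of_real (\<Prod>e'\<in>S - {e}. e - e')))"
proof -
  have "(\<Sum>e\<in>S. of_real (e - a) * (exp (of_real e * z) / of_real (\<Prod>e'\<in>S - {e}. e - e'))) =
        (\<Sum>e\<in>S - {a}. of_real (e - a) * (exp (of_real e * z) / of_real (\<Prod>e'\<in>S - {e}. e - e')))"
    using assms by (subst sum.remove[of S a]) auto
  also have "\<dots> = exp_divided_difference (S - {a}) z"
    unfolding exp_divided_difference_def
  proof (rule sum.cong)
    fix e assume e: "e \<in> S - {a}"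
    have "(\<Prod>e'\<in>S - {e}. e - e') = (e - a) * (\<Prod>e'\<in>S - {e} - {a}. e - e')"
      using assms e by (subst prod.remove[of _ a]) auto
    moreover have "S - {e} - {a} = S - {a} - {e}" by auto
    ultimately show "of_real (e - a) * (exp (of_real e * z) / of_real (\<Prod>e'\<in>S - {e}. e - e')) =
      exp (of_real e * z) / of_real (\<Prod>e'\<in>S - {a} - {e}. e - e')"
      using e by simp
  qed auto
  finally show ?thesis by simp
qed

lemma exp_divided_difference_rec:
  assumes "finite S" "a \<in> S" "b \<in> S"
  shows "of_real (b - a) * exp_divided_difference S z =
    exp_divided_difference (S - {a}) z - exp_divided_difference (S - {b}) z"
  unfolding exp_divided_difference_remove[OF assms(1,2)] exp_divided_difference_remove[OF assms(1,3)]
  unfolding exp_divided_difference_def sum_subtractf[symmetric] sum_distrib_left left_diff_distrib[symmetric]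
  by (rule sum.cong) simp_all

text \<open>At \<open>z = 0\<close> the interpolated function is constant, so its divided
  differences over at least two nodes vanish. This is the initial value from which the norm bound is
  integrated.\<close>

lemma exp_divided_difference_0:
  assumes "finite S" "card S \<ge> 2"
  shows "exp_divided_difference S 0 = 0"
  using assms
proof (induction "card S" arbitrary: S)
  case 0
  then show ?case by simp
next
  case (Suc k)
  obtain a b where ab: "a \<in> S" "b \<in> S" "a \<noteq> b"
    using Suc.prems by (metis card_2_iff' card_le_Suc0_iff_eq not_less_eq_eq numeral_2_eq_2)
  have "exp_divided_difference (S - {a}) 0 = exp_divided_difference (S - {b}) 0"
  proof (cases "card S = 2")
    case True
    then have "S = {a, b}" using ab Suc.prems by (metis card_2_iff doubleton_eq_iff insertE singletonD)
    with ab have "S - {a} = {b}" "S - {b} = {a}" by auto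
    then show ?thesis by (simp add: exp_divided_difference_def)
  next
    case False
    have "exp_divided_difference (S - {c}) 0 = 0" if "c \<in> S" for c
      using Suc.hyps(2) Suc.prems False that by (intro Suc.hyps(1)) auto
    then show ?thesis using ab by simp
  qed
  with exp_divided_difference_rec[OF Suc.prems(1) ab(1,2), of 0] ab(3) show ?case by simp
qed

text \<open>
  With \<open>g s = exp (a * (t - s) * z) * exp_divided_difference S (s * z)\<close> the derivative of \<open>g\<close>
  only involves the divided difference with the node \<open>a\<close> removed.
\<close>

lemma norm_exp_divided_difference_le_aux:
  assumes "finite S" "S \<noteq> {}" "\<And>e. e \<in> S \<Longrightarrow> e \<ge> 0" "Re z \<le> 0" "t \<ge> 0"
  shows "norm (exp_divided_difference S (of_real t * z)) \<le>
    (t * norm z) ^ (card S - 1) / fact (card S - 1)"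
  using assms
proof (induction "card S - 1" arbitrary: S t)
  case 0
  then have "card S = 1" using card_gt_0_iff[of S] by simp
  then obtain e where "S = {e}" by (auto simp: card_1_singleton_iff)
  with 0 show ?case by (simp add: exp_divided_difference_def mult_nonneg_nonpos)
next
  case (Suc k)
  obtain a where a: "a \<in> S" using Suc.prems by blast
  define S' where "S' = S - {a}"
  have card: "card S' = Suc k" "card S = Suc (Suc k)"
    using Suc.hyps(2) Suc.prems(1) a by (auto simp: S'_def)
  have S': "finite S'" using Suc.prems(1) by (simp add: S'_def)
  have S'_ne: "S' \<noteq> {}"
  proof
    assume "S' = {}"
    with card(1) show False by (metis card.empty nat.distinct(1))
  qed
  define g where "g s = exp (of_real (a * (t - s)) * z) * exp_divided_difference S (of_real s * z)" for s :: real
  define g' where "g' s = exp (of_real (a * (t - s)) * z) * (z * exp_divided_difference S' (of_real s * z))" for s :: real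
  have eq: "g s = (\<Sum>e\<in>S. exp (of_real (a * t) * z + of_real s * (of_real (e - a) * z)) /
      of_real (\<Prod>e'\<in>S - {e}. e - e'))" for s
    unfolding g_def exp_divided_difference_def sum_distrib_left
    by (rule sum.cong) (auto simp: algebra_simps simp flip: exp_add)
  have eq': "g' s = (\<Sum>e\<in>S. (of_real (e - a) * z) * exp (of_real (a * t) * z + of_real s * (of_real (e - a) * z)) /
      of_real (\<Prod>e'\<in>S - {e}. e - e'))" for s
    unfolding g'_def S'_def exp_divided_difference_remove[OF Suc.prems(1) a] sum_distrib_left
  proof (rule sum.cong)
    fix e
    have "exp (of_real (a * (t - s)) * z) * exp (of_real e * (of_real s * z)) =
      exp (of_real (a * t) * z + of_real s * (of_real (e - a) * z))"
      by (simp add: algebra_simps flip: exp_add)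
    then show "exp (of_real (a * (t - s)) * z) * (z * (of_real (e - a) *
        (exp (of_real e * (of_real s * z)) / of_real (\<Prod>e'\<in>S - {e}. e - e')))) =
      of_real (e - a) * z * exp (of_real (a * t) * z + of_real s * (of_real (e - a) * z)) /
        of_real (\<Prod>e'\<in>S - {e}. e - e')"
      by (simp only: times_divide_eq_right mult.assoc mult.left_commute[of "exp (of_real (a * (t - s)) * z)"]
          mult.left_commute[of z])
  qed auto
  have der: "(g has_vector_derivative g' s) (at s)" for s
    unfolding eq eq'
  proof (intro has_vector_derivative_sum)
    fix e
    define w K where "w = of_real (e - a) * z" and "K = complex_of_real (\<Prod>e'\<in>S - {e}. e - e')"
    have "((\<lambda>x. exp (of_real (a * t) * z + x * w) / K) has_field_derivative
        w * exp (of_real (a * t) * z + of_real s * w) / K) (at (of_real s))"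
      unfolding divide_inverse by (rule derivative_eq_intros refl | simp)+
    from has_vector_derivative_real_field[OF this]
    show "((\<lambda>s. exp (of_real (a * t) * z + of_real s * (of_real (e - a) * z)) / of_real (\<Prod>e'\<in>S - {e}. e - e'))
       has_vector_derivative of_real (e - a) * z * exp (of_real (a * t) * z + of_real s * (of_real (e - a) * z)) /
       of_real (\<Prod>e'\<in>S - {e}. e - e')) (at s)"
      unfolding w_def K_def .
  qed
  have bound: "norm (g' s) \<le> norm z * (s * norm z) ^ k / fact k" if s: "0 \<le> s" "s \<le> t" for s
  proof -
    have "k = card S' - 1" using card by simp
    have "norm (exp_divided_difference S' (of_real s * z)) \<le> (s * norm z) ^ k / fact k"
      using Suc.hyps(1)[OF \<open>k = card S' - 1\<close> S' S'_ne] Suc.prems s \<open>k = card S' - 1\<close> by (auto simp: S'_def)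
    moreover have "norm (exp (of_real (a * (t - s)) * z)) \<le> 1"
      using Suc.prems s a by (simp add: mult_nonneg_nonpos)
    ultimately have "norm (g' s) \<le> 1 * (norm z * ((s * norm z) ^ k / fact k))"
      unfolding g'_def norm_mult by (intro mult_mono) auto
    then show ?thesis by simp
  qed
  define \<phi> where "\<phi> s = (s * norm z) ^ Suc k / fact (Suc k)" for s :: real
  have der\<phi>: "(\<phi> has_vector_derivative norm z * (s * norm z) ^ k / fact k) (at s)" for s
  proof -
    have "((\<lambda>s. (s * norm z) ^ Suc k / fact (Suc k)) has_real_derivative
      (real (Suc k) * (s * norm z) ^ k * norm z) / fact (Suc k)) (at s)"
      unfolding divide_inverse by (rule derivative_eq_intros refl | simp)+
    moreover have "(real (Suc k) * (s * norm z) ^ k * norm z) / fact (Suc k) = norm z * (s * norm z) ^ k / fact k"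
      by (simp del: of_nat_Suc)
    ultimately show ?thesis
      unfolding \<phi>_def has_real_derivative_iff_has_vector_derivative by metis
  qed
  have g0: "g 0 = 0" using exp_divided_difference_0[of S] Suc.prems card by (simp add: g_def)
  have "norm (g t) \<le> \<phi> t"
  proof (cases "t = 0")
    case True
    then show ?thesis using g0 by (simp add: \<phi>_def)
  next
    case False
    have "norm (g t - g 0) \<le> \<phi> t - \<phi> 0"
    proof (rule differentiable_bound_general[of 0 t])
      show "continuous_on {0..t} g"
        by (intro continuous_at_imp_continuous_on ballI has_vector_derivative_continuous[OF der])
      show "continuous_on {0..t} \<phi>"
        by (intro continuous_at_imp_continuous_on ballI has_vector_derivative_continuous[OF der\<phi>])
    qed (use False Suc.prems der der\<phi> bound in auto)
    then show ?thesis using g0 by (simp add: \<phi>_def)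
  qed
  then show ?case using card by (simp add: \<phi>_def g_def)
qed

lemma norm_exp_divided_difference_le:
  assumes "finite S" "S \<noteq> {}" "\<And>e. e \<in> S \<Longrightarrow> e \<ge> 0" "Re z \<le> 0"
  shows "norm (exp_divided_difference S z) \<le> norm z ^ (card S - 1) / fact (card S - 1)"
  using norm_exp_divided_difference_le_aux[OF assms, of 1] by simp

section \<open>Pade approximation of roots\<close>

lemma multiplicity_fact_le:
  assumes "prime (p :: int)"
  shows "multiplicity p (fact k) \<le> k"
proof -
  define v where "v i = multiplicity p (int i)" for i
  obtain p' where p': "p = int p'" using assms by (metis prime_ge_0_int zero_le_imp_eq_int)
  have p2: "p' \<ge> 2" using prime_ge_2_int[OF assms] p' by simp
  have v_mult: "v (p' * j) = Suc (v j)" if "j > 0" for j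
    using that assms p2 unfolding v_def p' of_nat_mult
    by (subst multiplicity_times_same) (auto simp: not_prime_unit)
  have fact: "multiplicity p (fact n) = (\<Sum>i\<in>{1..n}. v i)" for n
  proof (induction n)
    case (Suc n)
    have "multiplicity p (fact (Suc n)) = v (Suc n) + multiplicity p (fact n)"
      unfolding fact_Suc v_def using assms
      by (subst prime_elem_multiplicity_mult_distrib) auto
    with Suc show ?case by simp
  qed auto
  \<comment> \<open>Legendre's recursion: only the \<open>q = k div p'\<close> multiples of
    \<open>p'\<close> contribute, each contributes one more than its cofactor, and the cofactors
    contribute at most \<open>q\<close> by induction.\<close>
  have "(\<Sum>i\<in>{1..k}. v i) \<le> k"
  proof (induction k rule: less_induct)
    case (less k)
    show ?case
    proof (cases "k = 0")
      case False
      define q where "q = k div p'"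
      have "(\<Sum>i\<in>{1..k}. v i) = (\<Sum>i\<in>(\<lambda>j. p' * j) ` {1..q}. v i)"
      proof (rule sum.mono_neutral_right)
        show "(\<lambda>j. p' * j) ` {1..q} \<subseteq> {1..k}"
          using p2 by (auto simp: q_def less_eq_div_iff_mult_less_eq mult.commute)
        show "\<forall>i\<in>{1..k} - (\<lambda>j. p' * j) ` {1..q}. v i = 0"
        proof
          fix i assume i: "i \<in> {1..k} - (\<lambda>j. p' * j) ` {1..q}"
          have "\<not> p' dvd i"
          proof
            assume "p' dvd i"
            then obtain j where j: "i = p' * j" by auto
            with i p2 have "j \<in> {1..q}"
              by (auto simp: q_def less_eq_div_iff_mult_less_eq mult.commute)
            with i j show False by auto
          qed
          then show "v i = 0" unfolding v_def p' by (intro not_dvd_imp_multiplicity_0) auto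
        qed
      qed auto
      also have "\<dots> = (\<Sum>j\<in>{1..q}. Suc (v j))"
        using p2 by (subst sum.reindex) (auto simp: inj_on_def v_mult intro!: sum.cong)
      also have "\<dots> = q + (\<Sum>j\<in>{1..q}. v j)"
        unfolding Suc_eq_plus1_left sum.distrib by simp
      also have "\<dots> \<le> q + q" using less.IH[of q] False p2 by (simp add: q_def)
      also have "\<dots> \<le> k"
      proof -
        have "q + q \<le> p' * q" using mult_le_mono1[OF p2, of q] by linarith
        also have "\<dots> \<le> k" by (simp add: q_def)
        finally show ?thesis .
      qed
      finally show ?thesis .
    qed auto
  qed
  with fact show ?thesis by simp
qed

lemma fact_dvd_prod_int: "fact k dvd (\<Prod>i<k. (b :: int) - int i)"
proof -
  have "(\<Prod>i<k. b - int i) = pochhammer (b - int k + 1) k"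
    unfolding pochhammer_prod
    by (rule prod.reindex_bij_witness[where i = "\<lambda>i. k - 1 - i" and j = "\<lambda>i. k - 1 - i"])
      (auto simp: of_nat_diff)
  then show ?thesis by (simp add: fact_dvd_pochhammer)
qed

text \<open>
  Primes dividing \<open>r\<close> are absorbed by the power of \<open>r\<close>; modulo a power of any other prime \<open>r\<close> is
  invertible and the product is a multiple of a product of \<open>k\<close> consecutive integers.
\<close>

lemma fact_dvd_arith_prog:
  fixes a r :: int
  shows "fact k dvd r ^ k * (\<Prod>i<k. a - int i * r)"
proof (cases "r ^ k * (\<Prod>i<k. a - int i * r) = 0")
  case False
  let ?P = "\<Prod>i<k. a - int i * r"
  show ?thesis
  proof (rule multiplicity_le_imp_dvd)
    fix p :: int assume p: "prime p"
    let ?m = "multiplicity p (fact k :: int)"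
    have "p ^ ?m dvd r ^ k * ?P"
    proof (cases "p dvd r")
      case True
      then have "p ^ k dvd r ^ k" by (rule dvd_power_same)
      moreover have "p ^ ?m dvd p ^ k"
        using multiplicity_fact_le[OF p] by (rule le_imp_power_dvd)
      ultimately show ?thesis by (meson dvd_mult2 dvd_trans)
    next
      case False
      then have "coprime (p ^ ?m) r" using p by (simp add: prime_imp_coprime)
      then obtain u w where uw: "u * p ^ ?m + w * r = 1"
        using bezout_int[of "p ^ ?m" r] by (auto simp: coprime_iff_gcd_eq_1)
      define b where "b = a * w"
      have cong: "(a - int i * r) mod p ^ ?m = ((b - int i) * r) mod p ^ ?m" for i
      proof -
        have "a = a * (u * p ^ ?m + w * r)" using uw by simp
        then have "a - int i * r = (b - int i) * r + (a * u) * p ^ ?m"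
          by (simp add: b_def algebra_simps)
        then show ?thesis by (metis mod_mult_self1)
      qed
      have "?P mod p ^ ?m = (\<Prod>i<k. (a - int i * r) mod p ^ ?m) mod p ^ ?m"
        by (simp only: mod_prod_eq)
      also have "\<dots> = (\<Prod>i<k. (b - int i) * r) mod p ^ ?m"
        by (simp only: cong mod_prod_eq)
      also have "\<dots> = 0"
        using fact_dvd_prod_int[of k b] multiplicity_dvd[of p "fact k :: int"]
        by (auto simp: prod.distrib intro!: dvd_mult2 elim: dvd_trans)
      finally show ?thesis by auto
    qed
    then show "?m \<le> multiplicity p (r ^ k * ?P)" using False p by (intro multiplicity_geI) auto
  qed auto
qed (metis dvd_0_right)

text \<open>One factor \<open>r ^ k\<close> clears the denominators of \<open>a / r - i\<close>, the
  other makes the resulting product divisible by \<open>fact k\<close>; hence the exponent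
  \<open>2 * k\<close>.\<close>

lemma power_mult_gbinomial_Ints:
  fixes a :: int
  assumes "r > 0"
  shows "of_nat r ^ (2 * k) * ((of_int a / of_nat r) gchoose k) \<in> (\<int> :: real set)"
proof -
  obtain c where c: "int r ^ k * (\<Prod>i<k. a - int i * int r) = fact k * c"
    using fact_dvd_arith_prog[of k "int r" a] by (auto elim: dvdE)
  have "real r ^ (2 * k) * (\<Prod>i<k. of_int a / real r - real i) =
    real r ^ k * (\<Prod>i<k. real r * (of_int a / real r - real i))"
    by (simp add: prod.distrib mult_2 power_add)
  also have "(\<Prod>i<k. real r * (of_int a / real r - real i)) = (\<Prod>i<k. of_int (a - int i * int r))"
    using assms by (intro prod.cong) (auto simp: field_simps)
  also have "real r ^ k * (\<Prod>i<k. of_int (a - int i * int r)) =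
     of_int (int r ^ k * (\<Prod>i<k. a - int i * int r))"
    by simp
  finally have "real r ^ (2 * k) * (\<Prod>i<k. of_int a / real r - real i) = fact k * of_int c"
    unfolding c by simp
  then have "real r ^ (2 * k) * ((of_int a / real r) gchoose k) = of_int c"
    by (simp add: gbinomial_prod_rev atLeast0LessThan)
  then show ?thesis by simp
qed

text \<open>
  The polynomials \<open>A(w) = \<Sum>k\<le>n. pade \<nu> n k * w ^ k\<close> and \<open>B(w) = \<Sum>k\<le>n. pade \<nu> n (n - k) * w ^ k\<close>
  are the diagonal Pade approximants \<open>A / B\<close> of \<open>w powr \<nu>\<close> at \<open>w = 1\<close>.
\<close>

definition pade :: "real \<Rightarrow> nat \<Rightarrow> nat \<Rightarrow> real" where
  "pade \<nu> n k = ((real n + \<nu>) gchoose k) * ((real n - \<nu>) gchoose (n - k))"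

definition pade_A :: "real \<Rightarrow> nat \<Rightarrow> complex \<Rightarrow> complex" where
  "pade_A \<nu> n w = (\<Sum>k\<le>n. of_real (pade \<nu> n k) * w ^ k)"

definition pade_B :: "real \<Rightarrow> nat \<Rightarrow> complex \<Rightarrow> complex" where
  "pade_B \<nu> n w = (\<Sum>k\<le>n. of_real (pade \<nu> n (n - k)) * w ^ k)"

lemma pade_uminus: "k \<le> n \<Longrightarrow> pade (- \<nu>) n k = pade \<nu> n (n - k)"
  by (simp add: pade_def)

text \<open>The exponents \<open>2 * k\<close> and \<open>2 * (n - k)\<close> belonging to the two
  binomial coefficients add up to \<open>2 * n\<close>, so one multiplier serves all
  coefficients.\<close>

lemma pade_Ints:
  assumes "r > 0" "k \<le> n"
  shows "real r ^ (2 * n) * pade (1 / real r) n k \<in> \<int>"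
proof -
  have "real n + 1 / real r = of_int (int n * int r + 1) / real r"
    "real n - 1 / real r = of_int (int n * int r - 1) / real r"
    using assms by (auto simp: field_simps)
  then have "(real r ^ (2 * k) * ((real n + 1 / real r) gchoose k)) *
    (real r ^ (2 * (n - k)) * ((real n - 1 / real r) gchoose (n - k))) \<in> \<int>"
    using power_mult_gbinomial_Ints[OF assms(1)] by (metis Ints_mult)
  moreover have "real r ^ (2 * n) = real r ^ (2 * k) * real r ^ (2 * (n - k))"
    using assms by (simp flip: power_add add: algebra_simps)
  ultimately show ?thesis by (simp add: pade_def mult_ac)
qed

lemma pade_pos:
  assumes "\<bar>\<nu>\<bar> < 1" "k \<le> n"
  shows "pade \<nu> n k > 0"
  unfolding pade_def gbinomial_prod_rev
  using assms by (intro mult_pos_pos divide_pos_pos prod_pos) auto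

lemma sum_pade: "(\<Sum>k\<le>n. pade \<nu> n k) = real ((2 * n) choose n)"
  using gbinomial_Vandermonde[of "real n + \<nu>" "real n - \<nu>" n]
  by (simp add: pade_def atLeast0AtMost binomial_gbinomial flip: mult_2)

text \<open>The coefficients are positive, so on the unit disc the norm is at most their sum, a
  central binomial coefficient by Vandermonde's identity.\<close>

lemma norm_pade_A_le:
  assumes "\<bar>\<nu>\<bar> < 1" "norm w \<le> 1"
  shows "norm (pade_A \<nu> n w) \<le> 4 ^ n"
proof -
  have "norm (pade_A \<nu> n w) \<le> (\<Sum>k\<le>n. pade \<nu> n k * 1)"
    unfolding pade_A_def
    using pade_pos[OF assms(1)] assms(2)
    by (intro sum_norm_le) (auto simp: norm_mult norm_power less_imp_le abs_of_pos power_le_one mult_left_le)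
  also have "\<dots> = real ((2 * n) choose n)" by (simp add: sum_pade)
  also have "\<dots> \<le> real (2 ^ (2 * n))" by (intro of_nat_mono binomial_le_pow2)
  also have "\<dots> = 4 ^ n" by (simp add: power_mult)
  finally show ?thesis .
qed

lemma norm_pade_B_le:
  assumes "\<bar>\<nu>\<bar> < 1" "norm w \<le> 1"
  shows "norm (pade_B \<nu> n w) \<le> 4 ^ n"
proof -
  have "pade_B \<nu> n w = pade_A (- \<nu>) n w"
    unfolding pade_A_def pade_B_def by (intro sum.cong) (auto simp: pade_uminus)
  then show ?thesis using norm_pade_A_le[of "- \<nu>" w n] assms by simp
qed

lemma prod_diff_nodes:
  assumes "k \<le> n"
  shows "(\<Prod>i\<in>{..n} - {k}. real k - real i) = (- 1) ^ (n - k) * fact k * fact (n - k)"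
proof -
  have "{..n} - {k} = {..<k} \<union> {k<..n}" using assms by auto
  then have "(\<Prod>i\<in>{..n} - {k}. real k - real i) =
    (\<Prod>i<k. real k - real i) * (\<Prod>i\<in>{k<..n}. real k - real i)"
    by (simp add: prod.union_disjoint Int_def)
  also have "(\<Prod>i<k. real k - real i) = (\<Prod>i\<in>{1..k}. real i)"
    by (rule prod.reindex_bij_witness[where i = "\<lambda>i. k - i" and j = "\<lambda>i. k - i"]) (auto simp: of_nat_diff)
  also have "(\<Prod>i\<in>{k<..n}. real k - real i) = (\<Prod>i\<in>{1..n - k}. (- 1) * real i)"
    by (rule prod.reindex_bij_witness[where i = "\<lambda>i. k + i" and j = "\<lambda>i. i - k"]) (auto simp: of_nat_diff)
  also have "\<dots> = (- 1) ^ (n - k) * (\<Prod>i\<in>{1..n - k}. real i)"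
    by (subst prod.distrib) simp
  finally show ?thesis by (simp add: fact_prod)
qed

text \<open>For the nodes \<open>i\<close> and \<open>i + \<nu>\<close> with
  \<open>i \<le> n\<close>, the bracket is the Lagrange denominator at \<open>k\<close>. As the
  right-hand side is independent of \<open>k\<close>, the Pade coefficients are, up to a constant,
  the weights of a divided difference.\<close>

lemma pade_mult_nodes:
  assumes "k \<le> n"
  shows "pade \<nu> n k * ((\<Prod>i\<in>{..n} - {k}. real k - real i) * (\<Prod>i\<le>n. real k - real i - \<nu>)) =
    (\<Prod>l\<le>n. real l - \<nu>) * (\<Prod>l\<in>{1..n}. real l + \<nu>)"
proof -
  have "(\<Prod>i\<le>n. real k - real i - \<nu>) = (\<Prod>i\<le>k. real k - real i - \<nu>) * (\<Prod>i\<in>{k<..n}. real k - real i - \<nu>)"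
    using assms by (subst prod.union_disjoint[symmetric]) (auto intro!: prod.cong)
  also have "(\<Prod>i\<le>k. real k - real i - \<nu>) = (\<Prod>l\<le>k. real l - \<nu>)"
    by (rule prod.reindex_bij_witness[where i = "\<lambda>i. k - i" and j = "\<lambda>i. k - i"]) (auto simp: of_nat_diff)
  also have "(\<Prod>i\<in>{k<..n}. real k - real i - \<nu>) = (\<Prod>l\<in>{1..n - k}. (- 1) * (real l + \<nu>))"
    by (rule prod.reindex_bij_witness[where i = "\<lambda>i. k + i" and j = "\<lambda>i. i - k"]) (auto simp: of_nat_diff)
  also have "\<dots> = (- 1) ^ (n - k) * (\<Prod>l\<in>{1..n - k}. real l + \<nu>)"
    by (subst prod.distrib) simp
  finally have 1: "(\<Prod>i\<le>n. real k - real i - \<nu>) =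
    (\<Prod>l\<le>k. real l - \<nu>) * ((- 1) ^ (n - k) * (\<Prod>l\<in>{1..n - k}. real l + \<nu>))" .
  have "fact k * ((real n + \<nu>) gchoose k) = (\<Prod>i<k. real n + \<nu> - real i)"
    by (simp add: gbinomial_mult_fact atLeast0LessThan)
  also have "\<dots> = (\<Prod>l\<in>{n - k<..n}. real l + \<nu>)"
    using assms
    by (intro prod.reindex_bij_witness[where i = "\<lambda>i. n - i" and j = "\<lambda>i. n - i"]) (auto simp: of_nat_diff)
  finally have 2: "fact k * ((real n + \<nu>) gchoose k) = (\<Prod>l\<in>{n - k<..n}. real l + \<nu>)" .
  have "fact (n - k) * ((real n - \<nu>) gchoose (n - k)) = (\<Prod>i<n - k. real n - \<nu> - real i)"
    by (simp add: gbinomial_mult_fact atLeast0LessThan)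
  also have "\<dots> = (\<Prod>l\<in>{k<..n}. real l - \<nu>)"
    using assms
    by (intro prod.reindex_bij_witness[where i = "\<lambda>i. n - i" and j = "\<lambda>i. n - i"]) (auto simp: of_nat_diff)
  finally have 3: "fact (n - k) * ((real n - \<nu>) gchoose (n - k)) = (\<Prod>l\<in>{k<..n}. real l - \<nu>)" .
  have "(\<Prod>l\<le>n. real l - \<nu>) = (\<Prod>l\<le>k. real l - \<nu>) * (\<Prod>l\<in>{k<..n}. real l - \<nu>)"
    using assms by (subst prod.union_disjoint[symmetric]) (auto intro!: prod.cong)
  moreover have "(\<Prod>l\<in>{1..n}. real l + \<nu>) = (\<Prod>l\<in>{1..n - k}. real l + \<nu>) * (\<Prod>l\<in>{n - k<..n}. real l + \<nu>)"
    using assms by (subst prod.union_disjoint[symmetric]) (auto intro!: prod.cong)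
  moreover have "(- 1) ^ (n - k) * ((- 1) ^ (n - k) :: real) = 1"
    by (simp flip: power_add mult_2)
  ultimately show ?thesis
    unfolding prod_diff_nodes[OF assms] 1 2[symmetric] 3[symmetric] pade_def
    by (simp add: mult_ac)
qed

text \<open>The remainder is exactly \<open>N\<close> times the divided difference over the
  \<open>2 * n + 2\<close> nodes \<open>k\<close> and \<open>k + \<nu>\<close>. The factor \<nu> in
  the bound is the \<open>l = 0\<close> factor of \<open>N\<close>; the two factorials bounding the
  rest of \<open>N\<close> are beaten by \<open>fact (2 * n + 1)\<close>.\<close>

lemma pade_remainder:
  assumes \<nu>: "0 < \<nu>" "\<nu> < 1" and z: "Re z \<le> 0"
  shows "norm (pade_A \<nu> n (exp z) - exp (of_real \<nu> * z) * pade_B \<nu> n (exp z)) \<le> \<nu> * norm z ^ (2 * n + 1)"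
proof -
  define N where "N = (\<Prod>l\<le>n. real l - \<nu>) * (\<Prod>l\<in>{1..n}. real l + \<nu>)"
  define S1 where "S1 = real ` {..n}"
  define S2 where "S2 = (\<lambda>k. real k + \<nu>) ` {..n}"
  define S where "S = S1 \<union> S2"
  have atMost: "{..n} = insert 0 {1..n}" by auto
  \<comment> \<open>The nodes \<open>k + \<nu>\<close> are handled by replacing \<nu> with
    \<open>- \<nu>\<close>. Only the factor for \<open>l = 0\<close> changes sign, which yields the
    minus sign in front of the \<open>B\<close> term.\<close>
  have N': "(\<Prod>l\<le>n. real l + \<nu>) * (\<Prod>l\<in>{1..n}. real l - \<nu>) = - N"
    unfolding N_def atMost by simp
  have N_eq: "N = - \<nu> * (\<Prod>l\<in>{1..n}. (real l - \<nu>) * (real l + \<nu>))"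
    unfolding N_def atMost by (simp add: prod.distrib)
  have pos: "(real l - \<nu>) * (real l + \<nu>) > 0" if "l \<in> {1..n}" for l
    using that \<nu> by (intro mult_pos_pos) auto
  have N0: "N \<noteq> 0" unfolding N_eq using \<nu> pos by (auto simp: prod_zero_iff simp del: mult_eq_0_iff)
  have "(\<Prod>l\<in>{1..n}. (real l - \<nu>) * (real l + \<nu>)) \<le> (\<Prod>l\<in>{1..n}. real l * real l)"
  proof (rule prod_mono)
    fix l assume l: "l \<in> {1..n}"
    have "(real l - \<nu>) * (real l + \<nu>) = real l * real l - \<nu> * \<nu>" by (simp add: algebra_simps)
    then show "0 \<le> (real l - \<nu>) * (real l + \<nu>) \<and> (real l - \<nu>) * (real l + \<nu>) \<le> real l * real l"
      using pos[OF l] by simp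
  qed
  also have "\<dots> = fact n * fact n" by (simp add: prod.distrib fact_prod)
  finally have prod_le: "(\<Prod>l\<in>{1..n}. (real l - \<nu>) * (real l + \<nu>)) \<le> fact n * fact n" .
  have N_le: "\<bar>N\<bar> \<le> \<nu> * (fact n * fact n)"
  proof -
    have "(\<Prod>l\<in>{1..n}. (real l - \<nu>) * (real l + \<nu>)) > 0" by (rule prod_pos) (rule pos)
    then have "\<bar>N\<bar> = \<nu> * (\<Prod>l\<in>{1..n}. (real l - \<nu>) * (real l + \<nu>))"
      unfolding N_eq abs_mult abs_minus_cancel using \<nu> by simp
    with prod_le \<nu> show ?thesis by simp
  qed
  have frac: "real i \<noteq> real j + \<nu>" for i j
  proof
    assume "real i = real j + \<nu>"
    with \<nu> have "real j < real i" "real i < real (Suc j)" by auto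
    then show False unfolding of_nat_less_iff by linarith
  qed
  have disj: "S1 \<inter> S2 = {}" using frac by (auto simp: S1_def S2_def)
  have fin: "finite S1" "finite S2" by (auto simp: S1_def S2_def)
  have inj: "inj_on real A" "inj_on (\<lambda>k. real k + \<nu>) A" for A by (auto simp: inj_on_def)
  have card: "card S = 2 * n + 2"
    unfolding S_def using card_Un_disjoint[OF fin disj] inj by (simp add: S1_def S2_def card_image)
  have P1: "of_real N * (exp (of_real (real k) * z) / of_real (\<Prod>e'\<in>S - {real k}. real k - e')) =
      of_real (pade \<nu> n k) * exp z ^ k" if k: "k \<le> n" for k
  proof -
    have "S - {real k} = real ` ({..n} - {k}) \<union> (\<lambda>k. real k + \<nu>) ` {..n}"
      using frac by (auto simp: S_def S1_def S2_def)
    then have "(\<Prod>e'\<in>S - {real k}. real k - e') =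
       (\<Prod>e'\<in>real ` ({..n} - {k}). real k - e') * (\<Prod>e'\<in>(\<lambda>k. real k + \<nu>) ` {..n}. real k - e')"
      using frac by (simp only:) (rule prod.union_disjoint, auto)
    also have "\<dots> = (\<Prod>i\<in>{..n} - {k}. real k - real i) * (\<Prod>i\<le>n. real k - real i - \<nu>)"
      using inj by (simp add: prod.reindex algebra_simps)
    finally have "pade \<nu> n k * (\<Prod>e'\<in>S - {real k}. real k - e') = N"
      using pade_mult_nodes[OF k] by (simp add: N_def)
    then have "of_real N = of_real (pade \<nu> n k) * complex_of_real (\<Prod>e'\<in>S - {real k}. real k - e')"
      "complex_of_real (\<Prod>e'\<in>S - {real k}. real k - e') \<noteq> 0"
      using N0 by (auto simp flip: of_real_mult simp del: of_real_prod)
    then show ?thesis by (simp add: exp_of_nat_mult del: of_real_prod)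
  qed
  have P2: "of_real N * (exp (of_real (real k + \<nu>) * z) / of_real (\<Prod>e'\<in>S - {real k + \<nu>}. real k + \<nu> - e')) =
      - (exp (of_real \<nu> * z) * (of_real (pade \<nu> n (n - k)) * exp z ^ k))" if k: "k \<le> n" for k
  proof -
    have "S - {real k + \<nu>} = real ` {..n} \<union> (\<lambda>k. real k + \<nu>) ` ({..n} - {k})"
      using frac frac[symmetric] by (auto simp: S_def S1_def S2_def image_iff)
    then have "(\<Prod>e'\<in>S - {real k + \<nu>}. real k + \<nu> - e') =
       (\<Prod>e'\<in>real ` {..n}. real k + \<nu> - e') * (\<Prod>e'\<in>(\<lambda>k. real k + \<nu>) ` ({..n} - {k}). real k + \<nu> - e')"
      using frac by (simp only:) (rule prod.union_disjoint, auto)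
    also have "\<dots> = (\<Prod>i\<le>n. real k - real i - (- \<nu>)) * (\<Prod>i\<in>{..n} - {k}. real k - real i)"
      using inj by (simp add: prod.reindex algebra_simps)
    finally have "pade \<nu> n (n - k) * (\<Prod>e'\<in>S - {real k + \<nu>}. real k + \<nu> - e') = - N"
      using pade_mult_nodes[OF k, of "- \<nu>"] N' k by (simp add: pade_uminus mult.commute)
    then have "of_real N = - (of_real (pade \<nu> n (n - k)) * complex_of_real (\<Prod>e'\<in>S - {real k + \<nu>}. real k + \<nu> - e'))"
      "complex_of_real (\<Prod>e'\<in>S - {real k + \<nu>}. real k + \<nu> - e') \<noteq> 0"
      using N0 by (auto simp flip: of_real_mult simp del: of_real_prod)
    moreover have "exp (of_real (real k + \<nu>) * z) = exp (of_real \<nu> * z) * exp z ^ k"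
      by (simp add: ring_distribs exp_add exp_of_nat_mult)
    ultimately show ?thesis by (simp del: of_real_prod of_real_add)
  qed
  have "of_real N * exp_divided_difference S z =
     (\<Sum>k\<le>n. of_real N * (exp (of_real (real k) * z) / of_real (\<Prod>e'\<in>S - {real k}. real k - e'))) +
     (\<Sum>k\<le>n. of_real N * (exp (of_real (real k + \<nu>) * z) / of_real (\<Prod>e'\<in>S - {real k + \<nu>}. real k + \<nu> - e')))"
  proof -
    have "of_real N * exp_divided_difference S z =
      (\<Sum>e\<in>S1. of_real N * (exp (of_real e * z) / of_real (\<Prod>e'\<in>S - {e}. e - e'))) +
      (\<Sum>e\<in>S2. of_real N * (exp (of_real e * z) / of_real (\<Prod>e'\<in>S - {e}. e - e')))"
      unfolding exp_divided_difference_def sum_distrib_left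
      by (subst (1) S_def) (rule sum.union_disjoint[OF fin disj])
    then show ?thesis
      unfolding S1_def S2_def sum.reindex[OF inj(1)] sum.reindex[OF inj(2)] o_def .
  qed
  also have "\<dots> = (\<Sum>k\<le>n. of_real (pade \<nu> n k) * exp z ^ k) +
     (\<Sum>k\<le>n. - (exp (of_real \<nu> * z) * (of_real (pade \<nu> n (n - k)) * exp z ^ k)))"
    using P1 P2 by (intro arg_cong2[where f = "(+)"] sum.cong) auto
  also have "\<dots> = pade_A \<nu> n (exp z) - exp (of_real \<nu> * z) * pade_B \<nu> n (exp z)"
    unfolding pade_A_def pade_B_def by (simp add: sum_negf sum_distrib_left)
  finally have "norm (pade_A \<nu> n (exp z) - exp (of_real \<nu> * z) * pade_B \<nu> n (exp z)) =
    \<bar>N\<bar> * norm (exp_divided_difference S z)"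
    by (metis norm_mult norm_of_real)
  also have "norm (exp_divided_difference S z) \<le> norm z ^ (2 * n + 1) / fact (2 * n + 1)"
  proof -
    have "norm (exp_divided_difference S z) \<le> norm z ^ (card S - 1) / fact (card S - 1)"
      using \<nu> fin z by (intro norm_exp_divided_difference_le) (auto simp: S_def S1_def S2_def)
    moreover have "card S - 1 = 2 * n + 1" using card by simp
    ultimately show ?thesis by metis
  qed
  also have "\<bar>N\<bar> * (norm z ^ (2 * n + 1) / fact (2 * n + 1)) \<le>
     (\<nu> * (fact n * fact n)) * (norm z ^ (2 * n + 1) / fact (2 * n + 1))"
    by (intro mult_right_mono N_le) auto
  also have "\<dots> \<le> \<nu> * norm z ^ (2 * n + 1)"
  proof -
    have "fact n * fact n \<le> (fact (n + n) :: nat)"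
      by (rule dvd_imp_le[OF fact_fact_dvd_fact]) simp
    also have "\<dots> \<le> fact (2 * n + 1)" by (intro fact_mono) simp
    finally have "(fact n * fact n :: real) \<le> fact (2 * n + 1)"
      by (metis of_nat_fact of_nat_le_iff of_nat_mult)
    then have "(fact n * fact n) / fact (2 * n + 1) \<le> (1 :: real)"
      by (subst pos_divide_le_eq) auto
    then have "(fact n * fact n) / fact (2 * n + 1) * (\<nu> * norm z ^ (2 * n + 1)) \<le> 1 * (\<nu> * norm z ^ (2 * n + 1))"
      using \<nu> by (intro mult_right_mono) auto
    then show ?thesis by (simp add: mult_ac)
  qed
  finally show ?thesis by (simp add: mult_left_mono)
qed

text \<open>The order of vanishing at \<open>1\<close> is read off along the curve
  \<open>exp (- t)\<close>: if the order \<open>k\<close> were below \<open>m\<close>, the cofactor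
  would be bounded by a multiple of \<open>t\<close>, although it is nonzero at \<open>1\<close>.
  The factor \<open>2 ^ k\<close> stems from \<open>1 - exp (- t) \<ge> t / 2\<close>.\<close>

lemma power_dvd_of_exp_bound:
  fixes p :: "complex poly"
  assumes bound: "\<And>t. 0 < t \<Longrightarrow> t \<le> 1 \<Longrightarrow> norm (poly p (of_real (exp (- t)))) \<le> C * t ^ m"
  shows "[:- 1, 1:] ^ m dvd p"
proof (cases "p = 0")
  case False
  define k where "k = order 1 p"
  obtain q where q: "p = [:- 1, 1:] ^ k * q" "\<not> [:- 1, 1:] dvd q"
    using order_decomp[OF False, of 1] by (auto simp: k_def)
  have q1: "poly q 1 \<noteq> 0" using q(2) by (simp add: poly_eq_0_iff_dvd)
  show ?thesis
  proof (cases "m \<le> k")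
    case True
    then show ?thesis unfolding q(1) by (intro dvd_mult2 le_imp_power_dvd)
  next
    case False
    have le: "norm (poly q (of_real (exp (- t)))) \<le> \<bar>C\<bar> * 2 ^ k * t" if t: "0 < t" "t \<le> 1" for t
    proof -
      have "exp (- t) \<le> 1 / (1 + t)"
        using exp_ge_add_one_self[of t] t by (simp add: exp_minus field_simps)
      also have "\<dots> \<le> 1 - t / 2" using t by (simp add: field_simps)
      finally have e: "t / 2 \<le> 1 - exp (- t)" by simp
      have "(t / 2) ^ k * norm (poly q (of_real (exp (- t)))) \<le>
         (1 - exp (- t)) ^ k * norm (poly q (of_real (exp (- t))))"
        using e t by (intro mult_right_mono power_mono) auto
      also have "\<dots> = norm (poly p (of_real (exp (- t))))"
      proof -
        have "norm (- 1 + complex_of_real (exp (- t))) = 1 - exp (- t)"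
          using e t by (metis (no_types, opaque_lifting) abs_minus_commute abs_of_nonneg add.commute diff_ge_0_iff_ge
             divide_nonneg_nonneg less_eq_real_def norm_of_real of_real_1 of_real_diff order_trans uminus_add_conv_diff zero_le_numeral)
        then show ?thesis unfolding q(1) by (simp add: norm_mult norm_power)
      qed
      also have "\<dots> \<le> C * t ^ m" by (rule bound[OF t])
      also have "\<dots> \<le> \<bar>C\<bar> * t ^ Suc k"
        using t False by (intro mult_mono power_decreasing) auto
      finally have "t ^ k * norm (poly q (of_real (exp (- t)))) \<le> t ^ k * (\<bar>C\<bar> * 2 ^ k * t)"
        by (simp add: field_simps)
      then show ?thesis using t by simp
    qed
    have lim: "((\<lambda>t. poly q (of_real (exp (- t)))) \<longlongrightarrow> poly q 1) (at_right (0::real))"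
      by (rule tendsto_eq_intros refl | simp)+
    have "((\<lambda>t. poly q (of_real (exp (- t)))) \<longlongrightarrow> 0) (at_right (0::real))"
    proof (rule Lim_null_comparison)
      show "\<forall>\<^sub>F t in at_right 0. norm (poly q (of_real (exp (- t)))) \<le> \<bar>C\<bar> * 2 ^ k * t"
        by (rule eventually_mono[OF eventually_at_right_real[of 0 1]]) (auto intro: le)
      show "((\<lambda>t. \<bar>C\<bar> * 2 ^ k * t) \<longlongrightarrow> 0) (at_right 0)"
        by (rule tendsto_eq_intros refl | simp)+
    qed
    then have "poly q 1 = 0" using tendsto_unique[OF _ lim] by simp
    with q1 show ?thesis by simp
  qed
qed auto

text \<open>
  The determinant is a polynomial of degree \<open>2 * n + 1\<close> in \<open>w\<close> that vanishes to order \<open>2 * n + 1\<close> at \<open>1\<close>.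
\<close>

lemma pade_det_nonzero:
  assumes \<nu>: "0 < \<nu>" "\<nu> < 1" and w: "w \<noteq> 1"
  shows "pade_A \<nu> n w * pade_B \<nu> (Suc n) w \<noteq> pade_A \<nu> (Suc n) w * pade_B \<nu> n w"
proof -
  define PA where "PA n = (\<Sum>k\<le>n. monom (complex_of_real (pade \<nu> n k)) k)" for n
  define PB where "PB n = (\<Sum>k\<le>n. monom (complex_of_real (pade \<nu> n (n - k))) k)" for n
  have polyA: "poly (PA n) x = pade_A \<nu> n x" for n x
    by (simp add: PA_def pade_A_def poly_sum poly_monom)
  have polyB: "poly (PB n) x = pade_B \<nu> n x" for n x
    by (simp add: PB_def pade_B_def poly_sum poly_monom)
  have coeffA: "coeff (PA n) k = (if k \<le> n then of_real (pade \<nu> n k) else 0)" for n k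
    by (simp add: PA_def coeff_sum if_distrib sum.delta cong: if_cong)
  have coeffB: "coeff (PB n) k = (if k \<le> n then of_real (pade \<nu> n (n - k)) else 0)" for n k
    by (simp add: PB_def coeff_sum if_distrib sum.delta cong: if_cong)
  have degA: "degree (PA n) = n" for n
    using \<nu> pade_pos[of \<nu> n n] by (intro antisym degree_le le_degree) (auto simp: coeffA)
  have degB: "degree (PB n) = n" for n
    using \<nu> pade_pos[of \<nu> 0 n] by (intro antisym degree_le le_degree) (auto simp: coeffB)
  define P where "P = PA n * PB (Suc n) - PA (Suc n) * PB n"
  have degP: "degree P \<le> 2 * n + 1"
    unfolding P_def
    by (intro degree_diff_le order_trans[OF degree_mult_le]) (auto simp: degA degB)
  have alg: "X * (Y * ((c - \<nu>) / c)) - X * ((c + \<nu>) / c) * Y = - (X * Y * (2 * \<nu> / c))" for X Y c :: real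
    by (simp add: diff_divide_distrib add_divide_distrib algebra_simps)
  \<comment> \<open>From \<open>n\<close> to \<open>Suc n\<close> the leading coefficients of
    \<open>PA\<close> and \<open>PB\<close> grow by the unequal ratios
    \<open>(n + 1 + \<nu>) / (n + 1)\<close> and \<open>(n + 1 - \<nu>) / (n + 1)\<close>, so the
    two products do not cancel.\<close>
  have "coeff P (2 * n + 1) = of_real (pade \<nu> n n * pade \<nu> (Suc n) 0 - pade \<nu> (Suc n) (Suc n) * pade \<nu> n 0)"
    using coeff_mult_degree_sum[of "PA n" "PB (Suc n)"] coeff_mult_degree_sum[of "PA (Suc n)" "PB n"]
    by (simp add: P_def degA degB coeffA coeffB mult_2)
  also have "pade \<nu> (Suc n) 0 = pade \<nu> n 0 * ((real n + 1 - \<nu>) / (real n + 1))"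
    using gbinomial_factors[of "real n - \<nu>" n] by (simp add: pade_def algebra_simps)
  also have "pade \<nu> (Suc n) (Suc n) = pade \<nu> n n * ((real n + 1 + \<nu>) / (real n + 1))"
    using gbinomial_factors[of "real n + \<nu>" n] by (simp add: pade_def algebra_simps)
  also have "pade \<nu> n n * (pade \<nu> n 0 * ((real n + 1 - \<nu>) / (real n + 1))) -
      pade \<nu> n n * ((real n + 1 + \<nu>) / (real n + 1)) * pade \<nu> n 0 =
      - (pade \<nu> n n * pade \<nu> n 0 * (2 * \<nu> / (real n + 1)))"
    by (rule alg)
  also have "complex_of_real (- (pade \<nu> n n * pade \<nu> n 0 * (2 * \<nu> / (real n + 1)))) \<noteq> 0"
    unfolding of_real_eq_0_iff
    using \<nu> pade_pos[of \<nu> n n] pade_pos[of \<nu> 0 n] \<nu> by simp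
  finally have coeffP: "coeff P (2 * n + 1) \<noteq> 0" .
  then have P0: "P \<noteq> 0" by auto
  have "[:- 1, 1:] ^ (2 * n + 1) dvd P"
  proof (rule power_dvd_of_exp_bound[where C = "4 ^ Suc n + 4 ^ n"])
    fix t :: real assume t: "0 < t" "t \<le> 1"
    define x where "x = complex_of_real (exp (- t))"
    have x: "x = exp (of_real (- t))" "norm x \<le> 1"
      using t by (simp_all add: x_def flip: exp_of_real)
    define e where "e = exp (complex_of_real \<nu> * of_real (- t))"
    define R where "R n = pade_A \<nu> n x - e * pade_B \<nu> n x" for n
    have R: "norm (R k) \<le> t ^ (2 * n + 1)" if "k \<ge> n" for k
    proof -
      have "norm (R k) \<le> \<nu> * norm (complex_of_real (- t)) ^ (2 * k + 1)"
        using pade_remainder[OF \<nu>, of "of_real (- t)" k] t by (simp add: R_def x e_def)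
      also have "\<dots> \<le> 1 * t ^ (2 * n + 1)"
        using \<nu> t that by (intro mult_mono) (auto simp del: power_Suc intro: power_decreasing)
      finally show ?thesis by simp
    qed
    \<comment> \<open>Eliminating the factor \<open>e\<close> expresses the determinant through two
      remainders, both of order at least \<open>2 * n + 1\<close> in \<open>t\<close>.\<close>
    have "poly P x = R n * pade_B \<nu> (Suc n) x - R (Suc n) * pade_B \<nu> n x"
      by (simp add: P_def polyA polyB R_def algebra_simps)
    also have "norm \<dots> \<le> t ^ (2 * n + 1) * 4 ^ Suc n + t ^ (2 * n + 1) * 4 ^ n"
      using R[of n] R[of "Suc n"] norm_pade_B_le[of \<nu> x] \<nu> x(2) t
      by (intro order_trans[OF norm_triangle_ineq4] add_mono) (auto simp: norm_mult intro!: mult_mono simp del: power_Suc)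
    finally show "norm (poly P (complex_of_real (exp (- t)))) \<le> (4 ^ Suc n + 4 ^ n) * t ^ (2 * n + 1)"
      by (simp add: x_def algebra_simps)
  qed
  then obtain q where q: "P = [:- 1, 1:] ^ (2 * n + 1) * q" by (auto elim: dvdE)
  with P0 have "q \<noteq> 0" by auto
  then have "degree P = 2 * n + 1 + degree q"
    unfolding q by (subst degree_mult_eq) (auto simp: degree_linear_power simp del: power_Suc)
  with degP have "degree q = 0" by simp
  then obtain c where "q = [:c:]" by (rule degree_eq_zeroE)
  with \<open>q \<noteq> 0\<close> have "poly q w \<noteq> 0" by simp
  with w have "poly P w \<noteq> 0" by (simp add: q)
  then show ?thesis by (simp add: P_def polyA polyB)
qed

section \<open>Diagonal forms\<close>

lemma of_int_form_eval:
  "of_int (form_eval r F x y) = form_eval r F (of_int x) (of_int y :: 'a :: comm_ring_1)"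
  by (simp add: form_eval_def)

text \<open>An element of the ring generated by \<open>s\<close> together with its conjugate. This
  is a relation and not a map because \<open>s\<close> may be an integer, and then \<open>u\<close>
  does not determine \<open>v\<close>.\<close>

definition conjugate_pair :: "complex \<Rightarrow> complex \<Rightarrow> complex \<Rightarrow> bool" where
  "conjugate_pair s u v \<longleftrightarrow> (\<exists>a b :: int. u = of_int a + of_int b * s \<and> v = of_int a - of_int b * s)"

lemma conjugate_pair_of_int: "conjugate_pair s (of_int a) (of_int a)"
  unfolding conjugate_pair_def by (rule exI[of _ a], rule exI[of _ 0]) simp

lemma conjugate_pair_add:
  assumes "conjugate_pair s u v" "conjugate_pair s u' v'"
  shows "conjugate_pair s (u + u') (v + v')"
proof -
  obtain a b a' b' where "u = of_int a + of_int b * s" "v = of_int a - of_int b * s"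
    "u' = of_int a' + of_int b' * s" "v' = of_int a' - of_int b' * s"
    using assms unfolding conjugate_pair_def by blast
  note eqs = this
  show ?thesis unfolding conjugate_pair_def eqs
    by (rule exI[where x = "a + a'"], rule exI[where x = "b + b'"]) (simp add: algebra_simps)
qed

lemma conjugate_pair_mult:
  assumes "conjugate_pair s u v" "conjugate_pair s u' v'" and D: "s\<^sup>2 = of_int D"
  shows "conjugate_pair s (u * u') (v * v')"
proof -
  obtain a b a' b' where "u = of_int a + of_int b * s" "v = of_int a - of_int b * s"
    "u' = of_int a' + of_int b' * s" "v' = of_int a' - of_int b' * s"
    using assms unfolding conjugate_pair_def by blast
  note eqs = this
  show ?thesis unfolding conjugate_pair_def eqs
    by (rule exI[where x = "a * a' + b * b' * D"], rule exI[where x = "a * b' + b * a'"])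
      (simp add: algebra_simps power2_eq_square flip: D)
qed

lemma conjugate_pair_power:
  assumes "conjugate_pair s u v" and D: "s\<^sup>2 = of_int D"
  shows "conjugate_pair s (u ^ n) (v ^ n)"
proof (induction n)
  case 0
  then show ?case using conjugate_pair_of_int[of s 1] by simp
qed (use assms in \<open>auto intro: conjugate_pair_mult\<close>)

lemma conjugate_pair_sum:
  assumes "\<And>i. i \<in> I \<Longrightarrow> conjugate_pair s (f i) (g i)"
  shows "conjugate_pair s (sum f I) (sum g I)"
  using assms
proof (induction I rule: infinite_finite_induct)
  case (insert i I)
  then show ?case by (auto intro: conjugate_pair_add)
qed (use conjugate_pair_of_int[of s 0] in auto)

lemma conjugate_pair_sym: "conjugate_pair s u v \<Longrightarrow> conjugate_pair s v u"
  unfolding conjugate_pair_def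
  by (metis (no_types, opaque_lifting) diff_minus_eq_add minus_mult_left of_int_minus uminus_add_conv_diff add.commute)

lemma norm_Ints_ge_1: "x \<in> \<int> \<Longrightarrow> x \<noteq> 0 \<Longrightarrow> 1 \<le> norm (x :: complex)"
proof (elim Ints_cases)
  fix k assume "x = of_int k" "x \<noteq> 0"
  then have "k \<noteq> 0" "norm x = real_of_int \<bar>k\<bar>" by auto
  then show ?thesis by linarith
qed

text \<open>The linear forms and the quadratic form are parameters because the configuration is
  instantiated again with swapped and rotated linear forms, with a primitive quadratic form, and on
  sublattices.\<close>

locale diagonal_form =
  fixes r :: nat and F :: "nat \<Rightarrow> int" and \<alpha> \<beta> \<gamma> \<delta> \<kappa> :: complex and A B C :: int
  assumes r: "r \<ge> 5"
    and diag: "diagonalization r F \<alpha> \<beta> \<gamma> \<delta>"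
    and quad: "\<And>x y. (\<alpha> * x + \<beta> * y) * (\<gamma> * x + \<delta> * y) =
                 \<kappa> * (of_int A * x\<^sup>2 + of_int B * x * y + of_int C * y\<^sup>2)"
begin

definition j :: complex where "j = \<alpha> * \<delta> - \<beta> * \<gamma>"
text \<open>A square root of \<open>B\<^sup>2 - 4 * A * C\<close>, with the sign tied to the order
  of the linear forms by \<open>j = \<kappa> * s\<close>.\<close>

definition s :: complex where "s = j / \<kappa>"
definition \<xi> :: "int \<times> int \<Rightarrow> complex" where "\<xi> v = \<alpha> * of_int (fst v) + \<beta> * of_int (snd v)"
definition \<eta> :: "int \<times> int \<Rightarrow> complex" where "\<eta> v = \<gamma> * of_int (fst v) + \<delta> * of_int (snd v)"

lemma j_nonzero: "j \<noteq> 0"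
  using diag by (simp add: j_def diagonalization_def)

lemma form_eval_eq: "form_eval r F x y = (\<alpha> * x + \<beta> * y) ^ r - (\<gamma> * x + \<delta> * y) ^ r"
  using diag by (simp add: diagonalization_def)

lemma form_eval_int: "of_int (form_eval r F x y) = \<xi> (x, y) ^ r - \<eta> (x, y) ^ r"
  by (simp add: of_int_form_eval form_eval_eq \<xi>_def \<eta>_def)

lemma quad_coeffs:
  "\<alpha> * \<gamma> = \<kappa> * of_int A" "\<alpha> * \<delta> + \<beta> * \<gamma> = \<kappa> * of_int B" "\<beta> * \<delta> = \<kappa> * of_int C"
proof -
  show 1: "\<alpha> * \<gamma> = \<kappa> * of_int A" using quad[of 1 0] by simp
  show 2: "\<beta> * \<delta> = \<kappa> * of_int C" using quad[of 0 1] by simp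
  have "(\<alpha> * \<delta> + \<beta> * \<gamma>) + (\<alpha> * \<gamma> + \<beta> * \<delta>) = \<kappa> * of_int B + (\<kappa> * of_int A + \<kappa> * of_int C)"
    using quad[of 1 1] by (simp add: algebra_simps)
  then show "\<alpha> * \<delta> + \<beta> * \<gamma> = \<kappa> * of_int B" unfolding 1 2 by simp
qed

lemma \<kappa>_nonzero: "\<kappa> \<noteq> 0"
  using quad_coeffs j_nonzero by (auto simp: j_def)

lemma s_square: "s\<^sup>2 = of_int (B\<^sup>2 - 4 * A * C)"
proof -
  have "j\<^sup>2 = (\<alpha> * \<delta> + \<beta> * \<gamma>)\<^sup>2 - 4 * (\<alpha> * \<gamma>) * (\<beta> * \<delta>)"
    by (simp add: j_def power2_eq_square algebra_simps)
  also have "\<dots> = \<kappa>\<^sup>2 * of_int (B\<^sup>2 - 4 * A * C)"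
    unfolding quad_coeffs by (simp add: power2_eq_square algebra_simps)
  finally show ?thesis using \<kappa>_nonzero by (simp add: s_def power_divide)
qed

lemma s_nonzero: "s \<noteq> 0"
  using j_nonzero \<kappa>_nonzero by (simp add: s_def)

text \<open>The integer \<open>M\<close> is the value of the Jacobian of the form and the quadratic form.\<close>

lemma jacobian_int: "\<exists>M :: int. of_int M = of_nat r * s * (\<xi> v ^ r + \<eta> v ^ r)"
proof -
  obtain x y where v: "v = (x, y)" by (cases v)
  define X Y where "X = complex_of_int x" and "Y = complex_of_int y"
  define U V where "U = \<alpha> * X + \<beta> * Y" and "V = \<gamma> * X + \<delta> * Y"
  define FX FY where "FX = (\<Sum>i\<le>r. F i * (int (r - i) * x ^ (r - i - 1)) * y ^ i)"
    and "FY = (\<Sum>i\<le>r. F i * x ^ (r - i) * (int i * y ^ (i - 1)))"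
  \<comment> \<open>Each partial derivative is computed from the integer coefficients and from the
    diagonalization; uniqueness of the derivative shows that the second expression is an
    integer.\<close>
  have "((\<lambda>z. form_eval r F z Y) has_field_derivative of_int FX) (at X)"
    unfolding form_eval_def FX_def X_def Y_def of_int_sum
    by (rule derivative_eq_intros refl | simp add: mult_ac)+
  moreover have "((\<lambda>z. form_eval r F z Y) has_field_derivative
      (of_nat r * U ^ (r - 1) * \<alpha> - of_nat r * V ^ (r - 1) * \<gamma>)) (at X)"
    unfolding form_eval_eq U_def V_def by (rule derivative_eq_intros refl | simp)+
  ultimately have FX: "of_int FX = of_nat r * U ^ (r - 1) * \<alpha> - of_nat r * V ^ (r - 1) * \<gamma>"
    by (rule DERIV_unique)
  have "((\<lambda>z. form_eval r F X z) has_field_derivative of_int FY) (at Y)"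
    unfolding form_eval_def FY_def X_def Y_def of_int_sum
    by (rule derivative_eq_intros refl | simp add: mult_ac)+
  moreover have "((\<lambda>z. form_eval r F X z) has_field_derivative
      (of_nat r * U ^ (r - 1) * \<beta> - of_nat r * V ^ (r - 1) * \<delta>)) (at Y)"
    unfolding form_eval_eq U_def V_def by (rule derivative_eq_intros refl | simp)+
  ultimately have FY: "of_int FY = of_nat r * U ^ (r - 1) * \<beta> - of_nat r * V ^ (r - 1) * \<delta>"
    by (rule DERIV_unique)
  define M where "M = FX * (B * x + 2 * C * y) - FY * (2 * A * x + B * y)"
  have QY: "\<kappa> * of_int (B * x + 2 * C * y) = \<beta> * V + \<delta> * U"
  proof -
    have "\<kappa> * of_int (B * x + 2 * C * y) = (\<kappa> * of_int B) * X + 2 * (\<kappa> * of_int C) * Y"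
      by (simp add: X_def Y_def algebra_simps)
    then show ?thesis unfolding quad_coeffs[symmetric] by (simp add: U_def V_def algebra_simps)
  qed
  have QX: "\<kappa> * of_int (2 * A * x + B * y) = \<alpha> * V + \<gamma> * U"
  proof -
    have "\<kappa> * of_int (2 * A * x + B * y) = 2 * (\<kappa> * of_int A) * X + (\<kappa> * of_int B) * Y"
      by (simp add: X_def Y_def algebra_simps)
    then show ?thesis unfolding quad_coeffs[symmetric] by (simp add: U_def V_def algebra_simps)
  qed
  have Suc: "U ^ r = U * U ^ (r - 1)" "V ^ r = V * V ^ (r - 1)"
    using r by (simp_all flip: power_Suc)
  have "\<kappa> * of_int M = of_int FX * (\<kappa> * of_int (B * x + 2 * C * y)) - of_int FY * (\<kappa> * of_int (2 * A * x + B * y))"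
    unfolding M_def by (simp add: algebra_simps)
  also have "\<dots> = of_nat r * j * (U ^ r + V ^ r)"
    unfolding QX QY FX FY Suc j_def by (simp add: algebra_simps)
  finally have "of_int M = of_nat r * s * (U ^ r + V ^ r)"
    using \<kappa>_nonzero by (simp add: s_def field_simps)
  then show ?thesis by (auto simp: v \<xi>_def \<eta>_def U_def V_def X_def Y_def)
qed

text \<open>With \<open>M\<close> the value of the Jacobian and \<open>g\<close> that of the form,
  the two numbers are \<open>M + r * g * s\<close> and \<open>M - r * g * s\<close>: exchanging
  \<xi> and \<eta> acts as conjugation.\<close>

lemma conjugate_pair_powers:
  "conjugate_pair s (2 * of_nat r * s * \<xi> v ^ r) (2 * of_nat r * s * \<eta> v ^ r)"
proof -
  obtain x y where v: "v = (x, y)" by (cases v)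
  obtain M where M: "of_int M = of_nat r * s * (\<xi> v ^ r + \<eta> v ^ r)" using jacobian_int by blast
  define g where "g = form_eval r F x y"
  have g: "of_int g = \<xi> v ^ r - \<eta> v ^ r" by (simp add: g_def form_eval_int v)
  show ?thesis unfolding conjugate_pair_def
    by (rule exI[of _ M], rule exI[of _ "int r * g"]) (simp add: M g algebra_simps)
qed

text \<open>\<open>m\<close> is the polar form of the quadratic form and \<open>k\<close> the
  determinant, so the two mixed products are conjugate as well, up to the common factor
  \<open>\<kappa> / 2\<close>.\<close>

lemma polarization:
  fixes v v' :: "int \<times> int"
  defines "k \<equiv> fst v * snd v' - fst v' * snd v"
  shows "\<xi> v * \<eta> v' - \<xi> v' * \<eta> v = j * of_int k"
    and "\<exists>m :: int. 2 * (\<xi> v * \<eta> v') = \<kappa> * (of_int m + of_int k * s) \<and>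
      2 * (\<xi> v' * \<eta> v) = \<kappa> * (of_int m - of_int k * s)"
proof -
  show 1: "\<xi> v * \<eta> v' - \<xi> v' * \<eta> v = j * of_int k"
    by (simp add: \<xi>_def \<eta>_def k_def j_def algebra_simps)
  define m where "m = 2 * A * fst v * fst v' + B * (fst v * snd v' + fst v' * snd v) + 2 * C * snd v * snd v'"
  have "\<kappa> * of_int m = 2 * (\<kappa> * of_int A) * of_int (fst v) * of_int (fst v') +
     (\<kappa> * of_int B) * (of_int (fst v) * of_int (snd v') + of_int (fst v') * of_int (snd v)) +
     2 * (\<kappa> * of_int C) * of_int (snd v) * of_int (snd v')"
    by (simp add: m_def algebra_simps)
  then have 2: "\<xi> v * \<eta> v' + \<xi> v' * \<eta> v = \<kappa> * of_int m"
    unfolding quad_coeffs[symmetric] by (simp add: \<xi>_def \<eta>_def algebra_simps)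
  have "j = \<kappa> * s" using \<kappa>_nonzero by (simp add: s_def)
  with 1 2 show "\<exists>m :: int. 2 * (\<xi> v * \<eta> v') = \<kappa> * (of_int m + of_int k * s) \<and>
      2 * (\<xi> v' * \<eta> v) = \<kappa> * (of_int m - of_int k * s)"
    by (intro exI[of _ m]) (auto simp: algebra_simps)
qed

text \<open>After multiplication by \<open>2 * (2 * r * s) ^ n\<close>, \<open>L\<close> becomes
  \<kappa> times the difference of \<open>(m + k * s) * (a + b * s)\<close> and its conjugate, that
  is \<open>2 * \<kappa> * s * (m * b + k * a)\<close>. Since \<open>\<kappa> * s = j\<close>, a
  nonzero \<open>L\<close> gives a nonzero integer multiple of \<open>j\<close>.\<close>

lemma linear_form_lower_bound:
  fixes c :: "nat \<Rightarrow> int" and n :: nat and v v' :: "int \<times> int"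
  defines "L \<equiv> \<xi> v * \<eta> v' * form_eval n c (\<xi> v ^ r) (\<eta> v ^ r) -
    \<xi> v' * \<eta> v * form_eval n c (\<eta> v ^ r) (\<xi> v ^ r)"
  assumes "L \<noteq> 0"
  shows "norm j \<le> (2 * real r * norm s) ^ n * norm L"
proof -
  define Z :: "complex \<Rightarrow> complex \<Rightarrow> complex" where "Z = form_eval n c"
  define w where "w = 2 * of_nat r * s"
  define X Y where "X = w * \<xi> v ^ r" and "Y = w * \<eta> v ^ r"
  have w0: "w \<noteq> 0" using r s_nonzero by (simp add: w_def)
  have homog: "Z (w * x) (w * y) = w ^ n * Z x y" for x y
  proof -
    have "w ^ n = w ^ (n - k) * w ^ k" if "k \<le> n" for k using that by (simp flip: power_add)
    then show ?thesis unfolding Z_def form_eval_def sum_distrib_left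
      by (intro sum.cong) (auto simp: power_mult_distrib mult_ac)
  qed
  have pair: "conjugate_pair s X Y" using conjugate_pair_powers[of v] by (simp add: X_def Y_def w_def)
  have "conjugate_pair s (Z X Y) (Z Y X)"
    unfolding Z_def form_eval_def
    by (intro conjugate_pair_sum conjugate_pair_mult[OF _ _ s_square] conjugate_pair_power[OF _ s_square]
        conjugate_pair_of_int pair conjugate_pair_sym[OF pair])
  then obtain a b :: int where ab: "Z X Y = of_int a + of_int b * s" "Z Y X = of_int a - of_int b * s"
    unfolding conjugate_pair_def by blast
  define k where "k = fst v * snd v' - fst v' * snd v"
  obtain m :: int where m: "2 * (\<xi> v * \<eta> v') = \<kappa> * (of_int m + of_int k * s)"
      "2 * (\<xi> v' * \<eta> v) = \<kappa> * (of_int m - of_int k * s)"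
    using polarization(2)[of v v'] by (auto simp: k_def)
  have "2 * (w ^ n * L) = (2 * (\<xi> v * \<eta> v')) * Z X Y - (2 * (\<xi> v' * \<eta> v)) * Z Y X"
    unfolding X_def Y_def homog L_def Z_def[symmetric] by (simp add: algebra_simps)
  also have "\<dots> = 2 * (j * of_int (m * b + k * a))"
    unfolding m ab using \<kappa>_nonzero by (simp add: s_def field_simps)
  finally have eq: "w ^ n * L = j * of_int (m * b + k * a)" by simp
  moreover have "w ^ n * L \<noteq> 0" using w0 assms(2) by simp
  ultimately have "m * b + k * a \<noteq> 0" by (metis mult_zero_right of_int_0)
  then have "1 \<le> norm (complex_of_int (m * b + k * a))"
    by (intro norm_Ints_ge_1) (simp_all only: Ints_of_int of_int_eq_0_iff not_False_eq_True)
  then have "norm j * 1 \<le> norm (w ^ n * L)"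
    unfolding eq norm_mult by (intro mult_left_mono) auto
  then show ?thesis by (simp add: norm_mult norm_power w_def)
qed

text \<open>\<open>4 * (\<xi> * \<eta>) ^ r\<close> is the difference of the squares of the sum and
  the difference of the \<open>r\<close>-th powers, so multiplying it by
  \<open>r ^ 2 * s ^ 2\<close> gives an integer. Since \<open>\<xi> * \<eta>\<close> is \<kappa>
  times a value of the quadratic form, \<rho> times the \<open>r\<close>-th power of each such value
  is an integer.\<close>

lemma norm_s_bound:
  assumes prim: "gcd A (gcd B C) = 1"
  shows "norm s ^ r \<le> 4 * real r ^ 2 * norm s ^ 2 * norm j ^ r"
proof -
  define \<rho> where "\<rho> = 4 * of_nat r ^ 2 * s ^ 2 * \<kappa> ^ r"
  have int: "\<rho> * of_int (A * x\<^sup>2 + B * x * y + C * y\<^sup>2) ^ r \<in> \<int>" for x y :: int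
  proof -
    define v where "v = (x, y)"
    obtain M where M: "of_int M = of_nat r * s * (\<xi> v ^ r + \<eta> v ^ r)" using jacobian_int by blast
    define g where "g = form_eval r F x y"
    have g: "of_int g = \<xi> v ^ r - \<eta> v ^ r" by (simp add: g_def form_eval_int v_def)
    have q: "\<xi> v * \<eta> v = \<kappa> * of_int (A * x\<^sup>2 + B * x * y + C * y\<^sup>2)"
      using quad[of "of_int x" "of_int y"] by (simp add: \<xi>_def \<eta>_def v_def)
    have "\<rho> * of_int (A * x\<^sup>2 + B * x * y + C * y\<^sup>2) ^ r = 4 * of_nat r ^ 2 * s ^ 2 * (\<xi> v * \<eta> v) ^ r"
      unfolding q \<rho>_def by (simp add: power_mult_distrib)
    also have "\<dots> = of_int M ^ 2 - of_nat r ^ 2 * s ^ 2 * of_int g ^ 2"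
      unfolding M g by (simp add: power2_eq_square power_mult_distrib algebra_simps)
    also have "\<dots> = of_int (M ^ 2 - int r ^ 2 * (B\<^sup>2 - 4 * A * C) * g ^ 2)"
      unfolding s_square by simp
    finally show ?thesis by simp
  qed
  have comb: "\<rho> * of_int (gcd a b) \<in> \<int>" if "\<rho> * of_int a \<in> \<int>" "\<rho> * of_int b \<in> \<int>" for a b :: int
  proof -
    obtain u v where "u * a + v * b = gcd a b" using bezout_int by blast
    then have "complex_of_int (gcd a b) = of_int u * of_int a + of_int v * of_int b"
      by (metis of_int_add of_int_mult)
    then have "\<rho> * of_int (gcd a b) = of_int u * (\<rho> * of_int a) + of_int v * (\<rho> * of_int b)"
      by (simp add: algebra_simps)
    then show ?thesis using that by auto
  qed
  \<comment> \<open>For a primitive quadratic form the values at \<open>(1, 0)\<close>,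
    \<open>(0, 1)\<close>, \<open>(1, 1)\<close> have no common factor, and neither have their
    \<open>r\<close>-th powers; hence \<rho> itself is a nonzero integer.\<close>
  have 1: "\<rho> * of_int (A ^ r) \<in> \<int>" "\<rho> * of_int (C ^ r) \<in> \<int>" "\<rho> * of_int ((A + B + C) ^ r) \<in> \<int>"
    using int[of 1 0] int[of 0 1] int[of 1 1] by simp_all
  have "gcd (gcd (A ^ r) (C ^ r)) ((A + B + C) ^ r) = gcd (gcd A C) (A + B + C) ^ r"
    by (simp only: gcd_exp)
  also have "gcd (gcd A C) (A + B + C) = 1"
  proof -
    let ?g = "gcd (gcd A C) (A + B + C)"
    have 1: "?g dvd A" "?g dvd C" and 2: "?g dvd A + B + C" by (meson dvd_trans gcd_dvd1 gcd_dvd2)+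
    have "?g dvd B" using dvd_diff[OF dvd_diff[OF 2 1(1)] 1(2)] by simp
    with 1 have "?g dvd gcd A (gcd B C)" by (intro gcd_greatest)
    then have "?g dvd 1" by (simp only: prim)
    then show ?thesis by simp
  qed
  finally have "\<rho> \<in> \<int>" using comb[OF comb[OF 1(1,2)] 1(3)] by simp
  moreover have "\<rho> \<noteq> 0" using r s_nonzero \<kappa>_nonzero by (simp add: \<rho>_def)
  ultimately have "1 \<le> norm \<rho>"
    using norm_Ints_ge_1 by blast
  also have "norm \<rho> = 4 * real r ^ 2 * norm s ^ 2 * norm \<kappa> ^ r"
    by (simp add: \<rho>_def norm_mult norm_power)
  also have "norm \<kappa> = norm j / norm s"
    using s_nonzero \<kappa>_nonzero j_nonzero by (simp add: s_def norm_divide)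
  finally show ?thesis using s_nonzero by (simp add: power_divide field_simps)
qed

text \<open>If \<open>s\<close> were larger, \<open>norm_s_bound\<close> would give
  \<open>\<bar>j\<bar> ^ (r - 4) \<le> 4 * r ^ 2\<close>, which the largeness of \<open>j\<close>
  excludes.\<close>

lemma norm_s_le:
  assumes "gcd A (gcd B C) = 1" and "real r ^ 7 \<le> (norm j / 2) ^ (r - 4)"
  shows "norm s \<le> norm j ^ 2"
proof (rule ccontr)
  assume "\<not> norm s \<le> norm j ^ 2"
  then have less: "norm j ^ 2 < norm s" by simp
  obtain k where k: "r = k + 4" using r le_Suc_ex[of 4 r] by (auto simp: add.commute)
  have s0: "norm s > 0" using s_nonzero by simp
  have "norm s ^ 2 * norm s ^ (k + 2) \<le> norm s ^ 2 * (4 * real r ^ 2 * norm j ^ r)"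
    using norm_s_bound[OF assms(1)] by (simp add: k power_add mult_ac eval_nat_numeral)
  then have "norm s ^ (k + 2) \<le> 4 * real r ^ 2 * norm j ^ r" using s0 by simp
  moreover have "(norm j ^ 2) ^ (k + 2) \<le> norm s ^ (k + 2)" using less by (intro power_mono) auto
  ultimately have "norm j ^ (2 * (k + 2)) \<le> 4 * real r ^ 2 * norm j ^ r" by (simp only: power_mult)
  moreover have "norm j ^ (2 * (k + 2)) = norm j ^ r * norm j ^ k"
  proof -
    have "2 * (k + 2) = r + k" using k by simp
    then show ?thesis by (simp only: power_add)
  qed
  ultimately have le: "norm j ^ k \<le> 4 * real r ^ 2" using j_nonzero by (simp add: mult.commute)
  have "2 ^ k * real r ^ 7 \<le> norm j ^ k" using assms(2) by (simp add: k power_divide field_simps)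
  moreover have "1 * real r ^ 7 \<le> 2 ^ k * real r ^ 7" by (intro mult_right_mono) auto
  ultimately have "real r ^ 5 * real r ^ 2 \<le> 4 * real r ^ 2" using le by (simp flip: power_add)
  then have "real r ^ 5 \<le> 4" by (rule mult_right_le_imp_le) (use r in auto)
  moreover have "5 ^ 5 \<le> real r ^ 5" using r by (intro power_mono) auto
  ultimately show False by simp
qed

end

section \<open>Contradiction from two approximations of very different height\<close>

context diagonal_form
begin

text \<open>The homogenized approximants, multiplied by \<open>r ^ (2 * n)\<close>, have integer
  coefficients, so the arithmetic lower bound applies to them. The power of \<open>\<xi> v\<close>
  is the cost of returning to the inhomogeneous variable \<open>q\<close>.\<close>

lemma pade_linear_form_lower_bound:
  fixes n :: nat and v v' :: "int \<times> int"
  assumes \<xi>0: "\<xi> v \<noteq> 0"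
  defines "q \<equiv> \<eta> v / \<xi> v"
  defines "L \<equiv> \<eta> v' * pade_A (1 / real r) n (q ^ r) - \<xi> v' * (q * pade_B (1 / real r) n (q ^ r))"
  assumes L: "L \<noteq> 0"
  shows "norm j \<le> (2 * real r ^ 3 * norm s) ^ n * norm (\<xi> v) ^ (r * n + 1) * norm L"
proof -
  have "\<exists>c :: int. of_int c = real r ^ (2 * n) * pade (1 / real r) n k" if "k \<le> n" for k
    using pade_Ints[of r k n] r that by (auto elim!: Ints_cases)
  then obtain c :: "nat \<Rightarrow> int" where c: "\<And>k. k \<le> n \<Longrightarrow> of_int (c k) = real r ^ (2 * n) * pade (1 / real r) n k"
    by metis
  have c': "of_int (c k) = of_nat r ^ (2 * n) * complex_of_real (pade (1 / real r) n k)" if "k \<le> n" for k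
    using arg_cong[OF c[OF that], of complex_of_real] by simp
  have \<eta>: "\<eta> v = \<xi> v * q" using \<xi>0 by (simp add: q_def)
  define X where "X = \<xi> v ^ r"
  have X: "\<xi> v ^ r = X" "\<eta> v ^ r = X * q ^ r"
    by (simp_all add: X_def \<eta> power_mult_distrib)
  have Xpow: "X ^ n = X ^ (n - k) * X ^ k" if "k \<le> n" for k using that by (simp flip: power_add)
  have 1: "form_eval n c (\<xi> v ^ r) (\<eta> v ^ r) = of_nat r ^ (2 * n) * X ^ n * pade_A (1 / real r) n (q ^ r)"
    unfolding form_eval_def pade_A_def X sum_distrib_left
    by (intro sum.cong) (auto simp: c' Xpow power_mult_distrib mult_ac)
  have "form_eval n c (\<eta> v ^ r) (\<xi> v ^ r) = (\<Sum>k\<le>n. of_nat r ^ (2 * n) * X ^ n * (of_real (pade (1 / real r) n k) * (q ^ r) ^ (n - k)))"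
    unfolding form_eval_def X
    by (intro sum.cong) (auto simp: c' Xpow power_mult_distrib mult_ac)
  also have "\<dots> = of_nat r ^ (2 * n) * X ^ n * pade_B (1 / real r) n (q ^ r)"
    unfolding pade_B_def sum_distrib_left
    by (rule sum.reindex_bij_witness[where i = "\<lambda>k. n - k" and j = "\<lambda>k. n - k"]) auto
  finally have 2: "form_eval n c (\<eta> v ^ r) (\<xi> v ^ r) = of_nat r ^ (2 * n) * X ^ n * pade_B (1 / real r) n (q ^ r)" .
  have eq: "\<xi> v * \<eta> v' * form_eval n c (\<xi> v ^ r) (\<eta> v ^ r) - \<xi> v' * \<eta> v * form_eval n c (\<eta> v ^ r) (\<xi> v ^ r) =
     of_nat r ^ (2 * n) * (\<xi> v ^ (r * n + 1) * L)"
  proof -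
    have pow: "\<xi> v ^ (r * n + 1) = X ^ n * \<xi> v" by (simp add: X_def power_mult)
    show ?thesis unfolding 1 2 L_def pow unfolding \<eta> by (simp only: algebra_simps)
  qed
  have "norm j \<le> (2 * real r * norm s) ^ n * norm (of_nat r ^ (2 * n) * (\<xi> v ^ (r * n + 1) * L))"
    using linear_form_lower_bound[of v v' n c] L \<xi>0 r unfolding eq by simp
  also have "\<dots> = (2 * real r ^ 3 * norm s) ^ n * norm (\<xi> v) ^ (r * n + 1) * norm L"
    by (simp add: norm_mult norm_power power_mult power_mult_distrib power2_eq_square power3_eq_cube mult_ac)
  finally show ?thesis .
qed

lemma half_norm_j_gt_1:
  assumes "real r ^ 7 \<le> (norm j / 2) ^ (r - 4)"
  shows "norm j / 2 > 1"
proof (rule ccontr)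
  assume "\<not> norm j / 2 > 1"
  then have "(norm j / 2) ^ (r - 4) \<le> 1" by (intro power_le_one) auto
  moreover have "1 < real r ^ 7" using r by (intro one_less_power) auto
  ultimately show False using assms by simp
qed

text \<open>A nonzero \<open>L n\<close> is bounded below by arithmetic and above by two terms: the
  error of \<open>v'\<close>, and the Pade remainder times \<open>H'\<close>. The degree is fitted
  to the size of \<open>H'\<close> relative to \<open>H\<close> so that each term, after scaling, is
  at most \<open>1\<close>; this leaves \<open>\<bar>j\<bar> \<le> 2\<close>.\<close>

lemma two_approximations_contradiction:
  assumes prim: "gcd A (gcd B C) = 1" and J: "real r ^ 7 \<le> (norm j / 2) ^ (r - 4)"
    and unit: "norm (\<xi> v ^ r - \<eta> v ^ r) = 1"
    and \<eta>_le: "norm (\<eta> v) \<le> norm (\<xi> v)"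
    and H: "(norm j / 2) ^ r \<le> norm (\<xi> v)"
    and H'_def: "H' = max (norm (\<xi> v')) (norm (\<eta> v'))"
    and H': "norm (\<xi> v) ^ (r - 1) \<le> H'"
    and t: "norm (\<eta> v - \<xi> v) * norm (\<xi> v) ^ (r - 1) \<le> 1"
    and t': "norm (\<eta> v' - \<xi> v') * H' ^ (r - 1) \<le> 1"
  shows False
proof -
  define J where "J = norm j / 2"
  define H where "H = norm (\<xi> v)"
  define \<nu> where "\<nu> = 1 / real r"
  have \<nu>: "0 < \<nu>" "\<nu> < 1" "2 * \<nu> \<le> 1" using r by (auto simp: \<nu>_def field_simps)
  have J1: "J > 1" using half_norm_j_gt_1[OF J] by (simp add: J_def)
  have "J ^ (r - 4) \<le> J ^ r" using J1 by (intro power_increasing) auto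
  also have JH: "J ^ r \<le> H" using assms(5) by (simp add: J_def H_def)
  finally have rH: "real r ^ 7 \<le> H" using J by (simp add: J_def)
  have r1: "1 < real r ^ 7" using r by (intro one_less_power) auto
  with rH have H1: "H > 1" by simp
  \<comment> \<open>The loss per degree is absorbed by a single power of \<open>H\<close>:
    \<open>\<bar>s\<bar> \<le> \<bar>j\<bar> ^ 2 = 4 * J ^ 2\<close> and
    \<open>32 * r ^ 3 \<le> r ^ 7 \<le> J ^ (r - 4)\<close>.\<close>
  have E: "8 * real r ^ 3 * norm s \<le> H"
  proof -
    have "norm s \<le> norm j ^ 2" by (rule norm_s_le[OF prim J])
    then have "8 * real r ^ 3 * norm s \<le> 8 * real r ^ 3 * (norm j ^ 2)" by (intro mult_left_mono) auto
    also have "\<dots> = 32 * real r ^ 3 * J ^ 2" by (simp add: J_def power2_eq_square)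
    also have "\<dots> \<le> real r ^ 7 * J ^ 2"
    proof -
      have "5 ^ 4 \<le> real r ^ 4" using r by (intro power_mono) auto
      then have "32 * real r ^ 3 \<le> real r ^ 4 * real r ^ 3" by (intro mult_right_mono) auto
      then show ?thesis by (intro mult_right_mono) (auto simp flip: power_add)
    qed
    also have "\<dots> \<le> J ^ (r - 4) * J ^ 2" using J by (intro mult_right_mono) (auto simp: J_def)
    also have "\<dots> \<le> J ^ r" unfolding power_add[symmetric] using r J1 by (intro power_increasing) auto
    finally show ?thesis using JH by simp
  qed
  have \<xi>0: "\<xi> v \<noteq> 0" using H1 by (auto simp: H_def)
  define q where "q = \<eta> v / \<xi> v"
  define w where "w = q ^ r"
  have Hr: "H ^ r = H * H ^ (r - 1)" using r by (simp flip: power_Suc)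
  have q1: "norm (q - 1) \<le> 1 / H ^ r"
  proof -
    have "q - 1 = (\<eta> v - \<xi> v) / \<xi> v" using \<xi>0 by (simp add: q_def field_simps)
    then have "norm (q - 1) * H ^ r = norm (\<eta> v - \<xi> v) * H ^ (r - 1)"
      using H1 by (simp add: norm_divide Hr flip: H_def)
    then have "norm (q - 1) * H ^ r \<le> 1" using t by (simp add: H_def)
    then show ?thesis using H1 by (simp add: pos_le_divide_eq)
  qed
  have H_le: "H \<le> H ^ r" using H1 r by (intro self_le_power) auto
  have rHr: "2 * (2 * real r) < H ^ r"
  proof -
    have "5 ^ 6 \<le> real r ^ 6" using r by (intro power_mono) auto
    then have "4 * real r < real r ^ 6 * real r" using r by (intro mult_strict_right_mono) auto
    also have "\<dots> = real r ^ 7" by (simp flip: power_Suc2)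
    finally show ?thesis using rH H_le by simp
  qed
  have small: "1 / H ^ r < 1 / (4 * real r)"
    using rHr r H1 by (simp add: field_simps)
  have small2: "1 / (4 * real r) < 1 / 2" using r by (simp add: field_simps)
  have q0: "q \<noteq> 0" using q1 small small2 by auto
  have w1: "norm (w - 1) = 1 / H ^ r"
  proof -
    have "\<xi> v ^ r - \<eta> v ^ r = \<xi> v ^ r * (1 - w)"
      using \<xi>0 by (simp add: w_def q_def power_divide field_simps)
    then have "H ^ r * norm (1 - w) = 1" using unit by (simp add: norm_mult norm_power H_def)
    then show ?thesis using H1 by (simp add: field_simps norm_minus_commute)
  qed
  have w_ne: "w \<noteq> 1" using w1 H1 by auto
  have qle: "norm q \<le> 1" using \<eta>_le \<xi>0 by (simp add: q_def norm_divide)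
  have wle: "norm w \<le> 1" using qle by (simp add: w_def norm_power power_le_one)
  \<comment> \<open>The logarithm of \<open>w\<close> is taken as \<open>r\<close> times that of
    \<open>q\<close>, so that \<open>exp (\<nu> * z)\<close> is \<open>q\<close> itself and not
    another \<open>r\<close>-th root of \<open>w\<close>.\<close>
  define z where "z = of_nat r * Ln q"
  have expz: "exp z = w" using q0 by (simp add: z_def w_def exp_of_nat_mult)
  have exp\<nu>z: "exp (of_real \<nu> * z) = q" using q0 r by (simp add: z_def \<nu>_def)
  have Rez: "Re z \<le> 0"
    using q0 qle by (simp add: z_def Re_Ln mult_nonneg_nonpos)
  have "norm (Ln q) \<le> 2 * norm (q - 1)"
    using norm_Ln_le[of "q - 1"] q1 small small2 by simp
  then have "norm z \<le> real r * (2 * norm (q - 1))"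
    unfolding z_def norm_mult by (intro mult_mono) auto
  also have "\<dots> \<le> real r * (2 * (1 / H ^ r))" using q1 by (intro mult_left_mono) auto
  also have "\<dots> \<le> real r * (2 * (1 / (4 * real r)))" using small by (intro mult_left_mono) auto
  also have "\<dots> \<le> 1" using r by simp
  finally have "\<bar>Im z\<bar> \<le> 1" using abs_Im_le_cmod[of z] by linarith
  \<comment> \<open>The crude bound on \<open>z\<close> serves only to identify it with the
    principal logarithm of \<open>w\<close>. The exact distance \<open>1 / H ^ r\<close> from
    \<open>w\<close> to \<open>1\<close> then yields a bound free of the factor
    \<open>r\<close>.\<close>
  then have "Ln w = z" unfolding expz[symmetric] using pi_gt3 by (intro Ln_exp) auto
  then have z: "norm z \<le> 2 / H ^ r"
    using norm_Ln_le[of "w - 1"] w1 small small2 by simp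
  define L where "L n = \<eta> v' * pade_A \<nu> n w - \<xi> v' * (q * pade_B \<nu> n w)" for n
  have H'1: "H' > 0" using H' H1 by (simp add: H_def) (meson H1 H_def less_le_trans zero_less_power order_less_trans zero_less_one)
  have nonzero: "L n \<noteq> 0 \<or> L (Suc n) \<noteq> 0" for n
  proof (rule ccontr)
    assume "\<not> (L n \<noteq> 0 \<or> L (Suc n) \<noteq> 0)"
    then have eqs: "\<eta> v' * pade_A \<nu> n w = \<xi> v' * q * pade_B \<nu> n w"
      "\<eta> v' * pade_A \<nu> (Suc n) w = \<xi> v' * q * pade_B \<nu> (Suc n) w"
      by (auto simp: L_def mult_ac)
    define det where "det = pade_A \<nu> n w * pade_B \<nu> (Suc n) w - pade_A \<nu> (Suc n) w * pade_B \<nu> n w"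
    have "det \<noteq> 0" using pade_det_nonzero[OF \<nu>(1,2) w_ne] by (simp add: det_def)
    have "\<eta> v' * det = (\<eta> v' * pade_A \<nu> n w) * pade_B \<nu> (Suc n) w - (\<eta> v' * pade_A \<nu> (Suc n) w) * pade_B \<nu> n w"
      by (simp add: det_def algebra_simps)
    also have "\<dots> = 0" unfolding eqs by simp
    finally have 1: "\<eta> v' = 0" using \<open>det \<noteq> 0\<close> by simp
    have "\<xi> v' * q * det = pade_A \<nu> n w * (\<xi> v' * q * pade_B \<nu> (Suc n) w) - pade_A \<nu> (Suc n) w * (\<xi> v' * q * pade_B \<nu> n w)"
      by (simp add: det_def algebra_simps)
    also have "\<dots> = 0" unfolding eqs[symmetric] by simp
    finally have "\<xi> v' = 0" using \<open>det \<noteq> 0\<close> q0 by simp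
    with 1 H'1 show False by (simp add: H'_def)
  qed
  have upper: "norm (L n) \<le> 4 ^ n * (1 / H' ^ (r - 1) + H' / H ^ (r * (2 * n + 1)))" for n
  proof -
    have "L n = (\<eta> v' - \<xi> v') * pade_A \<nu> n w + \<xi> v' * (pade_A \<nu> n w - q * pade_B \<nu> n w)"
      by (simp add: L_def algebra_simps)
    also have "norm \<dots> \<le> norm (\<eta> v' - \<xi> v') * norm (pade_A \<nu> n w) + norm (\<xi> v') * norm (pade_A \<nu> n w - q * pade_B \<nu> n w)"
      by (metis norm_triangle_ineq norm_mult)
    also have "\<dots> \<le> (1 / H' ^ (r - 1)) * 4 ^ n + H' * (4 ^ n / H ^ (r * (2 * n + 1)))"
    proof (intro add_mono mult_mono)
      show "norm (\<eta> v' - \<xi> v') \<le> 1 / H' ^ (r - 1)" using t' H'1 by (simp add: field_simps)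
      show "norm (pade_A \<nu> n w) \<le> 4 ^ n" using \<nu> wle by (intro norm_pade_A_le) auto
      show "norm (\<xi> v') \<le> H'" by (simp add: H'_def)
      have "norm (pade_A \<nu> n w - q * pade_B \<nu> n w) \<le> \<nu> * norm z ^ (2 * n + 1)"
        using pade_remainder[OF \<nu>(1,2) Rez, of n] by (simp only: expz exp\<nu>z)
      also have "\<dots> \<le> \<nu> * (2 / H ^ r) ^ (2 * n + 1)" using \<nu> z by (intro mult_left_mono power_mono) auto
      \<comment> \<open>The odd exponent leaves one factor \<open>2\<close> beside
        \<open>4 ^ n\<close>; it is absorbed by \<open>2 * \<nu> \<le> 1\<close>.\<close>
      also have "\<dots> = (2 * \<nu>) * (4 ^ n / H ^ (r * (2 * n + 1)))"
        by (simp add: power_divide power_mult[symmetric] power_add) (simp add: power_mult)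
      also have "\<dots> \<le> 1 * (4 ^ n / H ^ (r * (2 * n + 1)))" using \<nu> H1 by (intro mult_right_mono) auto
      finally show "norm (pade_A \<nu> n w - q * pade_B \<nu> n w) \<le> 4 ^ n / H ^ (r * (2 * n + 1))" by simp
    qed (use H'1 in auto)
    finally show ?thesis by (simp add: algebra_simps)
  qed
  have main: "norm j \<le> H ^ n * H ^ (r * n + 1) * (1 / H' ^ (r - 1) + H' / H ^ (r * (2 * n + 1)))"
    if "L n \<noteq> 0" for n
  proof -
    let ?X = "1 / H' ^ (r - 1) + H' / H ^ (r * (2 * n + 1))"
    have X: "?X \<ge> 0" using H1 H'1 by simp
    have "norm j \<le> (2 * real r ^ 3 * norm s) ^ n * H ^ (r * n + 1) * norm (L n)"
      using pade_linear_form_lower_bound[OF \<xi>0, of v' n] that by (simp add: L_def w_def q_def \<nu>_def H_def)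
    also have "\<dots> \<le> (2 * real r ^ 3 * norm s) ^ n * H ^ (r * n + 1) * (4 ^ n * ?X)"
      using H1 by (intro mult_left_mono upper) auto
    also have "\<dots> = (8 * real r ^ 3 * norm s) ^ n * (H ^ (r * n + 1) * ?X)"
    proof -
      have "8 * real r ^ 3 * norm s = 4 * (2 * real r ^ 3 * norm s)" by simp
      then have "(8 * real r ^ 3 * norm s) ^ n = 4 ^ n * (2 * real r ^ 3 * norm s) ^ n"
        by (metis power_mult_distrib)
      then show ?thesis by (simp only: mult_ac)
    qed
    also have "\<dots> \<le> H ^ n * (H ^ (r * n + 1) * ?X)"
      using E H1 X by (intro mult_right_mono power_mono) auto
    finally show ?thesis by (simp only: mult.assoc)
  qed
  \<comment> \<open>The degree is governed by \<open>b ^ n \<le> H' < b ^ Suc n\<close>;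
    \<open>N\<close> is \<open>n\<close> or \<open>Suc n\<close>, chosen so that the linear form
    does not vanish.\<close>
  define b where "b = H ^ (r - 1)"
  have b1: "b > 1" using H1 r by (simp add: b_def one_less_power)
  obtain m0 where m0: "H' < b ^ m0" using real_arch_pow[OF b1] by blast
  define m where "m = (LEAST m. H' < b ^ m)"
  have m: "H' < b ^ m" unfolding m_def by (rule LeastI[where P = "\<lambda>m. H' < b ^ m", OF m0])
  have m2: "m \<ge> 2"
  proof (rule ccontr)
    assume "\<not> m \<ge> 2"
    then have "b ^ m \<le> b ^ 1" using b1 by (intro power_increasing) auto
    with m H' show False by (simp add: b_def H_def)
  qed
  then obtain n where n: "m = Suc n" "n \<ge> 1" by (cases m) auto
  have bn: "b ^ n \<le> H'" using not_less_Least[of n "\<lambda>m. H' < b ^ m"] n by (simp add: m_def)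
  obtain N where N: "L N \<noteq> 0" "n \<le> N" "N \<le> Suc n" using nonzero[of n] by auto
  \<comment> \<open>In exponents of \<open>H\<close> this needs
    \<open>(r + 1) * N + 1 \<le> (r - 1) ^ 2 * n\<close>. The tightest case \<open>N = 2\<close>,
    \<open>n = 1\<close> reads \<open>2 * r + 3 \<le> (r - 1) ^ 2\<close>, true for
    \<open>r = 5\<close> but false for \<open>r = 4\<close>.\<close>
  have "H ^ N * H ^ (r * N + 1) \<le> H' ^ (r - 1)"
  proof -
    obtain k where k: "r = k + 5" using r le_Suc_ex[of 5 r] by (auto simp: add.commute)
    have "N + (r * N + 1) \<le> Suc n + (r * Suc n + 1)" using N by (intro add_mono mult_le_mono2) auto
    also have "\<dots> = (n + 1) * (k + 6) + 1" by (simp add: k algebra_simps)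
    also have "\<dots> \<le> (k + 4) * ((k + 4) * n)"
    proof -
      have "(k + 4) * ((k + 4) * n) = (n + 1) * (k + 6) + 1 + ((k * k + 6 * k + 3) * n + (k + 7) * (n - 1))"
        using n(2) by (cases n) (auto simp: algebra_simps)
      then show ?thesis by simp
    qed
    finally have le: "N + (r * N + 1) \<le> (r - 1) * n * (r - 1)" by (simp add: k algebra_simps)
    have "H ^ N * H ^ (r * N + 1) = H ^ (N + (r * N + 1))" by (rule power_add[symmetric])
    also have "\<dots> \<le> H ^ ((r - 1) * n * (r - 1))" using H1 by (intro power_increasing le) auto
    also have "\<dots> = (b ^ n) ^ (r - 1)" by (simp only: b_def power_mult)
    also have "\<dots> \<le> H' ^ (r - 1)" using bn b1 by (intro power_mono) auto
    finally show ?thesis .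
  qed
  then have 1: "H ^ N * H ^ (r * N + 1) * (1 / H' ^ (r - 1)) \<le> 1"
    using H'1 by (simp add: field_simps)
  \<comment> \<open>The exponents match exactly:
    \<open>(r + 1) * N + 1 + (r - 1) * Suc N = r * (2 * N + 1)\<close>.\<close>
  have "H ^ N * H ^ (r * N + 1) * H' \<le> H ^ (r * (2 * N + 1))"
  proof -
    have "H' \<le> b ^ Suc N"
      using m n N b1 by (meson Suc_le_mono less_imp_le order_trans power_increasing)
    then have "H ^ N * H ^ (r * N + 1) * H' \<le> H ^ N * H ^ (r * N + 1) * b ^ Suc N"
      using H1 by (intro mult_left_mono) auto
    also have "\<dots> = H ^ (N + (r * N + 1) + (r - 1) * Suc N)"
      by (simp only: b_def power_mult power_add)
    also have "N + (r * N + 1) + (r - 1) * Suc N = r * (2 * N + 1)"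
      using r by (cases r) (auto simp: algebra_simps)
    finally show ?thesis .
  qed
  then have 2: "H ^ N * H ^ (r * N + 1) * (H' / H ^ (r * (2 * N + 1))) \<le> 1"
    using H1 by (simp add: field_simps)
  have "norm j \<le> 2" using main[OF N(1)] 1 2 unfolding distrib_left by linarith
  with J1 show False by (simp add: J_def)
qed

section \<open>Heights and the gap principle\<close>

definition height :: "int \<times> int \<Rightarrow> real" where
  "height v = max (norm (\<xi> v)) (norm (\<eta> v))"

text \<open>The first alternative admits small vectors with no suitable root of unity nearby. In a
  sequence ordered by height with independent neighbours only the first vector can use it, since the
  next one then has height at least \<open>\<bar>j\<bar> / 2 > 1\<close>.\<close>

definition related :: "int \<times> int \<Rightarrow> bool" where
  "related v \<longleftrightarrow> height v \<le> 1 \<or> norm (\<eta> v - \<xi> v) * height v ^ (r - 1) \<le> 1"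

lemma height_nonneg: "height v \<ge> 0"
  by (simp add: height_def le_max_iff_disj)

lemma norm_j_le:
  assumes "fst v * snd v' - fst v' * snd v \<noteq> 0"
  shows "norm j \<le> norm (\<xi> v * \<eta> v' - \<xi> v' * \<eta> v)"
proof -
  have "1 \<le> norm (complex_of_int (fst v * snd v' - fst v' * snd v))"
    using assms by (intro norm_Ints_ge_1) (simp_all only: Ints_of_int of_int_eq_0_iff not_False_eq_True)
  then have "norm j * 1 \<le> norm j * norm (complex_of_int (fst v * snd v' - fst v' * snd v))"
    by (intro mult_left_mono) auto
  then show ?thesis unfolding polarization(1) norm_mult by simp
qed

lemma norm_j_le_height:
  assumes "fst v * snd v' - fst v' * snd v \<noteq> 0"
  shows "norm j \<le> 2 * (height v * height v')"
proof -
  have "norm (\<xi> v * \<eta> v' - \<xi> v' * \<eta> v) \<le> norm (\<xi> v) * norm (\<eta> v') + norm (\<xi> v') * norm (\<eta> v)"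
    by (metis norm_mult norm_triangle_ineq4)
  also have "\<dots> \<le> height v * height v' + height v' * height v"
    by (intro add_mono mult_mono) (simp_all add: height_def le_max_iff_disj)
  finally show ?thesis using norm_j_le[OF assms] by simp
qed

text \<open>The determinant equals
  \<open>\<xi> * (\<eta>' - \<xi>') - \<xi>' * (\<eta> - \<xi>)\<close>. Each term contains a
  difference that is small by assumption, while the whole has norm at least
  \<open>\<bar>j\<bar>\<close>.\<close>

lemma gap_principle:
  assumes det: "fst v * snd v' - fst v' * snd v \<noteq> 0"
    and le: "height v \<le> height v'"
    and rel: "norm (\<eta> v - \<xi> v) * height v ^ (r - 1) \<le> 1" "norm (\<eta> v' - \<xi> v') * height v' ^ (r - 1) \<le> 1"
  shows "norm j * height v ^ (r - 1) \<le> 2 * height v'"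
proof -
  have "\<xi> v * \<eta> v' - \<xi> v' * \<eta> v = \<xi> v * (\<eta> v' - \<xi> v') - \<xi> v' * (\<eta> v - \<xi> v)"
    by (simp add: algebra_simps)
  also have "norm \<dots> \<le> norm (\<xi> v) * norm (\<eta> v' - \<xi> v') + norm (\<xi> v') * norm (\<eta> v - \<xi> v)"
    by (metis norm_mult norm_triangle_ineq4)
  also have "\<dots> \<le> height v' * norm (\<eta> v' - \<xi> v') + height v' * norm (\<eta> v - \<xi> v)"
    using le by (intro add_mono mult_right_mono) (auto simp: height_def)
  finally have "norm j \<le> height v' * norm (\<eta> v' - \<xi> v') + height v' * norm (\<eta> v - \<xi> v)"
    using norm_j_le[OF det] by simp
  then have "norm j * height v ^ (r - 1) \<le>
      (height v' * norm (\<eta> v' - \<xi> v') + height v' * norm (\<eta> v - \<xi> v)) * height v ^ (r - 1)"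
    by (intro mult_right_mono) (auto simp: height_nonneg)
  also have "\<dots> = height v' * (norm (\<eta> v' - \<xi> v') * height v ^ (r - 1)) +
      height v' * (norm (\<eta> v - \<xi> v) * height v ^ (r - 1))"
    by (simp add: algebra_simps)
  also have "\<dots> \<le> height v' * (norm (\<eta> v' - \<xi> v') * height v' ^ (r - 1)) + height v' * 1"
    using le rel by (intro add_mono mult_left_mono power_mono) (auto simp: height_nonneg)
  also have "\<dots> \<le> height v' * 1 + height v' * 1"
    using rel by (intro add_mono mult_left_mono) (auto simp: height_nonneg)
  finally show ?thesis by simp
qed

text \<open>The three determinants give in turn \<open>height v2 \<ge> J\<close>,
  \<open>height v3 \<ge> J ^ r\<close> and \<open>height v4 \<ge> height v3 ^ (r - 1)\<close>, which
  is exactly what the contradiction for \<open>v3\<close> and \<open>v4\<close> requires.\<close>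

lemma no_four_related_aux:
  assumes prim: "gcd A (gcd B C) = 1" and J: "real r ^ 7 \<le> (norm j / 2) ^ (r - 4)"
    and unit: "norm (\<xi> v3 ^ r - \<eta> v3 ^ r) = 1"
    and det: "fst v1 * snd v2 - fst v2 * snd v1 \<noteq> 0" "fst v2 * snd v3 - fst v3 * snd v2 \<noteq> 0"
      "fst v3 * snd v4 - fst v4 * snd v3 \<noteq> 0"
    and le: "height v1 \<le> height v2" "height v2 \<le> height v3" "height v3 \<le> height v4"
    and rel: "related v1" "related v2" "related v3" "related v4"
    and \<eta>_le: "norm (\<eta> v3) \<le> norm (\<xi> v3)"
  shows False
proof -
  define J where "J = norm j / 2"
  have J1: "J > 1" using half_norm_j_gt_1[OF J] by (simp add: J_def)
  have J2: "J \<le> height v2"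
  proof (cases "height v1 \<le> 1")
    case True
    then have "height v1 * height v2 \<le> 1 * height v2" by (intro mult_right_mono) (auto simp: height_nonneg)
    with norm_j_le_height[OF det(1)] show ?thesis by (simp add: J_def)
  next
    case False
    with rel le have "norm j * height v1 ^ (r - 1) \<le> 2 * height v2"
      by (intro gap_principle det) (auto simp: related_def)
    moreover have "norm j * 1 \<le> norm j * height v1 ^ (r - 1)"
      using False by (intro mult_left_mono one_le_power) auto
    ultimately show ?thesis by (simp add: J_def)
  qed
  have "norm j * height v2 ^ (r - 1) \<le> 2 * height v3"
    using rel le J2 J1 by (intro gap_principle det) (auto simp: related_def)
  moreover have "J * J ^ (r - 1) \<le> J * height v2 ^ (r - 1)"
    using J1 J2 by (intro mult_left_mono power_mono) auto
  moreover have "J * J ^ (r - 1) = J ^ r" using r by (simp flip: power_Suc)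
  ultimately have J3: "J ^ r \<le> height v3" by (simp add: J_def)
  have "norm j * height v3 ^ (r - 1) \<le> 2 * height v4"
    using rel le J2 J1 by (intro gap_principle det) (auto simp: related_def)
  moreover have "1 * height v3 ^ (r - 1) \<le> J * height v3 ^ (r - 1)"
    using J1 by (intro mult_right_mono) (auto simp: height_nonneg)
  ultimately have J4: "height v3 ^ (r - 1) \<le> height v4" by (simp add: J_def)
  have h3: "height v3 = norm (\<xi> v3)" using \<eta>_le by (simp add: height_def)
  show False
  proof (rule two_approximations_contradiction[OF prim J unit \<eta>_le])
    show "(norm j / 2) ^ r \<le> norm (\<xi> v3)" using J3 by (simp add: J_def h3)
    show "height v4 = max (norm (\<xi> v4)) (norm (\<eta> v4))" by (rule height_def)
    show "norm (\<xi> v3) ^ (r - 1) \<le> height v4" using J4 by (simp add: h3)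
    show "norm (\<eta> v3 - \<xi> v3) * norm (\<xi> v3) ^ (r - 1) \<le> 1"
      using rel(3) le J2 J1 by (auto simp: related_def h3)
    show "norm (\<eta> v4 - \<xi> v4) * height v4 ^ (r - 1) \<le> 1"
      using rel(4) le J2 J1 by (auto simp: related_def)
  qed
qed

text \<open>Negating the form exchanges \<xi> and \<eta>. This reduces the case in which \<eta> is
  the larger one at the third solution to the opposite case.\<close>

lemma swap: "diagonal_form r (\<lambda>i. - F i) \<gamma> \<delta> \<alpha> \<beta> \<kappa> A B C"
proof
  have "form_eval r (\<lambda>i. - F i) x y = - form_eval r F x y" for x y :: complex
    by (simp add: form_eval_def sum_negf)
  then show "diagonalization r (\<lambda>i. - F i) \<gamma> \<delta> \<alpha> \<beta>"
    using j_nonzero by (simp add: diagonalization_def form_eval_eq j_def algebra_simps)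
qed (use r quad in \<open>auto simp: mult.commute\<close>)

text \<open>Dividing out the content changes \<kappa> and \<open>s\<close> but neither the linear
  forms nor \<open>j\<close>, so a statement about heights and \<open>j\<close> may assume
  primitivity.\<close>

lemma primitive_quadratic:
  "\<exists>\<kappa> A B C. diagonal_form r F \<alpha> \<beta> \<gamma> \<delta> \<kappa> A B C \<and> gcd A (gcd B C) = 1"
proof -
  define g where "g = gcd A (gcd B C)"
  have "g \<noteq> 0" using s_square s_nonzero by (auto simp: g_def)
  obtain A' B' C' where ABC: "A = g * A'" "B = g * B'" "C = g * C'"
    by (metis dvdE dvd_trans g_def gcd_dvd1 gcd_dvd2)
  have "g = gcd (g * A') (gcd (g * B') (g * C'))" using g_def unfolding ABC[symmetric] .
  also have "\<dots> = g * gcd A' (gcd B' C')"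
  proof -
    have "gcd (g * x) (g * y) = g * gcd x y" for x y
      using gcd_mult_distrib_int[of g x y] by (simp add: g_def)
    then show ?thesis by simp
  qed
  finally have "gcd A' (gcd B' C') = 1" using \<open>g \<noteq> 0\<close> by simp
  moreover have "diagonal_form r F \<alpha> \<beta> \<gamma> \<delta> (\<kappa> * of_int g) A' B' C'"
    by unfold_locales (use r diag quad in \<open>auto simp: ABC algebra_simps\<close>)
  ultimately show ?thesis by (intro exI conjI)
qed

lemma no_four_related:
  assumes J: "real r ^ 7 \<le> (norm j / 2) ^ (r - 4)"
    and unit: "\<bar>form_eval r F (fst v3) (snd v3)\<bar> = 1"
    and det: "fst v1 * snd v2 - fst v2 * snd v1 \<noteq> 0" "fst v2 * snd v3 - fst v3 * snd v2 \<noteq> 0"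
      "fst v3 * snd v4 - fst v4 * snd v3 \<noteq> 0"
    and le: "height v1 \<le> height v2" "height v2 \<le> height v3" "height v3 \<le> height v4"
    and rel: "related v1" "related v2" "related v3" "related v4"
  shows False
proof -
  obtain \<kappa>' A' B' C' where "diagonal_form r F \<alpha> \<beta> \<gamma> \<delta> \<kappa>' A' B' C'" and prim: "gcd A' (gcd B' C') = 1"
    using primitive_quadratic by (elim exE conjE) (rule that)
  then interpret p: diagonal_form r F \<alpha> \<beta> \<gamma> \<delta> \<kappa>' A' B' C' by simp
  have "norm (complex_of_int (form_eval r F (fst v3) (snd v3))) = 1"
    using unit by (simp only: norm_of_int)
  then have unit': "norm (\<xi> v3 ^ r - \<eta> v3 ^ r) = 1"
    unfolding form_eval_int by simp
  show False
  proof (cases "norm (\<eta> v3) \<le> norm (\<xi> v3)")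
    case True
    then show ?thesis using p.no_four_related_aux[OF prim J unit' det le rel] by blast
  next
    case False
    interpret sw: diagonal_form r "\<lambda>i. - F i" \<gamma> \<delta> \<alpha> \<beta> \<kappa>' A' B' C' by (rule p.swap)
    have eqs: "sw.\<xi> = \<eta>" "sw.\<eta> = \<xi>" "sw.height = height" "norm sw.j = norm j" "sw.related = related"
      by (auto simp: fun_eq_iff sw.\<xi>_def sw.\<eta>_def \<xi>_def \<eta>_def sw.height_def height_def sw.j_def j_def
          sw.related_def related_def max.commute norm_minus_commute mult.commute)
    show ?thesis
      using sw.no_four_related_aux[OF prim, of v3 v1 v2 v4] J unit' det le rel False
      unfolding eqs by (simp add: norm_minus_commute)
  qed
qed

end

section \<open>Extension of p-adic valuations to the complex numbers\<close>

definition is_subring :: "complex set \<Rightarrow> bool" where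
  "is_subring R \<longleftrightarrow> 1 \<in> R \<and> (\<forall>x\<in>R. \<forall>y\<in>R. x - y \<in> R \<and> x * y \<in> R)"

lemma is_subring_closed:
  assumes "is_subring R"
  shows "0 \<in> R" "1 \<in> R" "x \<in> R \<Longrightarrow> - x \<in> R" "x \<in> R \<Longrightarrow> y \<in> R \<Longrightarrow> x + y \<in> R"
    "x \<in> R \<Longrightarrow> y \<in> R \<Longrightarrow> x - y \<in> R" "x \<in> R \<Longrightarrow> y \<in> R \<Longrightarrow> x * y \<in> R"
proof -
  show 1: "1 \<in> R" and 2: "x \<in> R \<Longrightarrow> y \<in> R \<Longrightarrow> x - y \<in> R" and "x \<in> R \<Longrightarrow> y \<in> R \<Longrightarrow> x * y \<in> R" for x y
    using assms by (auto simp: is_subring_def)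
  show 0: "0 \<in> R" using 2[OF 1 1] by simp
  show 3: "x \<in> R \<Longrightarrow> - x \<in> R" for x using 2[OF 0, of x] by simp
  show "x \<in> R \<Longrightarrow> y \<in> R \<Longrightarrow> x + y \<in> R" using 2[of x "- y"] 3[of y] by simp
qed

lemma is_subring_power: "is_subring R \<Longrightarrow> x \<in> R \<Longrightarrow> x ^ n \<in> R"
  by (induction n) (auto intro: is_subring_closed)

lemma is_subring_sum: "is_subring R \<Longrightarrow> (\<And>i. i \<in> I \<Longrightarrow> f i \<in> R) \<Longrightarrow> sum f I \<in> R"
  by (induction I rule: infinite_finite_induct) (auto intro: is_subring_closed)

lemma is_subring_prod: "is_subring R \<Longrightarrow> (\<And>i. i \<in> I \<Longrightarrow> f i \<in> R) \<Longrightarrow> prod f I \<in> R"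
  by (induction I rule: infinite_finite_induct) (auto intro: is_subring_closed)

lemma is_subring_of_nat: "is_subring R \<Longrightarrow> of_nat n \<in> R"
  by (induction n) (auto intro: is_subring_closed)

lemma is_subring_of_int: "is_subring R \<Longrightarrow> of_int k \<in> R"
  by (cases k) (auto intro: is_subring_closed is_subring_of_nat simp flip: of_nat_Suc)

definition adjoin :: "complex set \<Rightarrow> complex \<Rightarrow> complex set" where
  "adjoin R x = {poly q x | q. \<forall>i. coeff q i \<in> R}"

lemma adjoin_base: "is_subring R \<Longrightarrow> R \<subseteq> adjoin R x"
proof
  fix a assume R: "is_subring R" "a \<in> R"
  then have "\<forall>i. coeff [:a:] i \<in> R" by (auto simp: coeff_pCons is_subring_closed split: nat.splits)
  then show "a \<in> adjoin R x" unfolding adjoin_def by (intro CollectI exI[of _ "[:a:]"]) auto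
qed

lemma adjoin_self: "is_subring R \<Longrightarrow> x \<in> adjoin R x"
  unfolding adjoin_def
  by (intro CollectI exI[of _ "[:0, 1:]"]) (auto simp: coeff_pCons is_subring_closed split: nat.splits)

lemma is_subring_adjoin:
  assumes "is_subring R"
  shows "is_subring (adjoin R x)"
  unfolding is_subring_def
proof (intro conjI ballI)
  show "1 \<in> adjoin R x" using adjoin_base[OF assms] is_subring_closed(2)[OF assms] by blast
  fix a b assume "a \<in> adjoin R x" "b \<in> adjoin R x"
  then obtain q q' where q: "a = poly q x" "b = poly q' x" "\<And>i. coeff q i \<in> R" "\<And>i. coeff q' i \<in> R"
    by (auto simp: adjoin_def)
  have "\<forall>i. coeff (q - q') i \<in> R" using q assms by (auto intro: is_subring_closed)
  then show "a - b \<in> adjoin R x" unfolding adjoin_def using q by (intro CollectI exI[of _ "q - q'"]) auto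
  have "\<forall>i. coeff (q * q') i \<in> R"
    using q assms by (auto simp: coeff_mult intro!: is_subring_sum is_subring_closed(6))
  then show "a * b \<in> adjoin R x" unfolding adjoin_def using q by (intro CollectI exI[of _ "q * q'"]) auto
qed

lemma exists_maximal_subring:
  fixes u :: complex
  assumes "u \<notin> \<int>"
  shows "\<exists>R. is_subring R \<and> u \<notin> R \<and> (\<forall>R'. is_subring R' \<longrightarrow> u \<notin> R' \<longrightarrow> R \<subseteq> R' \<longrightarrow> R' = R)"
proof -
  let ?\<A> = "{R. is_subring R \<and> u \<notin> R}"
  have "\<exists>M\<in>?\<A>. \<forall>X\<in>?\<A>. M \<subseteq> X \<longrightarrow> X = M"
  proof (rule subset_Zorn_nonempty)
    have "\<int> \<in> ?\<A>" using assms by (auto simp: is_subring_def)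
    then show "?\<A> \<noteq> {}" by blast
    fix \<C> assume \<C>: "\<C> \<noteq> {}" "subset.chain ?\<A> \<C>"
    have "is_subring (\<Union>\<C>)" unfolding is_subring_def
    proof (intro conjI ballI)
      show "1 \<in> \<Union>\<C>" using \<C> by (auto simp: subset.chain_def is_subring_def)
      fix a b assume "a \<in> \<Union>\<C>" "b \<in> \<Union>\<C>"
      then obtain R R' where R: "a \<in> R" "R \<in> \<C>" "b \<in> R'" "R' \<in> \<C>" by blast
      then have "R \<subseteq> R' \<or> R' \<subseteq> R" using \<C> by (auto simp: subset.chain_def)
      then obtain S where S: "S \<in> \<C>" "a \<in> S" "b \<in> S" using R by blast
      then have "is_subring S" using \<C> by (auto simp: subset.chain_def)
      then show "a - b \<in> \<Union>\<C>" "a * b \<in> \<Union>\<C>" using S by (auto simp: is_subring_def)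
    qed
    then show "\<Union>\<C> \<in> ?\<A>" using \<C> by (auto simp: subset.chain_def)
  qed
  then show ?thesis by blast
qed

text \<open>
  Chevalley's extension theorem for the place \<open>p\<close>: a subring of the complex numbers that is maximal
  with respect to not containing \<open>1 / p\<close> is a valuation ring.
\<close>

lemma exists_valuation_ring:
  fixes p :: int
  assumes p: "p \<ge> 2"
  shows "\<exists>R. is_subring R \<and> 1 / of_int p \<notin> R \<and> (\<forall>x. x \<noteq> 0 \<longrightarrow> x \<in> R \<or> 1 / x \<in> R)"
proof -
  define P where "P = complex_of_int p"
  have P0: "P \<noteq> 0" using p by (simp add: P_def)
  have "1 / P \<notin> \<int>"
  proof
    assume "1 / P \<in> \<int>"
    then obtain k where "1 / P = of_int k" by (auto elim: Ints_cases)
    then have "1 = complex_of_int (k * p)" using P0 by (simp add: P_def field_simps)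
    then have "k * p = 1" by (metis of_int_eq_1_iff)
    with p show False by (metis abs_ge_self dvdI dvd_triv_right linorder_not_le zdvd_imp_le zero_less_one one_less_numeral_iff semiring_norm(76) order_less_le_trans)
  qed
  then obtain R where R: "is_subring R" "1 / P \<notin> R"
    and max: "\<And>R'. is_subring R' \<Longrightarrow> 1 / P \<notin> R' \<Longrightarrow> R \<subseteq> R' \<Longrightarrow> R' = R"
    using exists_maximal_subring by metis
  note closed = is_subring_closed[OF R(1)]
  have PR: "P \<in> R" unfolding P_def by (rule is_subring_of_int[OF R(1)])
  have adjoin: "1 / P \<in> adjoin R x" if "x \<notin> R" for x
  proof (rule ccontr)
    assume "1 / P \<notin> adjoin R x"
    then have "adjoin R x = R"
      using max is_subring_adjoin[OF R(1)] adjoin_base[OF R(1)] by blast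
    with adjoin_self[OF R(1)] that show False by blast
  qed
  \<comment> \<open>Elements congruent to \<open>1\<close> modulo \<open>P\<close> are units of
    \<open>R\<close>. Otherwise maximality puts \<open>1 / P\<close> into
    \<open>adjoin R (1 / u)\<close>; clearing denominators gives \<open>u ^ n / P \<in> R\<close>,
    and \<open>u ^ n = 1 - P * b\<close> then gives \<open>1 / P \<in> R\<close>.\<close>
  have inv: "1 / (1 - P * a) \<in> R" if a: "a \<in> R" for a
  proof (rule ccontr)
    define u where "u = 1 - P * a"
    assume "1 / (1 - P * a) \<notin> R"
    then have "1 / P \<in> adjoin R (1 / u)" using adjoin by (simp add: u_def)
    then obtain q where q: "1 / P = poly q (1 / u)" "\<And>i. coeff q i \<in> R" by (auto simp: adjoin_def)
    have "u \<noteq> 0"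
    proof
      assume "u = 0"
      then have "a = 1 / P" using P0 by (simp add: u_def field_simps)
      with a R show False by simp
    qed
    have uR: "u \<in> R" unfolding u_def using a PR closed by simp
    define n where "n = degree q"
    have "u ^ n / P = (\<Sum>i\<le>n. coeff q i * u ^ (n - i))"
    proof -
      have "u ^ n / P = u ^ n * (1 / P)" by simp
      also have "1 / P = (\<Sum>i\<le>n. coeff q i * (1 / u) ^ i)"
        using q(1) by (simp only: poly_altdef n_def)
      also have "u ^ n * (\<Sum>i\<le>n. coeff q i * (1 / u) ^ i) = (\<Sum>i\<le>n. u ^ n * (coeff q i * (1 / u) ^ i))"
        by (rule sum_distrib_left)
      also have "\<dots> = (\<Sum>i\<le>n. coeff q i * u ^ (n - i))"
        using \<open>u \<noteq> 0\<close>
        by (intro sum.cong) (auto simp: power_divide power_diff)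
      finally show ?thesis .
    qed
    also have "\<dots> \<in> R" using q(2) uR
      by (intro is_subring_sum[OF R(1)] closed(6) is_subring_power[OF R(1)])
    finally have 1: "u ^ n / P \<in> R" .
    have "\<exists>b\<in>R. u ^ n = 1 - P * b"
    proof (induction n)
      case 0
      show ?case using closed(1) by (intro bexI[of _ 0]) auto
    next
      case (Suc n)
      then obtain b where b: "b \<in> R" "u ^ n = 1 - P * b" by blast
      then have "u ^ Suc n = (1 - P * a) * (1 - P * b)" by (simp add: u_def)
      then have "u ^ Suc n = 1 - P * (b + a - P * a * b)" by (simp add: algebra_simps)
      moreover have "b + a - P * a * b \<in> R" using a b PR by (intro closed) auto
      ultimately show ?case by blast
    qed
    then obtain b where b: "b \<in> R" "u ^ n = 1 - P * b" by blast
    then have "1 / P = u ^ n / P + b" using P0 by (simp add: field_simps)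
    with closed(4)[OF 1 b(1)] R(2) show False by simp
  qed
  \<comment> \<open>Multiplying the relation for \<open>x\<close> by \<open>P * y ^ m\<close>
    expresses \<open>(1 - P * coeff q 0) * y ^ m\<close> through lower powers of \<open>y\<close>,
    and the leading coefficient is a unit by \<open>inv\<close>.\<close>
  have monic: "\<exists>e. (\<forall>i. coeff e i \<in> R) \<and> (e = 0 \<or> degree e < degree q) \<and> y ^ degree q = poly e y"
    if y: "y * x = 1" and q: "1 / P = poly q x" "\<And>i. coeff q i \<in> R" for q x y
  proof -
    define m where "m = degree q"
    define c where "c = P / (1 - P * coeff q 0)"
    have u0: "1 - P * coeff q 0 \<noteq> 0"
    proof
      assume "1 - P * coeff q 0 = 0"
      then have "coeff q 0 = 1 / P" using P0 by (simp add: field_simps)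
      with q(2)[of 0] R(2) show False by simp
    qed
    have cR: "c \<in> R"
      using closed(6)[OF PR inv[OF q(2)[of 0]]] by (simp add: c_def)
    define e where "e = (\<Sum>i\<in>{1..m}. monom (c * coeff q i) (m - i))"
    have "coeff e k \<in> R" for k
      unfolding e_def coeff_sum using cR q(2) closed
      by (intro is_subring_sum[OF R(1)]) (auto intro: closed)
    moreover have "e = 0 \<or> degree e < m"
    proof (cases "m = 0")
      case True
      then show ?thesis by (simp add: e_def)
    next
      case False
      have "degree e \<le> m - 1" unfolding e_def
        by (intro degree_sum_le order_trans[OF degree_monom_le]) auto
      with False show ?thesis by arith
    qed
    moreover have "y ^ m = poly e y"
    proof -
      have pow: "y ^ m * x ^ i = y ^ (m - i)" if "i \<le> m" for i
      proof -
        have "y ^ m = y ^ (m - i) * y ^ i" using that by (simp flip: power_add)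
        then show ?thesis using y by (simp add: mult.assoc flip: power_mult_distrib)
      qed
      have "y ^ m / P = y ^ m * (1 / P)" by simp
      also have "1 / P = (\<Sum>i\<le>m. coeff q i * x ^ i)"
        using q(1) by (simp only: poly_altdef m_def)
      also have "y ^ m * (\<Sum>i\<le>m. coeff q i * x ^ i) = (\<Sum>i\<le>m. coeff q i * (y ^ m * x ^ i))"
        unfolding sum_distrib_left by (simp only: mult.left_commute)
      also have "\<dots> = (\<Sum>i\<le>m. coeff q i * y ^ (m - i))" using pow by (intro sum.cong) auto
      also have "{..m} = insert 0 {1..m}" by auto
      also have "(\<Sum>i\<in>insert 0 {1..m}. coeff q i * y ^ (m - i)) =
        coeff q 0 * y ^ m + (\<Sum>i\<in>{1..m}. coeff q i * y ^ (m - i))" by simp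
      finally have "(1 - P * coeff q 0) * y ^ m = P * (\<Sum>i\<in>{1..m}. coeff q i * y ^ (m - i))"
        using P0 by (simp add: field_simps)
      then have "y ^ m = c * (\<Sum>i\<in>{1..m}. coeff q i * y ^ (m - i))"
        using u0 by (simp add: c_def field_simps)
      also have "\<dots> = poly e y"
        by (simp add: e_def poly_sum poly_monom sum_distrib_left mult.assoc)
      finally show ?thesis .
    qed
    ultimately show ?thesis by (auto simp: m_def)
  qed
  \<comment> \<open>The monic relation for \<open>y\<close> cancels the leading term of
    \<open>q2\<close>; this is possible because its degree does not exceed that of
    \<open>q2\<close>.\<close>
  have descent: "\<exists>q'. 1 / P = poly q' y \<and> (\<forall>i. coeff q' i \<in> R) \<and> degree q' < degree q2"
    if yx: "y * x = 1" and q1: "1 / P = poly q1 x" "\<And>i. coeff q1 i \<in> R"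
      and q2: "1 / P = poly q2 y" "\<And>i. coeff q2 i \<in> R" and deg: "degree q1 \<le> degree q2" for x y q1 q2
  proof -
    obtain e where e: "\<And>i. coeff e i \<in> R" "e = 0 \<or> degree e < degree q1" "y ^ degree q1 = poly e y"
      using monic[OF yx q1] by blast
    define n m where "n = degree q2" and "m = degree q1"
    have n0: "n > 0"
    proof (rule ccontr)
      assume "\<not> n > 0"
      then obtain a where "q2 = [:a:]" using degree_eq_zeroE by (auto simp: n_def)
      with q2(1) q2(2)[of 0] R(2) show False by simp
    qed
    define f where "f = monom (coeff q2 n) (n - m) * (monom 1 m - e)"
    have deg_sub: "degree (monom 1 m - e :: complex poly) \<le> m"
      using e(2) by (intro degree_diff_le) (auto simp: degree_monom_le m_def)
    have deg_f: "degree f \<le> n"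
      using degree_mult_le[of "monom (coeff q2 n) (n - m)" "monom 1 m - e"] deg_sub
        degree_monom_le[of "coeff q2 n" "n - m"] deg by (simp add: f_def n_def m_def)
    have "coeff e m = 0" using e(2) by (auto simp: m_def coeff_eq_0)
    then have coeff_f: "coeff f n = coeff q2 n"
      using deg by (simp add: f_def coeff_monom_mult n_def m_def)
    have "degree (q2 - f) < n"
    proof (rule ccontr)
      assume "\<not> degree (q2 - f) < n"
      moreover have "degree (q2 - f) \<le> n" using deg_f by (intro degree_diff_le) (auto simp: n_def)
      ultimately have "degree (q2 - f) = n" by simp
      then have "coeff (q2 - f) (degree (q2 - f)) = 0" using coeff_f by simp
      then have "q2 - f = 0" by (simp only: leading_coeff_0_iff)
      with \<open>degree (q2 - f) = n\<close> n0 show False by simp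
    qed
    moreover have "poly f y = 0" using e(3) by (simp add: f_def poly_monom m_def)
    moreover have "coeff (q2 - f) i \<in> R" for i
      using q2(2) e(1) closed by (auto simp: f_def coeff_monom_mult)
    ultimately show ?thesis using q2(1) by (intro exI[of _ "q2 - f"]) (auto simp: n_def)
  qed
  \<comment> \<open>If neither lies in \<open>R\<close>, both \<open>adjoin R x\<close> and
    \<open>adjoin R (1 / x)\<close> contain \<open>1 / P\<close>. With representations of least
    degree in both, the descent shortens the one of larger degree.\<close>
  have "x \<in> R \<or> 1 / x \<in> R" if x: "x \<noteq> 0" for x
  proof (rule ccontr)
    assume not: "\<not> (x \<in> R \<or> 1 / x \<in> R)"
    define V where "V y d \<longleftrightarrow> (\<exists>q. 1 / P = poly q y \<and> (\<forall>i. coeff q i \<in> R) \<and> degree q = d)" for y d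
    have ex: "\<exists>d. V y d" if "y \<notin> R" for y
      using adjoin[OF that] by (auto simp: V_def adjoin_def)
    define d1 d2 where "d1 = (LEAST d. V x d)" and "d2 = (LEAST d. V (1 / x) d)"
    have V: "V x d1" "V (1 / x) d2"
      unfolding d1_def d2_def using ex not by (meson LeastI_ex)+
    have least: "\<not> V x d" if "d < d1" for d using that not_less_Least by (auto simp: d1_def)
    have least': "\<not> V (1 / x) d" if "d < d2" for d using that not_less_Least by (auto simp: d2_def)
    obtain q1 q2 where q1: "1 / P = poly q1 x" "\<And>i. coeff q1 i \<in> R" "degree q1 = d1"
      and q2: "1 / P = poly q2 (1 / x)" "\<And>i. coeff q2 i \<in> R" "degree q2 = d2"
      using V unfolding V_def by blast
    show False
    proof (cases "d1 \<le> d2")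
      case True
      then obtain q' where "1 / P = poly q' (1 / x)" "\<forall>i. coeff q' i \<in> R" "degree q' < d2"
        using descent[of "1 / x" x q1 q2] q1 q2 x by auto
      then show False using least'[of "degree q'"] unfolding V_def by blast
    next
      case False
      then obtain q' where "1 / P = poly q' x" "\<forall>i. coeff q' i \<in> R" "degree q' < d1"
        using descent[of x "1 / x" q2 q1] q1 q2 x by auto
      then show False using least[of "degree q'"] unfolding V_def by blast
    qed
  qed
  with R show ?thesis unfolding P_def by blast
qed

section \<open>Classes of solutions\<close>

locale valuation_ring =
  fixes p :: int and R :: "complex set"
  assumes p: "prime p" and R: "is_subring R" and p_R: "1 / of_int p \<notin> R"
    and total: "\<And>x. x \<noteq> 0 \<Longrightarrow> x \<in> R \<or> 1 / x \<in> R"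
begin

lemmas closed = is_subring_closed[OF R]

lemma of_int_R [simp]: "of_int k \<in> R"
  by (rule is_subring_of_int[OF R])

definition unit :: "complex \<Rightarrow> bool" where
  "unit x \<longleftrightarrow> x \<in> R \<and> x \<noteq> 0 \<and> 1 / x \<in> R"

lemma unit_R: "unit x \<Longrightarrow> x \<in> R"
  by (simp add: unit_def)

lemma unit_1: "unit 1"
  using closed by (simp add: unit_def)

lemma unit_mult: "unit x \<Longrightarrow> unit y \<Longrightarrow> unit (x * y)"
  using closed(6)[of x y] closed(6)[of "1 / x" "1 / y"] by (simp add: unit_def)

lemma unit_mult_left:
  assumes "unit (x * y)" "x \<in> R" "y \<in> R"
  shows "unit x"
proof -
  have "1 / x = y * (1 / (x * y))" using assms by (simp add: unit_def)
  also have "\<dots> \<in> R" using assms by (intro closed(6)) (auto simp: unit_def)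
  finally show ?thesis using assms by (auto simp: unit_def)
qed

lemma unit_mult_right: "unit (x * y) \<Longrightarrow> x \<in> R \<Longrightarrow> y \<in> R \<Longrightarrow> unit y"
  using unit_mult_left[of y x] by (simp add: mult.commute)

text \<open>One of the two quotients lies in \<open>R\<close>, so one summand factors out of the
  sum: the non-units are closed under addition and \<open>R\<close> is a local ring.\<close>

lemma not_unit_add:
  assumes "x \<in> R" "y \<in> R" "\<not> unit x" "\<not> unit y"
  shows "\<not> unit (x + y)"
proof
  assume u: "unit (x + y)"
  show False
  proof (cases "x = 0 \<or> y = 0")
    case True
    with u assms show False by auto
  next
    case False
    then consider "x / y \<in> R" | "y / x \<in> R" using total[of "x / y"] by auto
    then show False
    proof cases
      case 1
      have "x + y = y * (1 + x / y)" using False by (simp add: field_simps)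
      with u assms 1 unit_mult_left[of y "1 + x / y"] closed show False by metis
    next
      case 2
      have "x + y = x * (1 + y / x)" using False by (simp add: field_simps)
      with u assms 2 unit_mult_left[of x "1 + y / x"] closed show False by metis
    qed
  qed
qed

lemma unit_uminus: "unit (- x) \<longleftrightarrow> unit x"
  using closed(3)[of x] closed(3)[of "- x"] closed(3)[of "1 / x"] closed(3)[of "- (1 / x)"]
  by (auto simp: unit_def)

lemma not_unit_diff:
  assumes "x \<in> R" "y \<in> R" "\<not> unit x" "\<not> unit y"
  shows "\<not> unit (x - y)"
  using not_unit_add[of x "- y"] assms closed(3)[of y] unit_uminus[of y] by simp

lemma unit_add:
  assumes "unit x" "y \<in> R" "\<not> unit y"
  shows "unit (x + y)"
  using not_unit_diff[of "x + y" y] assms closed(4)[of x y] unit_R by auto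

lemma unit_prod: "(\<And>i. i \<in> I \<Longrightarrow> unit (f i)) \<Longrightarrow> unit (prod f I)"
  by (induction I rule: infinite_finite_induct) (auto intro: unit_mult unit_1)

lemma unit_prodD:
  assumes "finite I" "unit (prod f I)" "\<And>i. i \<in> I \<Longrightarrow> f i \<in> R" "i \<in> I"
  shows "unit (f i)"
proof -
  have "prod f I = f i * prod f (I - {i})" using assms by (simp add: prod.remove)
  moreover have "prod f (I - {i}) \<in> R" using assms by (intro is_subring_prod[OF R]) auto
  ultimately show ?thesis using unit_mult_left assms by metis
qed

lemma not_unit_p: "\<not> unit (of_int p)"
  using p_R by (simp add: unit_def)

text \<open>A Bezout relation writes \<open>u * k\<close> as \<open>1 - w * p\<close>, which is a
  unit because \<open>p\<close> is not.\<close>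

lemma unit_of_int:
  assumes "\<not> p dvd k"
  shows "unit (of_int k)"
proof -
  have "coprime k p" using prime_imp_coprime[OF p assms] by (simp add: coprime_commute)
  then obtain u w where uw: "u * k + w * p = 1"
    using bezout_int[of k p] by (auto simp: coprime_iff_gcd_eq_1)
  have "\<not> unit (of_int (- w) * of_int p)"
    using unit_mult_right[of "of_int (- w)" "of_int p"] not_unit_p of_int_R by blast
  moreover have "of_int (- w) * of_int p \<in> R" by (intro closed(6) of_int_R)
  ultimately have "unit (1 + of_int (- w) * of_int p)" using unit_add[OF unit_1] by blast
  also have "1 + of_int (- w) * of_int p = complex_of_int (1 - w * p)" by simp
  also have "1 - w * p = u * k" using uw by simp
  finally show ?thesis using unit_mult_right[of "of_int u" "of_int k"] by simp
qed

text \<open>A fraction in \<open>R\<close> cannot have \<open>p\<close> in its reduced denominator,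
  since integers prime to \<open>p\<close> are units and \<open>1 / p \<notin> R\<close>. This turns
  membership in \<open>R\<close> back into divisibility of integers.\<close>

lemma power_dvd_of_quotient:
  assumes "of_int d / of_int p ^ e \<in> R"
  shows "p ^ e dvd d"
  using assms
proof (induction e arbitrary: d)
  case (Suc e)
  have p0: "complex_of_int p \<noteq> 0" using p by auto
  have "x / P = P ^ e * (x / P ^ Suc e)" if "P \<noteq> 0" for x P :: complex
    using that by (simp add: field_simps)
  from this[OF p0] have "complex_of_int d / of_int p = of_int (p ^ e) * (of_int d / of_int p ^ Suc e)"
    by (simp only: of_int_power)
  also have "\<dots> \<in> R" using Suc.prems by (intro closed(6) of_int_R)
  finally have dR: "of_int d / of_int p \<in> R" .
  have "p dvd d"
  proof (rule ccontr)
    assume "\<not> p dvd d"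
    then have u: "unit (of_int d)" by (rule unit_of_int)
    then have "1 / of_int p = (complex_of_int d / of_int p) * (1 / of_int d)" by (simp add: unit_def)
    also have "\<dots> \<in> R" using dR u by (intro closed(6)) (auto simp: unit_def)
    finally show False using p_R by simp
  qed
  then obtain d1 where d1: "d = p * d1" by auto
  have "complex_of_int d1 / of_int p ^ e = of_int d / of_int p ^ Suc e" using p0 by (simp add: d1)
  then have "p ^ e dvd d1" using Suc.prems Suc.IH[of d1] by simp
  then show ?case by (simp add: d1)
qed auto

text \<open>Gauss's lemma for one factor. If \<open>a\<close> is a unit, the lowest unit coefficient
  of \<open>P\<close> survives at its own index; otherwise the highest one survives, shifted by one
  and multiplied by \<open>b\<close>.\<close>

lemma gauss_linear_factor:
  assumes P: "\<And>i. coeff P i \<in> R" "\<exists>k. unit (coeff P k)"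
    and ab: "a \<in> R" "b \<in> R" "unit a \<or> unit b"
  shows "(\<forall>i. coeff ([:a, b:] * P) i \<in> R) \<and> (\<exists>k. unit (coeff ([:a, b:] * P) k))"
proof
  have coeff: "coeff ([:a, b:] * P) k = a * coeff P k + (if k = 0 then 0 else b * coeff P (k - 1))" for k
    by (cases k) auto
  show "\<forall>i. coeff ([:a, b:] * P) i \<in> R" unfolding coeff using P ab by (auto intro!: closed)
  show "\<exists>k. unit (coeff ([:a, b:] * P) k)"
  proof (cases "unit a")
    case True
    define k where "k = (LEAST k. unit (coeff P k))"
    have k: "unit (coeff P k)" unfolding k_def using P(2) by (rule LeastI_ex)
    have less: "\<not> unit (coeff P i)" if "i < k" for i using that not_less_Least by (auto simp: k_def)
    define y where "y = (if k = 0 then 0 else b * coeff P (k - 1))"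
    have "y \<in> R" using P ab closed by (auto simp: y_def intro!: closed)
    moreover have "\<not> unit y"
      using less[of "k - 1"] unit_mult_right[of b "coeff P (k - 1)"] P ab by (auto simp: y_def unit_def)
    ultimately have "unit (a * coeff P k + y)" using True k by (intro unit_add unit_mult) auto
    then have "unit (coeff ([:a, b:] * P) k)" by (simp only: coeff y_def)
    then show ?thesis by blast
  next
    case False
    with ab have b: "unit b" by simp
    define k where "k = (GREATEST k. unit (coeff P k))"
    have bound: "i \<le> degree P" if "unit (coeff P i)" for i
      using that by (intro le_degree) (auto simp: unit_def)
    have k: "unit (coeff P k)" unfolding k_def using P(2) bound by (metis (mono_tags, lifting) GreatestI_ex_nat)
    have "\<not> unit (coeff P (Suc k))"
    proof
      assume "unit (coeff P (Suc k))"
      then have "Suc k \<le> k" unfolding k_def using bound by (intro Greatest_le_nat) auto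
      then show False by simp
    qed
    then have "\<not> unit (a * coeff P (Suc k))" using unit_mult_right P ab by blast
    moreover have "a * coeff P (Suc k) \<in> R" using P ab by (intro closed)
    ultimately have "unit (b * coeff P k + a * coeff P (Suc k))" using b k by (intro unit_add unit_mult) auto
    also have "b * coeff P k + a * coeff P (Suc k) = coeff ([:a, b:] * P) (Suc k)"
      by (simp add: coeff)
    finally show ?thesis by blast
  qed
qed

lemma gauss_prod:
  fixes n :: nat
  assumes "\<And>i. i < n \<Longrightarrow> a i \<in> R \<and> b i \<in> R \<and> (unit (a i) \<or> unit (b i))"
  shows "(\<forall>k. coeff (\<Prod>i<n. [:a i, b i:]) k \<in> R) \<and> (\<exists>k. unit (coeff (\<Prod>i<n. [:a i, b i:]) k))"
  using assms
proof (induction n)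
  case 0
  have "unit (coeff 1 0)" using unit_1 by simp
  moreover have "coeff 1 k \<in> R" for k using closed by (simp add: coeff_1)
  ultimately show ?case by auto
next
  case (Suc n)
  then show ?case
    using gauss_linear_factor[of "\<Prod>i<n. [:a i, b i:]" "a n" "b n"] by (simp add: mult.commute del: mult_pCons_left mult_pCons_right)
qed

end

section \<open>Labels of solutions at the primes dividing \<open>h\<close>\<close>

lemma prod_pairs:
  fixes c :: "nat \<Rightarrow> 'a :: comm_monoid_mult"
  shows "(\<Prod>j<r. \<Prod>i<j. c i * c j) = (\<Prod>i<r. c i) ^ (r - 1)"
proof (induction r)
  case (Suc r)
  have "(\<Prod>j<Suc r. \<Prod>i<j. c i * c j) = (\<Prod>j<r. \<Prod>i<j. c i * c j) * (\<Prod>i<r. c i * c r)"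
    by simp
  also have "\<dots> = (\<Prod>i<r. c i) ^ (r - 1) * ((\<Prod>i<r. c i) * c r ^ r)"
    unfolding Suc by (simp add: prod.distrib)
  also have "\<dots> = (\<Prod>i<r. c i) ^ r * c r ^ r"
    by (cases r) (auto simp: mult_ac)
  finally show ?case by (simp add: power_mult_distrib)
qed auto

text \<open>Each linear factor is scaled to have coefficients in \<open>R\<close>, one of them
  \<open>1\<close>. As the discriminant is a unit, so are the total scaling constant
  \<open>c0\<close> and the determinants of pairs of factors. At a primitive solution a single
  factor is then a non-unit and must absorb all of \<open>p ^ e\<close>; its index is the
  label.\<close>

lemma root_labels_prime_power:
  fixes F :: "nat \<Rightarrow> int" and a b :: "nat \<Rightarrow> complex" and p \<Delta> :: int
  assumes r: "r \<ge> 2" and p: "prime p" and e: "e > 0"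
    and factors: "\<And>x y. form_eval r F x y = (\<Prod>i<r. a i * x + b i * y)"
    and disc: "of_int \<Delta> = (\<Prod>j<r. \<Prod>i<j. (a i * b j - a j * b i)\<^sup>2)"
    and p_disc: "\<not> p dvd \<Delta>"
  shows "\<exists>l :: int \<times> int \<Rightarrow> nat.
    (\<forall>v. coprime (fst v) (snd v) \<longrightarrow> p ^ e dvd form_eval r F (fst v) (snd v) \<longrightarrow> l v < r) \<and>
    (\<forall>v v'. coprime (fst v) (snd v) \<longrightarrow> p ^ e dvd form_eval r F (fst v) (snd v) \<longrightarrow>
            coprime (fst v') (snd v') \<longrightarrow> p ^ e dvd form_eval r F (fst v') (snd v') \<longrightarrow>
            l v = l v' \<longrightarrow> p ^ e dvd fst v * snd v' - fst v' * snd v)"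
proof -
  obtain R where R: "is_subring R" "1 / of_int p \<notin> R" "\<forall>x. x \<noteq> 0 \<longrightarrow> x \<in> R \<or> 1 / x \<in> R"
    using exists_valuation_ring[of p] prime_ge_2_int[OF p] by blast
  interpret valuation_ring p R by unfold_locales (use p R in auto)
  have \<Delta>0: "\<Delta> \<noteq> 0" using p_disc by auto
  have nonzero: "a i \<noteq> 0 \<or> b i \<noteq> 0" if i: "i < r" for i
  proof (rule ccontr)
    assume *: "\<not> (a i \<noteq> 0 \<or> b i \<noteq> 0)"
    define k where "k = (if i = 0 then 1 else 0 :: nat)"
    have "k < r" "k \<noteq> i" using r by (auto simp: k_def)
    have "(\<Prod>j<r. \<Prod>i<j. (a i * b j - a j * b i)\<^sup>2) = 0"
    proof (rule prod_zero)
      show "\<exists>j\<in>{..<r}. (\<Prod>i<j. (a i * b j - a j * b i)\<^sup>2) = 0"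
        using * i \<open>k < r\<close> \<open>k \<noteq> i\<close>
        by (intro bexI[of _ "max i k"] prod_zero bexI[of _ "min i k"]) (auto simp: max_def min_def)
    qed auto
    with disc \<Delta>0 show False by simp
  qed
  have "\<exists>c a' b'. a i = c * a' \<and> b i = c * b' \<and> a' \<in> R \<and> b' \<in> R \<and> c \<noteq> 0 \<and> (a' = 1 \<or> b' = 1)"
    if i: "i < r" for i
  proof (cases "a i \<noteq> 0 \<and> b i / a i \<in> R")
    case True
    show ?thesis
      by (rule exI[of _ "a i"], rule exI[of _ 1], rule exI[of _ "b i / a i"]) (use True closed in auto)
  next
    case False
    have bi: "b i \<noteq> 0" using False nonzero[OF i] closed by auto
    have ai: "a i / b i \<in> R"
      using False total[of "b i / a i"] closed by (cases "a i = 0") (auto simp: bi)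
    show ?thesis
      by (rule exI[of _ "b i"], rule exI[of _ "a i / b i"], rule exI[of _ 1]) (use ai bi closed in auto)
  qed
  then obtain c where "\<exists>a' b'. a i = c i * a' \<and> b i = c i * b' \<and> a' \<in> R \<and> b' \<in> R \<and> c i \<noteq> 0 \<and> (a' = 1 \<or> b' = 1)"
    if "i < r" for i
    by metis
  then obtain a' where "\<exists>b'. a i = c i * a' i \<and> b i = c i * b' \<and> a' i \<in> R \<and> b' \<in> R \<and> c i \<noteq> 0 \<and> (a' i = 1 \<or> b' = 1)"
    if "i < r" for i
    by metis
  then obtain b' where cab0: "a i = c i * a' i \<and> b i = c i * b' i \<and> a' i \<in> R \<and> b' i \<in> R \<and> c i \<noteq> 0 \<and> (a' i = 1 \<or> b' i = 1)"
    if "i < r" for i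
    by metis
  then have cab: "\<And>i. i < r \<Longrightarrow> a i = c i * a' i" "\<And>i. i < r \<Longrightarrow> b i = c i * b' i"
      "\<And>i. i < r \<Longrightarrow> a' i \<in> R" "\<And>i. i < r \<Longrightarrow> b' i \<in> R" "\<And>i. i < r \<Longrightarrow> c i \<noteq> 0"
      "\<And>i. i < r \<Longrightarrow> a' i = 1 \<or> b' i = 1"
    by blast+
  define c0 where "c0 = (\<Prod>i<r. c i)"
  have c0_nz: "c0 \<noteq> 0" using cab by (simp add: c0_def)
  define P where "P = (\<Prod>i<r. [:a' i, b' i:])"
  have gauss: "\<And>k. coeff P k \<in> R" "\<exists>k. unit (coeff P k)"
  proof -
    have "unit (a' i) \<or> unit (b' i)" if "i < r" for i using cab(6)[OF that] unit_1 by metis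
    then show "\<And>k. coeff P k \<in> R" "\<exists>k. unit (coeff P k)"
      using gauss_prod[of r a' b'] cab(3,4) unfolding P_def by blast+
  qed
  \<comment> \<open>\<open>c0\<close> is the content: \<open>c0 * P\<close> has integer
    coefficients, and \<open>P\<close> has a unit among its coefficients.\<close>
  have "c0 \<in> R"
  proof -
    have "poly (\<Sum>i\<le>r. monom (of_int (F i)) i) y = poly (smult c0 P) y" for y
    proof -
      have "poly (\<Sum>i\<le>r. monom (of_int (F i)) i) y = form_eval r F 1 y"
        by (simp add: form_eval_def poly_sum poly_monom)
      also have "\<dots> = (\<Prod>i<r. c i * (a' i + b' i * y))"
        unfolding factors using cab by (intro prod.cong) (auto simp: algebra_simps)
      also have "\<dots> = poly (smult c0 P) y"
        by (simp add: c0_def P_def prod.distrib poly_prod mult.commute)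
      finally show ?thesis .
    qed
    then have eq: "(\<Sum>i\<le>r. monom (of_int (F i)) i) = smult c0 P" by (intro poly_eq_poly_eq_iff[THEN iffD1] ext)
    obtain k where k: "unit (coeff P k)" using gauss by blast
    have "c0 * coeff P k = coeff (\<Sum>i\<le>r. monom (of_int (F i)) i) k" by (simp add: eq)
    also have "\<dots> \<in> R"
      unfolding coeff_sum coeff_monom using closed(1) by (intro is_subring_sum[OF R(1)]) auto
    finally have 1: "c0 * coeff P k \<in> R" .
    have "1 / coeff P k \<in> R" using k by (simp only: unit_def)
    from closed(6)[OF 1 this]
    show ?thesis using k by (simp add: unit_def)
  qed
  define d where "d i k = a' i * b' k - a' k * b' i" for i k
  have dR: "d i k \<in> R" if "i < r" "k < r" for i k
    using cab that by (auto simp: d_def intro!: closed)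
  define W where "W = (\<Prod>j<r. \<Prod>i<j. d i j)"
  have WR: "W \<in> R" unfolding W_def by (intro is_subring_prod[OF R(1)] dR) auto
  have "(\<Prod>j<r. \<Prod>i<j. a i * b j - a j * b i) = (\<Prod>j<r. \<Prod>i<j. (c i * c j) * d i j)"
    using cab by (intro prod.cong) (auto simp: d_def algebra_simps)
  also have "\<dots> = c0 ^ (r - 1) * W"
    unfolding prod.distrib[of "\<lambda>i. c i * c _"] prod.distrib[of "\<lambda>j. \<Prod>i<j. c i * c j"] by (simp only: prod_pairs c0_def W_def)
  finally have W_eq: "(\<Prod>j<r. \<Prod>i<j. a i * b j - a j * b i) = c0 ^ (r - 1) * W" .
  \<comment> \<open>Both \<open>c0\<close> and \<open>W\<close> lie in \<open>R\<close> and divide a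
    unit, hence are units. Splitting off one factor \<open>c0\<close> uses
    \<open>r - 1 \<ge> 1\<close>.\<close>
  have "of_int \<Delta> = (c0 ^ (r - 1) * W)\<^sup>2"
    by (simp only: disc W_eq[symmetric] prod_power_distrib)
  moreover have "unit (of_int \<Delta>)" using p_disc by (rule unit_of_int)
  moreover have cpow: "c0 ^ (r - 1) = c0 * c0 ^ (r - 2)" "c0 ^ (r - 2) \<in> R"
  proof -
    have "r - 1 = Suc (r - 2)" using r by simp
    then show "c0 ^ (r - 1) = c0 * c0 ^ (r - 2)" by (simp only: power_Suc)
    show "c0 ^ (r - 2) \<in> R" by (rule is_subring_power[OF R(1) \<open>c0 \<in> R\<close>])
  qed
  ultimately have unit: "unit (c0 * (c0 ^ (r - 2) * W * (c0 ^ (r - 1) * W)))"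
    by (simp add: power2_eq_square mult_ac)
  have c0_unit: "unit c0"
    using unit_mult_left[OF unit] \<open>c0 \<in> R\<close> WR cpow is_subring_power[OF R(1) \<open>c0 \<in> R\<close>] by (auto intro!: closed)
  have "unit (W * (c0 * (c0 ^ (r - 2) * (c0 ^ (r - 1) * W))))"
    using unit by (simp add: mult_ac)
  then have "unit W"
    using \<open>c0 \<in> R\<close> WR cpow is_subring_power[OF R(1) \<open>c0 \<in> R\<close>] by (elim unit_mult_left) (auto intro!: closed)
  have d_unit_less: "unit (d i k)" if "i < k" "k < r" for i k
  proof -
    have "unit (\<Prod>i<k. d i k)"
      using \<open>unit W\<close> that dR unfolding W_def
      by (intro unit_prodD[of "{..<r}" "\<lambda>j. \<Prod>i<j. d i j" k]) (auto intro!: is_subring_prod[OF R(1)])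
    then show ?thesis using that dR by (intro unit_prodD[of "{..<k}" "\<lambda>i. d i k" i]) auto
  qed
  have d_unit: "unit (d i k)" if "i \<noteq> k" "i < r" "k < r" for i k
  proof (cases "i < k")
    case False
    have "d i k = - d k i" by (simp add: d_def)
    with False that show ?thesis using d_unit_less[of k i] unit_uminus by auto
  qed (use that d_unit_less in auto)
  define L where "L i v = a' i * of_int (fst v) + b' i * of_int (snd v)" for i and v :: "int \<times> int"
  have LR: "L i v \<in> R" if "i < r" for i v using cab that by (auto simp: L_def intro!: closed)
  have label: "\<exists>i<r. L i v / of_int p ^ e \<in> R"
    if v: "coprime (fst v) (snd v)" "p ^ e dvd form_eval r F (fst v) (snd v)" for v
  proof -
    obtain m where m: "form_eval r F (fst v) (snd v) = p ^ e * m" using v by auto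
    have "complex_of_int (form_eval r F (fst v) (snd v)) = (\<Prod>i<r. c i * L i v)"
      unfolding of_int_form_eval factors using cab by (intro prod.cong) (auto simp: L_def algebra_simps)
    also have "\<dots> = c0 * (\<Prod>i<r. L i v)" by (simp add: prod.distrib c0_def)
    finally have F: "of_int p ^ e * of_int m = c0 * (\<Prod>i<r. L i v)" by (simp add: m)
    have "\<exists>i<r. \<not> unit (L i v)"
    proof (rule ccontr)
      assume "\<not> (\<exists>i<r. \<not> unit (L i v))"
      then have "unit (c0 * (\<Prod>i<r. L i v))" using c0_unit by (intro unit_mult unit_prod) auto
      then have "unit (of_int p * (of_int p ^ (e - 1) * of_int m))"
        unfolding F[symmetric] using e by (simp add: mult.assoc[symmetric] flip: power_Suc)
      then have "unit (of_int p)"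
        by (rule unit_mult_left) (auto intro!: closed is_subring_power[OF R(1)])
      with not_unit_p show False by simp
    qed
    then obtain i where i: "i < r" "\<not> unit (L i v)" by blast
    \<comment> \<open>By Cramer's rule with the unit determinant \<open>d i k\<close>, two non-unit
      factors would make both coordinates of \<open>v\<close> non-units, hence divisible by
      \<open>p\<close>.\<close>
    have others: "unit (L k v)" if k: "k < r" "k \<noteq> i" for k
    proof (rule ccontr)
      assume nk: "\<not> unit (L k v)"
      have du: "unit (d i k)" using d_unit i k by auto
      have "d i k * of_int (fst v) = b' k * L i v - b' i * L k v"
        by (simp add: d_def L_def algebra_simps)
      moreover have "\<not> unit (b' k * L i v - b' i * L k v)"
        using unit_mult_right[of "b' k" "L i v"] unit_mult_right[of "b' i" "L k v"] i k nk cab(3,4) LR[of i v] LR[of k v]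
        by (intro not_unit_diff) (auto intro!: closed)
      ultimately have "\<not> unit (of_int (fst v))" using du unit_mult by metis
      then have 1: "p dvd fst v" using unit_of_int by blast
      have "d i k * of_int (snd v) = a' i * L k v - a' k * L i v"
        by (simp add: d_def L_def algebra_simps)
      moreover have "\<not> unit (a' i * L k v - a' k * L i v)"
        using unit_mult_right[of "a' k" "L i v"] unit_mult_right[of "a' i" "L k v"] i k nk cab(3,4) LR[of i v] LR[of k v]
        by (intro not_unit_diff) (auto intro!: closed)
      ultimately have "\<not> unit (of_int (snd v))" using du unit_mult by metis
      then have "p dvd snd v" using unit_of_int by blast
      with 1 v(1) p show False by (meson coprime_common_divisor not_prime_unit)
    qed
    define U where "U = c0 * (\<Prod>k\<in>{..<r} - {i}. L k v)"
    have U: "unit U" unfolding U_def using others c0_unit by (intro unit_mult unit_prod) auto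
    have "of_int p ^ e * of_int m = U * L i v"
      unfolding F U_def using i by (simp add: prod.remove[of "{..<r}" i] mult_ac)
    then have "L i v / of_int p ^ e = of_int m * (1 / U)"
      using U p by (auto simp: unit_def field_simps)
    also have "\<dots> \<in> R" using U by (intro closed(6)) (auto simp: unit_def)
    finally show ?thesis using i by blast
  qed
  define l where "l v = (SOME i. i < r \<and> L i v / of_int p ^ e \<in> R)" for v
  have l: "l v < r \<and> L (l v) v / of_int p ^ e \<in> R"
    if "coprime (fst v) (snd v)" "p ^ e dvd form_eval r F (fst v) (snd v)" for v
    unfolding l_def using label[OF that] by (rule someI_ex)
  have "p ^ e dvd fst v * snd v' - fst v' * snd v"
    if v: "coprime (fst v) (snd v)" "p ^ e dvd form_eval r F (fst v) (snd v)"
      "coprime (fst v') (snd v')" "p ^ e dvd form_eval r F (fst v') (snd v')" and eq: "l v = l v'" for v v'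
  proof -
    define i where "i = l v"
    have i: "i < r" "L i v / of_int p ^ e \<in> R" "L i v' / of_int p ^ e \<in> R"
      using l[OF v(1,2)] l[OF v(3,4)] eq by (auto simp: i_def)
    define D where "D = complex_of_int (fst v * snd v' - fst v' * snd v)"
    \<comment> \<open>Eliminating one coordinate from the common factor leaves
      \<open>a' i * D\<close> and \<open>b' i * D\<close>, and one of these coefficients is
      \<open>1\<close>.\<close>
    have 1: "of_int (snd v') * (L i v / of_int p ^ e) - of_int (snd v) * (L i v' / of_int p ^ e) = a' i * D / of_int p ^ e"
      by (simp add: L_def D_def diff_divide_distrib[symmetric] algebra_simps)
    have 2: "of_int (fst v) * (L i v' / of_int p ^ e) - of_int (fst v') * (L i v / of_int p ^ e) = b' i * D / of_int p ^ e"
      by (simp add: L_def D_def diff_divide_distrib[symmetric] algebra_simps)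
    have "a' i * D / of_int p ^ e \<in> R" unfolding 1[symmetric] using i by (intro closed of_int_R)
    moreover have "b' i * D / of_int p ^ e \<in> R" unfolding 2[symmetric] using i by (intro closed of_int_R)
    ultimately have "D / of_int p ^ e \<in> R" using cab(6)[OF i(1)] by auto
    then show ?thesis unfolding D_def by (rule power_dvd_of_quotient)
  qed
  with l show ?thesis by (intro exI[of _ l]) auto
qed

definition det2 :: "int \<times> int \<Rightarrow> int \<times> int \<Rightarrow> int" where
  "det2 v w = fst v * snd w - fst w * snd v"

text \<open>The labels at the single primes form one function, restricted to
  \<open>prime_factors h\<close> so that it ranges over a finite function space. Divisibility of the
  determinant by \<open>h\<close> is checked one prime at a time.\<close>

lemma root_labels:
  fixes F :: "nat \<Rightarrow> int" and a b :: "nat \<Rightarrow> complex" and h \<Delta> :: int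
  assumes r: "r \<ge> 2" and h: "h \<noteq> 0" and coprime: "gcd h \<Delta> = 1"
    and factors: "\<And>x y. form_eval r F x y = (\<Prod>i<r. a i * x + b i * y)"
    and disc: "of_int \<Delta> = (\<Prod>j<r. \<Prod>i<j. (a i * b j - a j * b i)\<^sup>2)"
  shows "\<exists>l :: int \<times> int \<Rightarrow> int \<Rightarrow> nat. \<forall>v. coprime (fst v) (snd v) \<longrightarrow> h dvd form_eval r F (fst v) (snd v) \<longrightarrow>
    l v \<in> prime_factors h \<rightarrow>\<^sub>E {..<r} \<and>
    (\<forall>w. coprime (fst w) (snd w) \<longrightarrow> h dvd form_eval r F (fst w) (snd w) \<longrightarrow> l v = l w \<longrightarrow> h dvd det2 v w)"
proof -
  define good where "good q v \<longleftrightarrow> coprime (fst v) (snd v) \<and> q dvd form_eval r F (fst v) (snd v)" for q and v :: "int \<times> int"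
  define q where "q p = p ^ multiplicity p h" for p :: int
  have "\<exists>l :: int \<times> int \<Rightarrow> nat. (\<forall>v. good (q p) v \<longrightarrow> l v < r) \<and>
      (\<forall>v w. good (q p) v \<longrightarrow> good (q p) w \<longrightarrow> l v = l w \<longrightarrow> q p dvd det2 v w)"
    if p: "p \<in> prime_factors h" for p
  proof -
    have "prime p" "p dvd h" using p by auto
    have "\<not> p dvd \<Delta>"
    proof
      assume "p dvd \<Delta>"
      with \<open>p dvd h\<close> have "p dvd gcd h \<Delta>" by simp
      with coprime \<open>prime p\<close> show False by auto
    qed
    moreover have "multiplicity p h > 0" using p by (simp add: prime_factors_multiplicity)
    ultimately show ?thesis
      using root_labels_prime_power[OF r \<open>prime p\<close> _ factors disc, of "multiplicity p h"]
      unfolding good_def q_def det2_def by blast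
  qed
  then obtain L :: "int \<Rightarrow> int \<times> int \<Rightarrow> nat" where
    L: "p \<in> prime_factors h \<Longrightarrow> (\<forall>v. good (q p) v \<longrightarrow> L p v < r) \<and>
      (\<forall>v w. good (q p) v \<longrightarrow> good (q p) w \<longrightarrow> L p v = L p w \<longrightarrow> q p dvd det2 v w)" for p
    by metis
  define l where "l v = restrict (\<lambda>p. L p v) (prime_factors h)" for v
  have good: "good (q p) v" if "good h v" for p v
    using that multiplicity_dvd[of p h] unfolding good_def q_def by (meson dvd_trans)
  have "l v \<in> prime_factors h \<rightarrow>\<^sub>E {..<r}" if "good h v" for v
    unfolding l_def using L good[OF that] by (intro restrict_PiE_iff[THEN iffD2]) blast
  moreover have "h dvd det2 v w" if "good h v" "good h w" "l v = l w" for v w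
  proof (cases "det2 v w = 0")
    case False
    show ?thesis
    proof (rule multiplicity_le_imp_dvd[OF h])
      fix p :: int assume p: "prime p"
      show "multiplicity p h \<le> multiplicity p (det2 v w)"
      proof (cases "p \<in> prime_factors h")
        case True
        have "L p v = L p w" using fun_cong[OF \<open>l v = l w\<close>, of p] True by (simp add: l_def)
        then have "q p dvd det2 v w" using L[OF True] good that by blast
        then show ?thesis using False p unfolding q_def by (intro multiplicity_geI) auto
      next
        case False
        then have "multiplicity p h = 0" using p by (auto simp: prime_factors_multiplicity)
        then show ?thesis by simp
      qed
    qed
  qed auto
  ultimately show ?thesis unfolding good_def by (intro exI[of _ l]) blast
qed

section \<open>Integral substitutions and restriction of a form to a sublattice\<close>

lemma form_eval_mult_linear:
  "\<exists>c'. \<forall>x y :: complex. form_eval n c x y * (of_int p * x + of_int q * y) = form_eval (Suc n) c' x y"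
proof -
  define c' where "c' i = (if i \<le> n then p * c i else 0) + (if i = 0 then 0 else q * c (i - 1))" for i
  have "form_eval (Suc n) c' x y = form_eval n c x y * (of_int p * x + of_int q * y)" for x y :: complex
  proof -
    have "form_eval (Suc n) c' x y =
      (\<Sum>i\<le>Suc n. (if i \<le> n then of_int (p * c i) * x ^ (Suc n - i) * y ^ i else 0)) +
      (\<Sum>i\<le>Suc n. (if i = 0 then 0 else of_int (q * c (i - 1)) * x ^ (Suc n - i) * y ^ i))"
      unfolding form_eval_def sum.distrib[symmetric] by (intro sum.cong) (auto simp: c'_def algebra_simps)
    also have "(\<Sum>i\<le>Suc n. (if i \<le> n then of_int (p * c i) * x ^ (Suc n - i) * y ^ i else 0)) =
        form_eval n c x y * (of_int p * x)"
      unfolding form_eval_def sum_distrib_right by (simp add: Suc_diff_le mult_ac)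
    also have "(\<Sum>i\<le>Suc n. (if i = 0 then 0 else of_int (q * c (i - 1)) * x ^ (Suc n - i) * y ^ i)) =
        form_eval n c x y * (of_int q * y)"
      unfolding sum.atMost_Suc_shift form_eval_def sum_distrib_right by (simp add: mult_ac)
    finally show ?thesis by (simp add: algebra_simps)
  qed
  then show ?thesis by metis
qed

lemma form_eval_mult_linear_power:
  "\<exists>c'. \<forall>x y :: complex. form_eval n c x y * (of_int p * x + of_int q * y) ^ m = form_eval (n + m) c' x y"
proof (induction m)
  case 0
  show ?case by (intro exI[of _ c]) simp
next
  case (Suc m)
  then obtain c' where c': "\<forall>x y :: complex. form_eval n c x y * (of_int p * x + of_int q * y) ^ m = form_eval (n + m) c' x y"
    by blast
  obtain c'' where c'': "\<forall>x y :: complex. form_eval (n + m) c' x y * (of_int p * x + of_int q * y) = form_eval (Suc (n + m)) c'' x y"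
    using form_eval_mult_linear[of "n + m" c' p q] by blast
  show ?case
  proof (intro exI allI)
    fix x y :: complex
    have "form_eval n c x y * (of_int p * x + of_int q * y) ^ Suc m =
      form_eval n c x y * (of_int p * x + of_int q * y) ^ m * (of_int p * x + of_int q * y)"
      by (simp only: power_Suc2 mult.assoc)
    then show "form_eval n c x y * (of_int p * x + of_int q * y) ^ Suc m = form_eval (n + Suc m) c'' x y"
      using c' c'' by simp
  qed
qed

lemma form_substitution:
  "\<exists>c. \<forall>x y :: complex. form_eval r F (of_int p * x + of_int q * y) (of_int s * x + of_int t * y) = form_eval r c x y"
proof -
  have one: "form_eval 0 (\<lambda>_. 1) x y = 1" for x y :: complex by (simp add: form_eval_def)
  have "\<exists>c. \<forall>x y :: complex. (of_int p * x + of_int q * y) ^ (r - i) * (of_int s * x + of_int t * y) ^ i = form_eval r c x y"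
    if "i \<le> r" for i
  proof -
    obtain c1 where c1: "\<forall>x y :: complex. form_eval 0 (\<lambda>_. 1) x y * (of_int p * x + of_int q * y) ^ (r - i) = form_eval (0 + (r - i)) c1 x y"
      using form_eval_mult_linear_power by blast
    obtain c2 where c2: "\<forall>x y :: complex. form_eval (r - i) c1 x y * (of_int s * x + of_int t * y) ^ i = form_eval (r - i + i) c2 x y"
      using form_eval_mult_linear_power by blast
    show ?thesis using c1 c2 that by (intro exI[of _ c2]) (simp add: one)
  qed
  then obtain c where c: "i \<le> r \<Longrightarrow> \<forall>x y :: complex. (of_int p * x + of_int q * y) ^ (r - i) * (of_int s * x + of_int t * y) ^ i = form_eval r (c i) x y" for i
    by metis
  define C where "C k = (\<Sum>i\<le>r. F i * c i k)" for k
  have "form_eval r F (of_int p * x + of_int q * y) (of_int s * x + of_int t * y) = form_eval r C x y" for x y :: complex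
  proof -
    have "form_eval r F (of_int p * x + of_int q * y) (of_int s * x + of_int t * y) = (\<Sum>i\<le>r. of_int (F i) * form_eval r (c i) x y)"
      unfolding form_eval_def[of r F] using c by (intro sum.cong) (auto simp: mult.assoc)
    also have "\<dots> = (\<Sum>i\<le>r. \<Sum>k\<le>r. of_int (F i * c i k) * x ^ (r - k) * y ^ k)"
      unfolding form_eval_def sum_distrib_left by (simp add: mult.assoc)
    also have "\<dots> = (\<Sum>k\<le>r. \<Sum>i\<le>r. of_int (F i * c i k) * x ^ (r - k) * y ^ k)"
      by (rule sum.swap)
    also have "\<dots> = form_eval r C x y"
      unfolding form_eval_def C_def by (simp add: sum_distrib_right)
    finally show ?thesis .
  qed
  then show ?thesis by blast
qed

text \<open>
  Applied to a solution \<open>v\<close> and a vector \<open>u\<close> that completes it to a basis of the integer lattice: then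
  the lattice spanned by \<open>v\<close> and \<open>h * u\<close> contains the class of \<open>v\<close>.
\<close>

lemma form_divide_lattice:
  fixes v u :: "int \<times> int"
  assumes h: "h > 0" "h dvd form_eval r F (fst v) (snd v)"
  shows "\<exists>g. \<forall>x y :: complex. of_int h * form_eval r g x y =
    form_eval r F (of_int (fst v) * x + of_int (h * fst u) * y) (of_int (snd v) * x + of_int (h * snd u) * y)"
proof -
  obtain c where c: "\<And>x y :: complex. form_eval r F (of_int (fst v) * x + of_int (fst u) * y) (of_int (snd v) * x + of_int (snd u) * y) = form_eval r c x y"
    using form_substitution by blast
  have zero: "form_eval r c 1 0 = complex_of_int (c 0)"
    unfolding form_eval_def by (simp add: power_0_left if_distrib sum.delta cong: if_cong)
  have "complex_of_int (c 0) = of_int (form_eval r F (fst v) (snd v))"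
    unfolding of_int_form_eval using c[of 1 0] zero by simp
  then have "c 0 = form_eval r F (fst v) (snd v)" by (simp only: of_int_eq_iff)
  then have dvd: "h dvd c i * h ^ i" for i
    using h(2) by (cases i) auto
  define g where "g i = c i * h ^ i div h" for i
  have g: "c i * h ^ i = h * g i" for i using dvd[of i] by (simp add: g_def)
  have "of_int h * form_eval r g x y =
    form_eval r F (of_int (fst v) * x + of_int (h * fst u) * y) (of_int (snd v) * x + of_int (h * snd u) * y)" for x y :: complex
  proof -
    have gc: "complex_of_int (c i) * of_int h ^ i = of_int h * of_int (g i)" for i
      using arg_cong[OF g[of i], of complex_of_int] by simp
    have "of_int h * form_eval r g x y = (\<Sum>i\<le>r. (of_int h * of_int (g i)) * x ^ (r - i) * y ^ i)"
      unfolding form_eval_def sum_distrib_left by (simp add: mult.assoc)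
    also have "\<dots> = form_eval r c x (of_int h * y)"
      unfolding form_eval_def by (intro sum.cong) (auto simp: power_mult_distrib mult_ac simp flip: gc)
    also have "\<dots> = form_eval r F (of_int (fst v) * x + of_int (h * fst u) * y) (of_int (snd v) * x + of_int (h * snd u) * y)"
      unfolding c[symmetric] by (simp add: mult_ac)
    finally show ?thesis .
  qed
  then show ?thesis by blast
qed

text \<open>By coprimality the coordinates divide each other, so they agree up to sign. If exactly
  one sign were changed, the vanishing determinant would force a coordinate to be \<open>0\<close>,
  which leads back to the two stated cases.\<close>

lemma coprime_det2_eq_0:
  assumes "coprime (fst v) (snd v)" "coprime (fst w) (snd w)" "det2 v w = 0"
  shows "w = v \<or> w = (- fst v, - snd v)"
proof -
  have eq: "fst v * snd w = fst w * snd v" using assms(3) by (simp add: det2_def)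
  have dvd: "fst v dvd fst w" "snd v dvd snd w"
    if "coprime (fst v) (snd v)" "fst v * snd w = fst w * snd v" for v w :: "int \<times> int"
  proof -
    have "fst v dvd fst w * snd v" "snd v dvd fst v * snd w" using that(2) by (metis dvd_triv_left, simp)
    then show "fst v dvd fst w" "snd v dvd snd w"
      using that(1) by (simp_all add: coprime_dvd_mult_left_iff coprime_dvd_mult_right_iff coprime_commute)
  qed
  have 1: "\<bar>fst v\<bar> = \<bar>fst w\<bar>" "\<bar>snd v\<bar> = \<bar>snd w\<bar>"
    using dvd[OF assms(1) eq] dvd[OF assms(2) eq[symmetric]] by (auto intro: zdvd_antisym_abs)
  then consider "w = v" | "w = (- fst v, - snd v)" | "fst w = fst v" "snd w = - snd v" | "fst w = - fst v" "snd w = snd v"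
    by (cases v; cases w) (force simp: abs_eq_iff)
  then show ?thesis
    using eq by cases (cases v; cases w; force)+
qed

section \<open>Transfer of the estimates to solutions in one class\<close>

context diagonal_form
begin

text \<open>This becomes \<open>related\<close> for the form \<open>F / h\<close>, whose linear
  forms are those of \<open>F\<close> divided by the \<open>r\<close>-th root of
  \<open>h\<close>.\<close>

definition near :: "int \<Rightarrow> int \<times> int \<Rightarrow> bool" where
  "near h v \<longleftrightarrow> height v ^ r \<le> of_int h \<or> norm (\<eta> v - \<xi> v) * height v ^ (r - 1) \<le> of_int h"

text \<open>On the lattice spanned by \<open>v1\<close> and \<open>h * u\<close> the linear forms
  are divided by \<open>l = root r h\<close>, while the index \<open>h\<close> multiplies their
  determinant. The new determinant \<open>j * h / l ^ 2\<close> has norm at least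
  \<open>\<bar>j\<bar>\<close> because \<open>l ^ 2 \<le> l ^ r = h\<close>, so the largeness
  assumption persists.\<close>

lemma no_four_near:
  assumes J: "real r ^ 7 \<le> (norm j / 2) ^ (r - 4)" and h: "h > 0"
    and sol: "\<And>v. v \<in> S \<Longrightarrow> coprime (fst v) (snd v) \<and> \<bar>form_eval r F (fst v) (snd v)\<bar> = h \<and> near h v"
    and cls: "\<And>v w. v \<in> S \<Longrightarrow> w \<in> S \<Longrightarrow> h dvd det2 v w"
    and v: "v1 \<in> S" "v2 \<in> S" "v3 \<in> S" "v4 \<in> S"
    and det: "det2 v1 v2 \<noteq> 0" "det2 v2 v3 \<noteq> 0" "det2 v3 v4 \<noteq> 0"
    and le: "height v1 \<le> height v2" "height v2 \<le> height v3" "height v3 \<le> height v4"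
  shows False
proof -
  obtain y x where "x * fst v1 + y * snd v1 = 1"
    using bezout_int[of "fst v1" "snd v1"] sol[OF v(1)] by (auto simp: coprime_iff_gcd_eq_1)
  then obtain u :: "int \<times> int" where u: "fst v1 * snd u - fst u * snd v1 = 1"
    by (metis add.commute diff_minus_eq_add fst_conv minus_mult_left mult.commute snd_conv)
  have "h dvd form_eval r F (fst v1) (snd v1)" using sol[OF v(1)] by (metis dvd_abs_iff dvd_refl)
  then obtain g where g: "\<And>x y :: complex. of_int h * form_eval r g x y =
    form_eval r F (of_int (fst v1) * x + of_int (h * fst u) * y) (of_int (snd v1) * x + of_int (h * snd u) * y)"
    using form_divide_lattice[OF h] by blast
  define l where "l = root r (of_int h)"
  have l: "l > 0" "l ^ r = of_int h" using h r by (auto simp: l_def)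
  have l1: "l \<ge> 1" using h r by (auto simp: l_def)
  have lc: "complex_of_real l ^ r = of_int h" using arg_cong[OF l(2), of complex_of_real] by simp
  define V where "V = (h * fst u, h * snd u)"
  define \<alpha>' \<beta>' \<gamma>' \<delta>' where "\<alpha>' = \<xi> v1 / of_real l" and "\<beta>' = \<xi> V / of_real l"
    and "\<gamma>' = \<eta> v1 / of_real l" and "\<delta>' = \<eta> V / of_real l"
  define \<kappa>' where "\<kappa>' = \<kappa> / of_real l ^ 2"
  define A' where "A' = A * (fst v1)\<^sup>2 + B * fst v1 * snd v1 + C * (snd v1)\<^sup>2"
  define B' where "B' = 2 * A * fst v1 * fst V + B * (fst v1 * snd V + fst V * snd v1) + 2 * C * snd v1 * snd V"
  define C' where "C' = A * (fst V)\<^sup>2 + B * fst V * snd V + C * (snd V)\<^sup>2"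
  have lin\<xi>: "\<alpha>' * x + \<beta>' * y = (\<alpha> * (of_int (fst v1) * x + of_int (h * fst u) * y) +
      \<beta> * (of_int (snd v1) * x + of_int (h * snd u) * y)) / of_real l" for x y
    by (simp add: \<alpha>'_def \<beta>'_def \<xi>_def V_def add_divide_distrib algebra_simps)
  have lin\<eta>: "\<gamma>' * x + \<delta>' * y = (\<gamma> * (of_int (fst v1) * x + of_int (h * fst u) * y) +
      \<delta> * (of_int (snd v1) * x + of_int (h * snd u) * y)) / of_real l" for x y
    by (simp add: \<gamma>'_def \<delta>'_def \<eta>_def V_def add_divide_distrib algebra_simps)
  have "det2 v1 V = h * (fst v1 * snd u - fst u * snd v1)"
    by (simp add: det2_def V_def algebra_simps)
  then have det_V: "det2 v1 V = h" by (simp only: u)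
  have j': "\<alpha>' * \<delta>' - \<beta>' * \<gamma>' = j * of_int h / of_real l ^ 2"
  proof -
    have "\<alpha>' * \<delta>' - \<beta>' * \<gamma>' = (\<xi> v1 * \<eta> V - \<xi> V * \<eta> v1) / of_real l ^ 2"
      by (simp add: \<alpha>'_def \<beta>'_def \<gamma>'_def \<delta>'_def power2_eq_square diff_divide_distrib)
    also have "\<xi> v1 * \<eta> V - \<xi> V * \<eta> v1 = j * of_int (det2 v1 V)"
      unfolding polarization(1) det2_def ..
    finally show ?thesis by (simp only: det_V)
  qed
  interpret G: diagonal_form r g \<alpha>' \<beta>' \<gamma>' \<delta>' \<kappa>' A' B' C'
  proof
    show "5 \<le> r" by (rule r)
    show "diagonalization r g \<alpha>' \<beta>' \<gamma>' \<delta>'"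
      unfolding diagonalization_def
    proof (intro conjI allI)
      show "\<alpha>' * \<delta>' - \<beta>' * \<gamma>' \<noteq> 0" unfolding j' using j_nonzero h l by simp
      fix x y
      have "of_int h * form_eval r g x y = of_int h * ((\<alpha>' * x + \<beta>' * y) ^ r - (\<gamma>' * x + \<delta>' * y) ^ r)"
        unfolding g form_eval_eq lin\<xi> lin\<eta> power_divide lc using h by (simp add: right_diff_distrib)
      then show "form_eval r g x y = (\<alpha>' * x + \<beta>' * y) ^ r - (\<gamma>' * x + \<delta>' * y) ^ r"
        using h by simp
    qed
    fix x y
    have "(\<alpha>' * x + \<beta>' * y) * (\<gamma>' * x + \<delta>' * y) = \<kappa> * (of_int A * (of_int (fst v1) * x + of_int (h * fst u) * y)\<^sup>2 +
        of_int B * (of_int (fst v1) * x + of_int (h * fst u) * y) * (of_int (snd v1) * x + of_int (h * snd u) * y) +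
        of_int C * (of_int (snd v1) * x + of_int (h * snd u) * y)\<^sup>2) / of_real l ^ 2"
      unfolding lin\<xi> lin\<eta> times_divide_times_eq quad by (simp only: power2_eq_square)
    also have "of_int A * (of_int (fst v1) * x + of_int (h * fst u) * y)\<^sup>2 +
        of_int B * (of_int (fst v1) * x + of_int (h * fst u) * y) * (of_int (snd v1) * x + of_int (h * snd u) * y) +
        of_int C * (of_int (snd v1) * x + of_int (h * snd u) * y)\<^sup>2 =
        of_int A' * x\<^sup>2 + of_int B' * x * y + of_int C' * y\<^sup>2"
      by (simp add: A'_def B'_def C'_def V_def power2_eq_square algebra_simps)
    also have "\<kappa> * (of_int A' * x\<^sup>2 + of_int B' * x * y + of_int C' * y\<^sup>2) / of_real l ^ 2 =
        \<kappa>' * (of_int A' * x\<^sup>2 + of_int B' * x * y + of_int C' * y\<^sup>2)"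
      by (simp add: \<kappa>'_def)
    finally show "(\<alpha>' * x + \<beta>' * y) * (\<gamma>' * x + \<delta>' * y) = \<kappa>' * (of_int A' * x\<^sup>2 + of_int B' * x * y + of_int C' * y\<^sup>2)" .
  qed
  \<comment> \<open>Coordinates with respect to the basis \<open>v1\<close>, \<open>h * u\<close> by
    Cramer's rule; the division is exact because \<open>h\<close> divides \<open>det2 v1 w\<close>
    within the class.\<close>
  define f where "f w = (fst w * snd u - fst u * snd w, det2 v1 w div h)" for w
  have f: "fst v1 * fst (f w) + h * fst u * snd (f w) = fst w" "snd v1 * fst (f w) + h * snd u * snd (f w) = snd w"
    if w: "w \<in> S" for w
  proof -
    have d: "h * snd (f w) = det2 v1 w" using cls[OF v(1) w] by (simp add: f_def)
    have "fst v1 * fst (f w) + fst u * (h * snd (f w)) = fst w * (fst v1 * snd u - fst u * snd v1)"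
      unfolding d by (simp add: f_def det2_def algebra_simps)
    then show "fst v1 * fst (f w) + h * fst u * snd (f w) = fst w" using u by (simp add: mult_ac)
    have "snd v1 * fst (f w) + snd u * (h * snd (f w)) = snd w * (fst v1 * snd u - fst u * snd v1)"
      unfolding d by (simp add: f_def det2_def algebra_simps)
    then show "snd v1 * fst (f w) + h * snd u * snd (f w) = snd w" using u by (simp add: mult_ac)
  qed
  have fc: "of_int (fst v1) * complex_of_int (fst (f w)) + of_int (h * fst u) * of_int (snd (f w)) = of_int (fst w)"
    "of_int (snd v1) * complex_of_int (fst (f w)) + of_int (h * snd u) * of_int (snd (f w)) = of_int (snd w)"
    if w: "w \<in> S" for w
    using f[OF w] by (metis of_int_add of_int_mult)+
  have \<xi>G: "G.\<xi> (f w) = \<xi> w / of_real l" and \<eta>G: "G.\<eta> (f w) = \<eta> w / of_real l" if w: "w \<in> S" for w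
    unfolding G.\<xi>_def G.\<eta>_def lin\<xi> lin\<eta> fc[OF w] by (simp_all add: \<xi>_def \<eta>_def)
  have hG: "G.height (f w) = height w / l" if w: "w \<in> S" for w
    unfolding G.height_def height_def \<xi>G[OF w] \<eta>G[OF w]
    using l by (simp add: norm_divide max_divide_distrib_right)
  have relG: "G.related (f w)" if w: "w \<in> S" for w
  proof -
    have "(height w / l) ^ r \<le> 1 \<Longrightarrow> height w / l \<le> 1"
      using one_less_power[of "height w / l" r] r by (meson less_le_trans not_le zero_less_numeral)
    moreover have "norm (\<eta> w / of_real l - \<xi> w / of_real l) * (height w / l) ^ (r - 1) =
        norm (\<eta> w - \<xi> w) * height w ^ (r - 1) / of_int h"
    proof -
      have "norm (\<eta> w / of_real l - \<xi> w / of_real l) = norm (\<eta> w - \<xi> w) / l"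
        using l by (simp flip: diff_divide_distrib add: norm_divide)
      moreover have "l * l ^ (r - 1) = of_int h" using r l(2) by (simp flip: power_Suc)
      ultimately show ?thesis by (simp add: power_divide)
    qed
    moreover have "(height w / l) ^ r = height w ^ r / of_int h" by (simp add: power_divide l(2))
    ultimately show ?thesis
      using sol[OF w] h unfolding G.related_def near_def \<xi>G[OF w] \<eta>G[OF w] hG[OF w] by auto
  qed
  have detG: "fst (f w) * snd (f w') - fst (f w') * snd (f w) \<noteq> 0" if w: "w \<in> S" "w' \<in> S" "det2 w w' \<noteq> 0" for w w'
  proof
    assume "fst (f w) * snd (f w') - fst (f w') * snd (f w) = 0"
    moreover have "det2 w w' = h * (fst (f w) * snd (f w') - fst (f w') * snd (f w)) * (fst v1 * snd u - fst u * snd v1)"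
      unfolding det2_def f[OF w(1), symmetric] f[OF w(2), symmetric] by (simp add: algebra_simps)
    ultimately show False using w(3) by simp
  qed
  have jG: "norm j \<le> norm G.j"
  proof -
    have "l ^ 2 \<le> l ^ r" using l1 r by (intro power_increasing) auto
    then have "1 \<le> of_int h / l ^ 2" using l by (simp add: field_simps)
    then have "norm j * 1 \<le> norm j * (of_int h / l ^ 2)" by (intro mult_left_mono) auto
    also have "\<dots> = norm G.j" unfolding G.j_def j' using l h by (simp add: norm_mult norm_divide norm_power)
    finally show ?thesis by simp
  qed
  have "\<bar>form_eval r g (fst (f v3)) (snd (f v3))\<bar> = 1"
  proof -
    have "of_int h * complex_of_int (form_eval r g (fst (f v3)) (snd (f v3))) = of_int (form_eval r F (fst v3) (snd v3))"
      unfolding of_int_form_eval g fc[OF v(3)] ..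
    then have "h * form_eval r g (fst (f v3)) (snd (f v3)) = form_eval r F (fst v3) (snd v3)"
      by (metis of_int_eq_iff of_int_mult)
    then have "h * \<bar>form_eval r g (fst (f v3)) (snd (f v3))\<bar> = h"
      using sol[OF v(3)] h by (metis abs_mult abs_of_pos)
    then show ?thesis using h by simp
  qed
  moreover have "real r ^ 7 \<le> (norm G.j / 2) ^ (r - 4)"
    using J jG by (elim order_trans) (intro power_mono, auto)
  ultimately show False
    using G.no_four_related[of "f v3" "f v1" "f v2" "f v4"] detG v det le relG l
    by (simp add: hG divide_right_mono)
qed

text \<open>Independent vectors of one class have determinant at least \<open>h\<close>, so
  \<open>\<bar>j\<bar> * h\<close> would be at most twice the product of the heights, which is
  itself at most \<open>h\<close>. This contradicts \<open>\<bar>j\<bar> > 2\<close>.\<close>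

lemma no_two_small:
  assumes J: "real r ^ 7 \<le> (norm j / 2) ^ (r - 4)" and h: "h > 0"
    and small: "height v ^ r \<le> of_int h" "height w ^ r \<le> of_int h"
    and cls: "h dvd det2 v w"
  shows "det2 v w = 0"
proof (rule ccontr)
  assume det: "det2 v w \<noteq> 0"
  have hv: "height v * height w \<le> of_int h"
  proof -
    define l where "l = root r (of_int h)"
    have l: "l ^ r = of_int h" "l \<ge> 1" using h r by (auto simp: l_def)
    have "height u \<le> l" if "height u ^ r \<le> of_int h" for u
      using that l r by (metis height_nonneg l_def not_le order_trans power_less_imp_less_base power_strict_mono zero_le_one zero_less_numeral less_le_trans)
    then have "height v * height w \<le> l * l" using small l by (intro mult_mono) (auto simp: height_nonneg)
    also have "\<dots> \<le> l ^ r" using l r power_increasing[of 2 r l] by (simp add: power2_eq_square)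
    finally show ?thesis using l by simp
  qed
  have "h \<le> \<bar>det2 v w\<bar>" using cls det h by (simp add: zdvd_imp_le)
  then have "norm j * of_int h \<le> norm j * norm (complex_of_int (det2 v w))"
    by (intro mult_left_mono) (auto simp flip: of_int_abs)
  also have "\<dots> = norm (\<xi> v * \<eta> w - \<xi> w * \<eta> v)"
    unfolding polarization(1) norm_mult det2_def ..
  also have "\<dots> \<le> norm (\<xi> v) * norm (\<eta> w) + norm (\<xi> w) * norm (\<eta> v)"
    by (metis norm_mult norm_triangle_ineq4)
  also have "\<dots> \<le> height v * height w + height w * height v"
    by (intro add_mono mult_mono) (simp_all add: height_def le_max_iff_disj)
  also have "\<dots> \<le> 2 * of_int h" using hv by simp
  finally have "norm j / 2 \<le> 1" using h by simp
  then show False using half_norm_j_gt_1[OF J] by simp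
qed

end

section \<open>Discriminant and real structure\<close>

lemma sin_le_sin_mult:
  assumes "r \<ge> 1" "real r * \<bar>\<theta>\<bar> \<le> pi"
  shows "\<bar>sin (\<theta> / 2)\<bar> \<le> \<bar>sin (real r * \<theta> / 2)\<bar>"
proof -
  have abs: "\<bar>sin x\<bar> = \<bar>sin \<bar>x\<bar>\<bar>" for x :: real by (cases "x \<ge> 0") auto
  have le: "1 * \<bar>\<theta>\<bar> \<le> real r * \<bar>\<theta>\<bar>" using assms by (intro mult_right_mono) auto
  have "sin (\<bar>\<theta>\<bar> / 2) \<le> sin (real r * \<bar>\<theta>\<bar> / 2)"
    using assms le by (intro sin_monotone_2pi_le) auto
  moreover have "0 \<le> sin (\<bar>\<theta>\<bar> / 2)" using assms le by (intro sin_ge_zero) auto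
  ultimately show ?thesis
    using abs[of "\<theta> / 2"] abs[of "real r * \<theta> / 2"] by (simp add: abs_mult)
qed

text \<open>
  Here \<open>y / x\<close> is \<open>cis \<theta>\<close> times some \<open>r\<close>-th root of unity with \<open>\<bar>\<theta>\<bar> \<le> pi / r\<close>, and the estimate is
  the monotonicity of the sine.
\<close>

lemma nearest_root_of_unity:
  fixes x y :: complex
  assumes r: "r \<ge> 1" and eq: "norm x = norm y"
  shows "\<exists>k<r. norm (y - cis (2 * pi * real k / real r) * x) * norm x ^ (r - 1) \<le> norm (x ^ r - y ^ r)"
proof (cases "x = 0")
  case True
  with eq r show ?thesis by (intro exI[of _ 0]) auto
next
  case False
  define \<phi> where "\<phi> = Arg (y / x)"
  have "y \<noteq> 0" using eq False by (metis norm_eq_zero)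
  then have "norm (y / x) = 1" by (simp add: norm_divide eq)
  then have "y / x = cis \<phi>" using cis_Arg[of "y / x"] by (force simp: \<phi>_def sgn_eq)
  then have y: "y = cis \<phi> * x" using False by (simp add: field_simps)
  define K where "K = round (\<phi> * real r / (2 * pi))"
  define k where "k = nat (K mod int r)"
  define \<theta> where "\<theta> = \<phi> - 2 * pi * of_int K / real r"
  have "\<bar>of_int K - \<phi> * real r / (2 * pi)\<bar> \<le> 1 / 2" unfolding K_def by (rule of_int_round_abs_le)
  then have "\<bar>2 * pi * (\<phi> * real r / (2 * pi) - of_int K)\<bar> \<le> 2 * pi * (1 / 2)"
    unfolding abs_mult using pi_gt_zero by (intro mult_mono) (auto simp: abs_minus_commute)
  moreover have "2 * pi * (\<phi> * real r / (2 * pi) - of_int K) = real r * \<theta>"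
    using r by (simp add: \<theta>_def field_simps)
  ultimately have \<theta>: "real r * \<bar>\<theta>\<bar> \<le> pi" by (simp add: abs_mult)
  have "K = int k + int r * (K div int r)" using r by (simp add: k_def)
  then have "real_of_int K = real k + real r * of_int (K div int r)"
    by (metis of_int_add of_int_mult of_int_of_nat_eq)
  then have "2 * pi * of_int K / real r = 2 * pi * real k / real r + 2 * pi * of_int (K div int r)"
    using r by (simp add: field_simps)
  then have "\<phi> = 2 * pi * real k / real r + 2 * pi * of_int (K div int r) + \<theta>" by (simp add: \<theta>_def)
  then have cis: "cis \<phi> = cis (2 * pi * real k / real r) * cis \<theta>"
    by (simp add: cis_multiple_2pi flip: cis_mult)
  define \<omega> where "\<omega> = cis (2 * pi * real k / real r)"
  have "\<omega> ^ r = cis (real r * (2 * pi * real k / real r))" unfolding \<omega>_def by (rule Complex.DeMoivre)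
  then have \<omega>r: "\<omega> ^ r = 1" using r by (simp add: cis_multiple_2pi)
  have "norm (y - \<omega> * x) = norm (cis \<theta> - 1) * norm x"
  proof -
    have "y - \<omega> * x = \<omega> * ((cis \<theta> - 1) * x)" unfolding y cis by (simp add: \<omega>_def algebra_simps)
    then show ?thesis by (simp add: norm_mult \<omega>_def)
  qed
  also have "norm (cis \<theta> - 1) = 2 * \<bar>sin (\<theta> / 2)\<bar>" using dist_exp_i_1[of \<theta>] by (simp add: cis_conv_exp)
  finally have 1: "norm (y - \<omega> * x) = 2 * \<bar>sin (\<theta> / 2)\<bar> * norm x" .
  have "norm (x ^ r - y ^ r) = norm (cis (real r * \<theta>) - 1) * norm x ^ r"
  proof -
    have "y ^ r = cis (real r * \<theta>) * x ^ r"
      unfolding y cis \<omega>_def[symmetric] by (simp add: power_mult_distrib \<omega>r Complex.DeMoivre)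
    then have "x ^ r - y ^ r = (1 - cis (real r * \<theta>)) * x ^ r" by (simp add: algebra_simps)
    then show ?thesis by (simp add: norm_mult norm_power norm_minus_commute)
  qed
  also have "norm (cis (real r * \<theta>) - 1) = 2 * \<bar>sin (real r * \<theta> / 2)\<bar>"
    using dist_exp_i_1[of "real r * \<theta>"] by (simp add: cis_conv_exp)
  finally have 2: "norm (x ^ r - y ^ r) = 2 * \<bar>sin (real r * \<theta> / 2)\<bar> * norm x ^ r" .
  have pow: "norm x * norm x ^ (r - 1) = norm x ^ r" using r by (simp flip: power_Suc)
  have "norm (y - \<omega> * x) * norm x ^ (r - 1) = 2 * \<bar>sin (\<theta> / 2)\<bar> * norm x ^ r"
    unfolding 1 by (simp only: mult.assoc pow)
  also have "\<dots> \<le> norm (x ^ r - y ^ r)"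
    unfolding 2 using sin_le_sin_mult[OF r \<theta>] by (intro mult_right_mono) auto
  finally have "norm (y - \<omega> * x) * norm x ^ (r - 1) \<le> norm (x ^ r - y ^ r)" .
  moreover have "k < r" using r by (simp add: k_def nat_less_iff)
  ultimately show ?thesis unfolding \<omega>_def by blast
qed

text \<open>For real values of equal sign the relevant root of unity is \<open>1\<close>, and the
  estimate follows from \<open>y * y ^ (r - 1) \<le> y * x ^ (r - 1)\<close> for
  \<open>0 \<le> y \<le> x\<close>.\<close>

lemma diff_mult_power_le:
  fixes x y :: real
  assumes r: "r \<ge> 1" and xy: "x * y \<ge> 0"
  shows "\<bar>x - y\<bar> * (max \<bar>x\<bar> \<bar>y\<bar>) ^ (r - 1) \<le> \<bar>x ^ r - y ^ r\<bar>"
proof -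
  have nonneg: "(x - y) * x ^ (r - 1) \<le> x ^ r - y ^ r" if "0 \<le> y" "y \<le> x" for x y :: real
  proof -
    obtain n where n: "r = Suc n" using r by (cases r) auto
    have "y * y ^ n \<le> y * x ^ n" using that by (intro mult_left_mono power_mono) auto
    then show ?thesis by (simp add: n algebra_simps)
  qed
  have nonneg': "\<bar>x - y\<bar> * (max x y) ^ (r - 1) \<le> \<bar>x ^ r - y ^ r\<bar>" if "0 \<le> y" "0 \<le> x" for x y :: real
    using nonneg[of y x] nonneg[of x y] that by (cases "y \<le> x") (auto simp: max_def)
  consider "0 \<le> x" "0 \<le> y" | "x \<le> 0" "y \<le> 0" using xy by (auto simp: zero_le_mult_iff)
  then show ?thesis
  proof cases
    case 1
    then show ?thesis using nonneg'[of y x] by simp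
  next
    case 2
    have "\<bar>(- x) ^ r - (- y) ^ r\<bar> = \<bar>x ^ r - y ^ r\<bar>"
      by (cases "even r") (auto simp: abs_minus_commute)
    then show ?thesis using nonneg'[of "- y" "- x"] 2 by (simp add: abs_minus_commute)
  qed
qed

text \<open>\<open>P k\<close> collects the determinants of the \<open>k\<close>-th factor with all
  others, so the product of all \<open>P k\<close> has norm \<open>\<bar>\<Delta>\<bar>\<close>.
  Each norm is found by differentiating the form at its \<open>k\<close>-th zero in two ways, and
  the remaining product of the \<open>X k\<close> is a value of the form.\<close>

lemma norm_discriminant:
  fixes \<alpha> \<beta> \<gamma> \<delta> :: complex
  assumes r: "r \<ge> 2"
    and F: "\<And>x y. form_eval r F x y = (\<alpha> * x + \<beta> * y) ^ r - (\<gamma> * x + \<delta> * y) ^ r"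
    and det: "\<alpha> * \<delta> - \<beta> * \<gamma> \<noteq> 0"
    and disc: "is_discriminant r F \<Delta>"
  shows "real_of_int \<bar>\<Delta>\<bar> = real r ^ r * norm (\<alpha> * \<delta> - \<beta> * \<gamma>) ^ (r * (r - 1))"
proof -
  define d where "d = \<alpha> * \<delta> - \<beta> * \<gamma>"
  obtain a b :: "nat \<Rightarrow> complex" where factors: "\<And>x y. form_eval r F x y = (\<Prod>i<r. a i * x + b i * y)"
    and \<Delta>: "of_int \<Delta> = (\<Prod>j<r. \<Prod>i<j. (a i * b j - a j * b i)\<^sup>2)"
    using disc unfolding is_discriminant_def by blast
  define e where "e i k = a i * b k - a k * b i" for i k
  define P where "P k = (\<Prod>i\<in>{..<r} - {k}. e i k)" for k
  define X where "X k = \<alpha> * b k - \<beta> * a k" for k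
  define Y where "Y k = \<gamma> * b k - \<delta> * a k" for k
  have XY: "X k ^ r = Y k ^ r" if "k < r" for k
  proof -
    have "(\<Prod>i<r. a i * b k + b i * (- a k)) = 0" using that by (intro prod_zero) (auto intro!: bexI[of _ k])
    then have "form_eval r F (b k) (- a k) = 0" using factors by simp
    then show ?thesis using F[of "b k" "- a k"] by (simp add: X_def Y_def)
  qed
  \<comment> \<open>At \<open>(- \<beta>, \<alpha>)\<close> the first linear form of the
    diagonalization vanishes and the second equals \<open>d\<close>.\<close>
  have X_nz: "(\<Prod>k<r. X k) = - (d ^ r)"
  proof -
    have "(\<Prod>k<r. X k) = form_eval r F (- \<beta>) \<alpha>"
      unfolding factors by (intro prod.cong) (auto simp: X_def algebra_simps)
    also have "\<dots> = - (d ^ r)" unfolding F using r by (simp add: d_def algebra_simps power_0_left)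
    finally show ?thesis .
  qed
  have X0: "X k \<noteq> 0" if "k < r" for k
  proof
    assume "X k = 0"
    then have "(\<Prod>k<r. X k) = 0" using that by (intro prod_zero) auto
    with X_nz det show False by (simp add: d_def)
  qed
  have norm_XY: "norm (X k) = norm (Y k)" if "k < r" for k
  proof (rule power_eq_imp_eq_base)
    show "norm (X k) ^ r = norm (Y k) ^ r" using XY[OF that] by (metis norm_power)
  qed (use r in auto)
  have P: "norm (P k) = real r * norm d * norm (X k) ^ (r - 2)" if k: "k < r" for k
  proof -
    \<comment> \<open>The direction \<open>(- \<delta>, \<gamma>)\<close> leaves the second linear
      form constant and changes the first at rate \<open>- d\<close>; the \<open>k\<close>-th factor
      becomes \<open>t * Y k\<close>.\<close>
    have "((\<lambda>t. \<Prod>i<r. a i * (b k - t * \<delta>) + b i * (- a k + t * \<gamma>)) has_field_derivative Y k * P k) (at 0)"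
    proof -
      define G where "G t = (\<Prod>i\<in>{..<r} - {k}. a i * (b k - t * \<delta>) + b i * (- a k + t * \<gamma>))" for t
      have G: "continuous (at 0) G" unfolding G_def by (intro continuous_intros)
      have eq: "(\<Prod>i<r. a i * (b k - t * \<delta>) + b i * (- a k + t * \<gamma>)) = t * (Y k * G t)" for t
        unfolding G_def using k by (subst prod.remove[of _ k]) (auto simp: Y_def algebra_simps)
      have "((\<lambda>t. (t * (Y k * G t) - 0) / (t - 0)) \<longlongrightarrow> Y k * G 0) (at 0)"
      proof (rule Lim_transform_eventually)
        show "((\<lambda>t. Y k * G t) \<longlongrightarrow> Y k * G 0) (at 0)"
          using G by (intro tendsto_intros) (simp add: continuous_at)
        show "\<forall>\<^sub>F t in at 0. Y k * G t = (t * (Y k * G t) - 0) / (t - 0)"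
          by (simp add: eventually_at_filter)
      qed
      moreover have "G 0 = P k" by (auto simp: G_def P_def e_def intro!: prod.cong)
      ultimately show ?thesis unfolding eq by (simp add: has_field_derivative_iff)
    qed
    moreover have "(\<Prod>i<r. a i * (b k - t * \<delta>) + b i * (- a k + t * \<gamma>)) = (X k - t * d) ^ r - Y k ^ r" for t
      using factors[of "b k - t * \<delta>" "- a k + t * \<gamma>"] F[of "b k - t * \<delta>" "- a k + t * \<gamma>"]
      by (simp add: X_def Y_def d_def algebra_simps)
    moreover have "((\<lambda>t. (X k - t * d) ^ r - Y k ^ r) has_field_derivative (- (of_nat r * X k ^ (r - 1) * d))) (at 0)"
      by (rule derivative_eq_intros refl | simp)+
    ultimately have eq: "Y k * P k = - (of_nat r * X k ^ (r - 1) * d)"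
      by (simp add: DERIV_unique)
    have "norm (Y k) * norm (P k) = real r * norm (X k) ^ (r - 1) * norm d"
      using arg_cong[OF eq, of norm] by (simp add: norm_mult norm_power)
    moreover have "norm (X k) ^ (r - 1) = norm (X k) * norm (X k) ^ (r - 2)"
    proof -
      have "r - 1 = Suc (r - 2)" using r by simp
      then show ?thesis by (simp only: power_Suc)
    qed
    moreover have "norm (Y k) \<noteq> 0" using norm_XY[OF k] X0[OF k] by (metis norm_eq_zero)
    ultimately show ?thesis using norm_XY[OF k] by (simp add: mult_ac)
  qed
  have "norm (\<Prod>k<r. P k) = (\<Prod>k<r. real r * norm d * norm (X k) ^ (r - 2))"
    by (simp add: P flip: prod_norm)
  also have "\<dots> = (real r * norm d) ^ r * norm (\<Prod>k<r. X k) ^ (r - 2)"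
    by (simp add: prod.distrib power_mult_distrib prod_norm flip: prod_power_distrib)
  also have "\<dots> = real r ^ r * norm d ^ (r * (r - 1))"
  proof -
    have "r * (r - 1) = r + r * (r - 2)" using r by (cases r) (auto simp: algebra_simps le_Suc_ex)
    then show ?thesis unfolding X_nz by (simp add: norm_power power_mult_distrib power_add power_mult)
  qed
  also have "norm (\<Prod>k<r. P k) = norm (of_int \<Delta> :: complex)"
  proof -
    have "(\<Prod>k<r. P k) = (\<Prod>k<r. (\<Prod>i<k. e i k) * (\<Prod>i\<in>{k<..<r}. e i k))"
      unfolding P_def
    proof (intro prod.cong refl)
      fix k assume "k \<in> {..<r}"
      then have "{..<r} - {k} = {..<k} \<union> {k<..<r}" by auto
      then show "(\<Prod>i\<in>{..<r} - {k}. e i k) = (\<Prod>i<k. e i k) * (\<Prod>i\<in>{k<..<r}. e i k)"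
        by (simp add: prod.union_disjoint Int_def)
    qed
    also have "\<dots> = (\<Prod>k<r. \<Prod>i<k. e i k) * (\<Prod>k<r. \<Prod>i\<in>{k<..<r}. e i k)" by (rule prod.distrib)
    also have "(\<Prod>k<r. \<Prod>i\<in>{k<..<r}. e i k) = (\<Prod>i<r. \<Prod>k<i. e i k)"
    proof -
      have "(\<Prod>k<r. \<Prod>i\<in>{k<..<r}. e i k) = (\<Prod>k<r. \<Prod>i\<in>{i. i \<in> {..<r} \<and> k < i}. e i k)"
        by (intro prod.cong) auto
      also have "\<dots> = (\<Prod>i<r. \<Prod>k\<in>{k. k \<in> {..<r} \<and> k < i}. e i k)"
        by (rule prod.swap_restrict) auto
      also have "\<dots> = (\<Prod>i<r. \<Prod>k<i. e i k)"
        by (intro prod.cong) auto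
      finally show ?thesis .
    qed
    finally have "norm (\<Prod>k<r. P k) = (\<Prod>k<r. \<Prod>i<k. norm (e i k)) * (\<Prod>i<r. \<Prod>k<i. norm (e i k))"
      by (simp add: norm_mult flip: prod_norm)
    also have "(\<Prod>i<r. \<Prod>k<i. norm (e i k)) = (\<Prod>k<r. \<Prod>i<k. norm (e i k))"
      by (intro prod.cong refl) (simp add: e_def norm_minus_commute)
    also have "(\<Prod>k<r. \<Prod>i<k. norm (e i k)) * (\<Prod>k<r. \<Prod>i<k. norm (e i k)) = norm (of_int \<Delta> :: complex)"
      unfolding \<Delta> by (simp add: prod_norm[symmetric] norm_power e_def power2_eq_square prod.distrib norm_mult)
    finally show ?thesis .
  qed
  finally show ?thesis by (simp add: d_def)
qed

text \<open>Cancelling \<open>r ^ r\<close> and taking the root of order \<open>r * (r - 1)\<close>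
  bounds \<open>J\<close> from below; raising to the power \<open>r - 4\<close> removes the real
  exponent \<open>7 / (r - 4)\<close>.\<close>

lemma norm_det_ge:
  assumes r: "r \<ge> 5" and J: "J \<ge> 0"
    and \<Delta>: "real_of_int \<bar>\<Delta>\<bar> = real r ^ r * J ^ (r * (r - 1))"
    and ge: "real_of_int \<bar>\<Delta>\<bar> \<ge>
           2 ^ (r\<^sup>2 - r) * real r powr (real r + 7 * real r * (real r - 1) / (real r - 4))"
  shows "real r ^ 7 \<le> (J / 2) ^ (r - 4)"
proof -
  define m where "m = r * (r - 1)"
  define t where "t = real r powr (7 / (real r - 4))"
  have m0: "m > 0" using r by (simp add: m_def)
  have exps: "r\<^sup>2 - r = m" by (simp add: m_def power2_eq_square diff_mult_distrib2)
  have powr: "real r powr (real r + 7 * real r * (real r - 1) / (real r - 4)) = real r ^ r * t ^ m"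
  proof -
    have "7 * real r * (real r - 1) / (real r - 4) = 7 / (real r - 4) * real m"
      using r by (simp add: m_def of_nat_diff)
    then have "real r powr (7 * real r * (real r - 1) / (real r - 4)) = t powr real m"
      by (simp only: t_def powr_powr)
    also have "\<dots> = t ^ m" using r by (intro powr_realpow) (simp add: t_def)
    finally have "real r powr (7 * real r * (real r - 1) / (real r - 4)) = t ^ m" .
    then show ?thesis using r by (simp add: powr_add powr_realpow)
  qed
  have "2 ^ m * (real r ^ r * t ^ m) \<le> real r ^ r * J ^ m"
    using ge unfolding exps powr \<Delta> m_def[symmetric] .
  then have "real r ^ r * (2 * t) ^ m \<le> real r ^ r * J ^ m"
    by (simp only: power_mult_distrib mult.left_commute)
  then have "(2 * t) ^ m \<le> J ^ m" using r by simp
  then have "2 * t \<le> J" using J m0 by (metis not_le power_strict_mono t_def zero_le_numeral mult_nonneg_nonneg powr_ge_zero linorder_not_less)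
  then have "t ^ (r - 4) \<le> (J / 2) ^ (r - 4)" by (intro power_mono) (auto simp: t_def)
  also have "t ^ (r - 4) = real r ^ 7"
  proof -
    have "t ^ (r - 4) = t powr real (r - 4)" using r by (subst powr_realpow) (auto simp: t_def)
    also have "\<dots> = real r powr 7"
    proof -
      have "real (r - 4) = real r - 4" "real r - 4 \<noteq> 0" using r by (auto simp: of_nat_diff)
      then have "7 / (real r - 4) * real (r - 4) = 7" by (metis nonzero_eq_divide_eq)
      then show ?thesis by (simp only: t_def powr_powr)
    qed
    also have "\<dots> = real r ^ 7" using r powr_realpow[of "real r" 7] by simp
    finally show ?thesis .
  qed
  finally show ?thesis .
qed

section \<open>Effect of the sign of the quadratic discriminant on the linear forms\<close>

context diagonal_form
begin

text \<open>Here \<open>s\<close> is purely imaginary, so integrality of the Jacobian makes the sum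
  \<open>T\<close> of the \<open>r\<close>-th powers purely imaginary, while their difference
  \<open>g\<close> is an integer. Hence \<open>T + g\<close> and \<open>T - g\<close> have equal
  norm.\<close>

lemma norm_eq_if_negative:
  assumes D: "B\<^sup>2 - 4 * A * C < 0"
  shows "norm (\<xi> v) = norm (\<eta> v)"
proof -
  obtain x y where v: "v = (x, y)" by (cases v)
  obtain M :: int where M: "of_int M = of_nat r * s * (\<xi> v ^ r + \<eta> v ^ r)" using jacobian_int by blast
  define g where "g = form_eval r F x y"
  have g: "of_int g = \<xi> v ^ r - \<eta> v ^ r" by (simp add: g_def form_eval_int v)
  define T where "T = \<xi> v ^ r + \<eta> v ^ r"
  define k where "k = B\<^sup>2 - 4 * A * C"
  have "Re s * Re s - Im s * Im s = of_int k"
    using arg_cong[OF s_square, of Re] unfolding k_def[symmetric] by (simp add: power2_eq_square)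
  moreover have "Re s = 0 \<or> Im s = 0"
    using arg_cong[OF s_square, of Im] unfolding k_def[symmetric] by (auto simp: power2_eq_square)
  moreover have "real_of_int k < 0" using D by (simp add: k_def[symmetric])
  ultimately have "Re s = 0"
    by (metis diff_zero mult_zero_left not_less zero_le_square)
  then have cnj_s: "cnj s = - s" by (simp add: complex_eq_iff)
  have "cnj T = - T"
  proof -
    have "of_nat r * s * T = of_nat r * (- s) * cnj T"
    proof -
      have M': "of_int M = of_nat r * s * T" using M by (simp only: T_def)
      have "of_int M = of_nat r * cnj s * cnj T" using arg_cong[OF M', of cnj] by simp
      then show ?thesis using M' by (simp only: cnj_s)
    qed
    then have "of_nat r * s * (T + cnj T) = 0" by (simp add: algebra_simps)
    then have "T + cnj T = 0" using r s_nonzero by simp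
    then show ?thesis by (simp add: eq_neg_iff_add_eq_0 add.commute)
  qed
  then have "cnj (T + of_int g) = - (T - of_int g)" by simp
  then have "norm (T + of_int g) = norm (T - of_int g)" by (metis complex_mod_cnj norm_minus_cancel)
  moreover have "T + of_int g = 2 * \<xi> v ^ r" "T - of_int g = 2 * \<eta> v ^ r" by (simp_all add: T_def g)
  ultimately have "norm (\<xi> v) ^ r = norm (\<eta> v) ^ r" by (simp add: norm_mult norm_power)
  then show ?thesis by (rule power_eq_imp_eq_base) (use r in auto)
qed

lemma powers_real_if_positive:
  assumes D: "B\<^sup>2 - 4 * A * C > 0"
  shows "\<xi> v ^ r \<in> \<real>" "\<eta> v ^ r \<in> \<real>"
proof -
  obtain x y where v: "v = (x, y)" by (cases v)
  obtain M :: int where M: "of_int M = of_nat r * s * (\<xi> v ^ r + \<eta> v ^ r)" using jacobian_int by blast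
  define g where "g = form_eval r F x y"
  have g: "of_int g = \<xi> v ^ r - \<eta> v ^ r" by (simp add: g_def form_eval_int v)
  define d where "d = sqrt (of_int (B\<^sup>2 - 4 * A * C))"
  have "d\<^sup>2 = of_int (B\<^sup>2 - 4 * A * C)" unfolding d_def using D by (intro real_sqrt_pow2) (simp only: of_int_0_le_iff)
  then have "s\<^sup>2 = (of_real d)\<^sup>2"
    unfolding s_square by (metis of_real_of_int_eq of_real_power)
  then have "s \<in> \<real>" by (auto simp: power2_eq_iff)
  moreover have "\<xi> v ^ r + \<eta> v ^ r = of_int M / (of_nat r * s)" using M r s_nonzero by simp
  ultimately have T: "\<xi> v ^ r + \<eta> v ^ r \<in> \<real>" by simp
  have "\<xi> v ^ r = ((\<xi> v ^ r + \<eta> v ^ r) + of_int g) / 2" "\<eta> v ^ r = ((\<xi> v ^ r + \<eta> v ^ r) - of_int g) / 2"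
    by (simp_all add: g)
  then show "\<xi> v ^ r \<in> \<real>" "\<eta> v ^ r \<in> \<real>"
    using T by (metis Reals_add Reals_diff Reals_divide Reals_of_int Reals_numeral)+
qed

end

section \<open>Counting solutions\<close>

text \<open>Any four elements can be sorted by \<open>f\<close>. Only neighbours are presented as
  distinct, since the gap argument compares consecutive heights.\<close>

lemma card_le_3I:
  fixes f :: "'a \<Rightarrow> real"
  assumes "\<And>a b c d. {a, b, c, d} \<subseteq> S \<Longrightarrow> a \<noteq> b \<Longrightarrow> b \<noteq> c \<Longrightarrow> c \<noteq> d \<Longrightarrow>
    f a \<le> f b \<Longrightarrow> f b \<le> f c \<Longrightarrow> f c \<le> f d \<Longrightarrow> False"
  shows "finite S \<and> card S \<le> 3"
proof (rule ccontr)
  assume *: "\<not> (finite S \<and> card S \<le> 3)"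
  have "\<exists>T\<subseteq>S. finite T \<and> card T = 4"
  proof (cases "finite S")
    case True
    with * have "4 \<le> card S" by simp
    then show ?thesis by (metis obtain_subset_with_card_n)
  next
    case False
    then show ?thesis using infinite_arbitrarily_large[of S 4] by blast
  qed
  then obtain T where T: "T \<subseteq> S" "finite T" "card T = 4" by blast
  obtain xs where xs: "set xs = T" "distinct xs" using finite_distinct_list[OF T(2)] by blast
  define ys where "ys = sort_key f xs"
  have ys: "set ys = T" "distinct ys" "sorted (map f ys)" "length ys = 4"
    using xs T(3) distinct_card[OF xs(2)] by (auto simp: ys_def)
  then obtain a b c d where "ys = [a, b, c, d]"
    by (auto simp: length_Suc_conv numeral_eq_Suc)
  with ys T(1) assms[of a b c d] show False by auto
qed

definition solutions :: "nat \<Rightarrow> (nat \<Rightarrow> int) \<Rightarrow> int \<Rightarrow> (int \<times> int) set" where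
  "solutions r F h = {v. coprime (fst v) (snd v) \<and> \<bar>form_eval r F (fst v) (snd v)\<bar> = h}"

lemma primitive_solutions_eq:
  "primitive_solutions r F h = (\<lambda>v. {v, (- fst v, - snd v)}) ` solutions r F h"
  unfolding primitive_solutions_def solutions_def
  by (intro image_cong) (auto simp: coprime_iff_gcd_eq_1)

text \<open>One representative is chosen from each pair of opposite solutions, and distinct
  representatives are independent. Labels are read after this choice, so they may differ on
  \<open>v\<close> and its opposite.\<close>

lemma card_primitive_solutions_le:
  assumes T: "finite T" "\<And>v. v \<in> solutions r F h \<Longrightarrow> lab v \<in> T"
    and fiber: "\<And>S t. S \<subseteq> solutions r F h \<Longrightarrow> (\<And>v. v \<in> S \<Longrightarrow> lab v = t) \<Longrightarrow>
      (\<And>v w. v \<in> S \<Longrightarrow> w \<in> S \<Longrightarrow> v \<noteq> w \<Longrightarrow> det2 v w \<noteq> 0) \<Longrightarrow> finite S \<and> card S \<le> N"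
  shows "finite (primitive_solutions r F h) \<and> card (primitive_solutions r F h) \<le> card T * N"
proof -
  define q where "q v = {v, (- fst v, - snd v)}" for v :: "int \<times> int"
  define rep where "rep P = (SOME v. v \<in> solutions r F h \<and> q v = P)" for P
  let ?PS = "primitive_solutions r F h"
  have PS: "?PS = q ` solutions r F h" by (simp add: primitive_solutions_eq q_def)
  have rep: "rep P \<in> solutions r F h \<and> q (rep P) = P" if "P \<in> ?PS" for P
  proof -
    obtain v where "v \<in> solutions r F h \<and> q v = P" using \<open>P \<in> ?PS\<close> unfolding PS by blast
    then show ?thesis unfolding rep_def by (rule someI)
  qed
  define R where "R = rep ` ?PS"
  define R' where "R' t = {v \<in> R. lab v = t}" for t
  have fib: "finite (R' t) \<and> card (R' t) \<le> N" for t
  proof (rule fiber)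
    show "R' t \<subseteq> solutions r F h" using rep by (auto simp: R'_def R_def)
    show "lab v = t" if "v \<in> R' t" for v using that by (simp add: R'_def)
    fix v w assume vw: "v \<in> R' t" "w \<in> R' t" "v \<noteq> w"
    show "det2 v w \<noteq> 0"
    proof
      assume "det2 v w = 0"
      moreover have "v \<in> solutions r F h" "w \<in> solutions r F h" using vw rep by (auto simp: R'_def R_def)
      ultimately have "w = v \<or> w = (- fst v, - snd v)"
        by (intro coprime_det2_eq_0) (auto simp: solutions_def)
      then have "q v = q w" by (auto simp: q_def)
      moreover obtain P P' where "P \<in> ?PS" "P' \<in> ?PS" "v = rep P" "w = rep P'"
        using vw by (auto simp: R'_def R_def)
      ultimately show False using rep vw(3) by metis
    qed
  qed
  have "R \<subseteq> solutions r F h" using rep unfolding R_def by blast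
  then have R: "R = (\<Union>t\<in>T. R' t)"
    using T(2) unfolding R'_def by blast
  have finR: "finite R" unfolding R using T(1) fib by auto
  have "card R \<le> (\<Sum>t\<in>T. card (R' t))" unfolding R using T(1) by (rule card_UN_le)
  also have "\<dots> \<le> (\<Sum>t\<in>T. N)" using fib by (intro sum_mono) auto
  finally have cardR: "card R \<le> card T * N" by simp
  have "?PS = q ` R" using rep by (force simp: R_def)
  then have "finite ?PS" "card ?PS \<le> card R" using finR card_image_le[OF finR, of q] by auto
  with cardR show ?thesis by simp
qed

lemma card_labels: "card (prime_factors h \<rightarrow>\<^sub>E {..<r}) = r ^ omega h"
  by (simp add: card_PiE omega_def)

section \<open>Bounds per class and per root of unity\<close>

locale labelled_form = diagonal_form +
  fixes h :: int and l :: "int \<times> int \<Rightarrow> int \<Rightarrow> nat"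
  assumes h_pos: "h > 0"
    and j_large: "real r ^ 7 \<le> (norm (\<alpha> * \<delta> - \<beta> * \<gamma>) / 2) ^ (r - 4)"
    and label: "v \<in> solutions r F h \<Longrightarrow> l v \<in> prime_factors h \<rightarrow>\<^sub>E {..<r}"
    and label_dvd: "v \<in> solutions r F h \<Longrightarrow> w \<in> solutions r F h \<Longrightarrow> l v = l w \<Longrightarrow> h dvd det2 v w"
begin

lemma card_near_le:
  assumes S: "S \<subseteq> solutions r F h" "\<And>v. v \<in> S \<Longrightarrow> l v = t" "\<And>v. v \<in> S \<Longrightarrow> near h v"
    and det: "\<And>v w. v \<in> S \<Longrightarrow> w \<in> S \<Longrightarrow> v \<noteq> w \<Longrightarrow> det2 v w \<noteq> 0"
  shows "finite S \<and> card S \<le> 3"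
proof (rule card_le_3I[of S height])
  fix a b c d
  assume *: "{a, b, c, d} \<subseteq> S" "a \<noteq> b" "b \<noteq> c" "c \<noteq> d"
    "height a \<le> height b" "height b \<le> height c" "height c \<le> height d"
  show False
  proof (rule no_four_near[of h S a b c d])
    show "real r ^ 7 \<le> (norm j / 2) ^ (r - 4)" using j_large by (simp only: j_def)
    show "h dvd det2 v w" if "v \<in> S" "w \<in> S" for v w
      using that S by (intro label_dvd) auto
    show "coprime (fst v) (snd v) \<and> \<bar>form_eval r F (fst v) (snd v)\<bar> = h \<and> near h v" if "v \<in> S" for v
      using that S by (auto simp: solutions_def)
  qed (use * det h_pos in auto)
qed

text \<open>Dividing \<eta> by \<omega> preserves the form because \<open>\<omega> ^ r = 1\<close>,
  preserves heights and \<open>\<bar>j\<bar>\<close>, and moves the approximated root of unity to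
  \<open>1\<close>.\<close>

lemma card_rotated_near_le:
  assumes S: "S \<subseteq> solutions r F h" "\<And>v. v \<in> S \<Longrightarrow> l v = t"
    and near: "\<And>v. v \<in> S \<Longrightarrow> height v ^ r \<le> of_int h \<or> norm (\<eta> v - \<omega> * \<xi> v) * height v ^ (r - 1) \<le> of_int h"
    and det: "\<And>v w. v \<in> S \<Longrightarrow> w \<in> S \<Longrightarrow> v \<noteq> w \<Longrightarrow> det2 v w \<noteq> 0"
    and \<omega>: "\<omega> ^ r = 1"
  shows "finite S \<and> card S \<le> 3"
proof -
  have n1: "norm \<omega> = 1" using power_eq_1_iff[OF \<omega>] r by auto
  then have \<omega>0: "\<omega> \<noteq> 0" by auto
  interpret rot: labelled_form r F \<alpha> \<beta> "\<gamma> / \<omega>" "\<delta> / \<omega>" "\<kappa> / \<omega>" A B C h l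
  proof
    have j: "\<alpha> * (\<delta> / \<omega>) - \<beta> * (\<gamma> / \<omega>) = j / \<omega>" by (simp add: j_def diff_divide_distrib)
    have lin: "\<gamma> / \<omega> * x + \<delta> / \<omega> * y = (\<gamma> * x + \<delta> * y) / \<omega>" for x y by (simp add: add_divide_distrib)
    show "diagonalization r F \<alpha> \<beta> (\<gamma> / \<omega>) (\<delta> / \<omega>)"
      unfolding diagonalization_def j lin power_divide \<omega> using j_nonzero \<omega>0 by (simp add: form_eval_eq)
    show "(\<alpha> * x + \<beta> * y) * (\<gamma> / \<omega> * x + \<delta> / \<omega> * y) =
        \<kappa> / \<omega> * (of_int A * x\<^sup>2 + of_int B * x * y + of_int C * y\<^sup>2)" for x y
      unfolding lin times_divide_eq_right quad by simp
    show "real r ^ 7 \<le> (norm (\<alpha> * (\<delta> / \<omega>) - \<beta> * (\<gamma> / \<omega>)) / 2) ^ (r - 4)"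
      using j_large unfolding j by (simp add: norm_divide n1 j_def)
  qed (use r h_pos label label_dvd in auto)
  have \<eta>: "rot.\<eta> v = \<eta> v / \<omega>" for v
    by (simp add: rot.\<eta>_def \<eta>_def add_divide_distrib)
  have height: "rot.height = height"
    by (simp add: fun_eq_iff rot.height_def height_def \<eta> norm_divide n1)
  have "norm (rot.\<eta> v - rot.\<xi> v) = norm (\<eta> v - \<omega> * \<xi> v)" for v
  proof -
    have "\<eta> v - \<omega> * \<xi> v = \<omega> * (rot.\<eta> v - rot.\<xi> v)" using \<omega>0 by (simp add: \<eta> algebra_simps)
    then show ?thesis by (simp add: norm_mult n1)
  qed
  then show ?thesis
    using rot.card_near_le[of S t] S det near unfolding rot.near_def height by simp
qed

lemma norm_form_eval:
  assumes "v \<in> solutions r F h"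
  shows "norm (\<xi> v ^ r - \<eta> v ^ r) = of_int h"
proof -
  have "\<xi> v ^ r - \<eta> v ^ r = of_int (form_eval r F (fst v) (snd v))"
    using form_eval_int[of "fst v" "snd v"] by simp
  then have "norm (\<xi> v ^ r - \<eta> v ^ r) = of_int \<bar>form_eval r F (fst v) (snd v)\<bar>"
    by (simp only: norm_of_int)
  with assms show ?thesis by (simp add: solutions_def)
qed

text \<open>A label consists of the class and the nearest root of unity, which gives
  \<open>r ^ omega h * r\<close> labels with at most three solutions each.\<close>

lemma card_primitive_solutions_negative:
  assumes D: "B\<^sup>2 - 4 * A * C < 0"
  shows "finite (primitive_solutions r F h) \<and> card (primitive_solutions r F h) \<le> 3 * r ^ (1 + omega h)"
proof -
  define \<omega> where "\<omega> k = cis (2 * pi * real k / real r)" for k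
  have \<omega>: "\<omega> k ^ r = 1" for k
  proof -
    have "\<omega> k ^ r = cis (real r * (2 * pi * real k / real r))" unfolding \<omega>_def by (rule Complex.DeMoivre)
    then show ?thesis using r by (simp add: cis_multiple_2pi)
  qed
  have "\<exists>k<r. norm (\<eta> v - \<omega> k * \<xi> v) * height v ^ (r - 1) \<le> of_int h" if v: "v \<in> solutions r F h" for v
  proof -
    have "height v = norm (\<xi> v)" using norm_eq_if_negative[OF D, of v] by (simp add: height_def)
    then show ?thesis
      using nearest_root_of_unity[of r "\<xi> v" "\<eta> v"] norm_eq_if_negative[OF D, of v] r norm_form_eval[OF v]
      by (simp add: \<omega>_def)
  qed
  then obtain k where k: "v \<in> solutions r F h \<Longrightarrow> k v < r \<and> norm (\<eta> v - \<omega> (k v) * \<xi> v) * height v ^ (r - 1) \<le> of_int h" for v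
    by metis
  let ?T = "(prime_factors h \<rightarrow>\<^sub>E {..<r}) \<times> {..<r}"
  have "finite (primitive_solutions r F h) \<and> card (primitive_solutions r F h) \<le> card ?T * 3"
  proof (rule card_primitive_solutions_le[where lab = "\<lambda>v. (l v, k v)"])
    show "finite ?T" by (auto intro!: finite_PiE)
    show "(l v, k v) \<in> ?T" if "v \<in> solutions r F h" for v using label[OF that] k[OF that] by auto
    fix S t
    assume S: "S \<subseteq> solutions r F h" and t: "\<And>v. v \<in> S \<Longrightarrow> (l v, k v) = t"
      and det: "\<And>v w. v \<in> S \<Longrightarrow> w \<in> S \<Longrightarrow> v \<noteq> w \<Longrightarrow> det2 v w \<noteq> 0"
    show "finite S \<and> card S \<le> 3"
    proof (rule card_rotated_near_le[OF S, of "fst t" "\<omega> (snd t)"])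
      show "l v = fst t" if "v \<in> S" for v using t[OF that] by auto
      show "height v ^ r \<le> of_int h \<or> norm (\<eta> v - \<omega> (snd t) * \<xi> v) * height v ^ (r - 1) \<le> of_int h" if "v \<in> S" for v
        using t[OF that] k[of v] S that by auto
    qed (use det \<omega> in auto)
  qed
  then show ?thesis by (simp add: card_cartesian_product card_labels mult_ac)
qed

lemma card_primitive_solutions_small:
  assumes small: "\<And>v. v \<in> solutions r F h \<Longrightarrow> height v ^ r \<le> of_int h"
  shows "finite (primitive_solutions r F h) \<and> card (primitive_solutions r F h) \<le> r ^ omega h"
proof -
  let ?T = "prime_factors h \<rightarrow>\<^sub>E {..<r}"
  have "finite (primitive_solutions r F h) \<and> card (primitive_solutions r F h) \<le> card ?T * 1"
  proof (rule card_primitive_solutions_le[where lab = l])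
    show "finite ?T" by (auto intro!: finite_PiE)
    show "l v \<in> ?T" if "v \<in> solutions r F h" for v by (rule label[OF that])
    fix S t
    assume S: "S \<subseteq> solutions r F h" and t: "\<And>v. v \<in> S \<Longrightarrow> l v = t"
      and det: "\<And>v w. v \<in> S \<Longrightarrow> w \<in> S \<Longrightarrow> v \<noteq> w \<Longrightarrow> det2 v w \<noteq> 0"
    have "v = w" if "v \<in> S" "w \<in> S" for v w
    proof (rule ccontr)
      assume "v \<noteq> w"
      moreover have "det2 v w = 0"
      proof (rule no_two_small)
        have "v \<in> solutions r F h" "w \<in> solutions r F h" using that S by auto
        then show "height v ^ r \<le> of_int h" "height w ^ r \<le> of_int h" "h dvd det2 v w"
          using small label_dvd t[OF that(1)] t[OF that(2)] by auto
      qed (use h_pos j_large in \<open>auto simp: j_def\<close>)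
      ultimately show False using det that by blast
    qed
    then have eq: "v = w" if "v \<in> S" "w \<in> S" for v w using that by blast
    show "finite S \<and> card S \<le> 1"
    proof (cases "S = {}")
      case False
      then obtain v where "v \<in> S" by blast
      with eq have "S = {v}" by blast
      then show ?thesis by simp
    qed auto
  qed
  then show ?thesis by (simp add: card_labels)
qed

text \<open>For \<open>X v * Y v \<ge> 0\<close> the root is \<open>1\<close>. For opposite signs
  and even \<open>r\<close> it is \<open>- 1\<close>, which doubles the number of labels; for odd
  \<open>r\<close> the powers add up, so the vector is small and fits into the same label.\<close>

lemma card_primitive_solutions_real:
  fixes a b c d :: real
  assumes real: "\<alpha> = of_real a" "\<beta> = of_real b" "\<gamma> = of_real c" "\<delta> = of_real d"
  shows "finite (primitive_solutions r F h) \<and>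
    card (primitive_solutions r F h) \<le> (if even r then 6 else 3) * r ^ omega h"
proof -
  define X where "X v = a * of_int (fst v) + b * of_int (snd v)" for v :: "int \<times> int"
  define Y where "Y v = c * of_int (fst v) + d * of_int (snd v)" for v :: "int \<times> int"
  have \<xi>: "\<xi> v = of_real (X v)" and \<eta>: "\<eta> v = of_real (Y v)" for v
    unfolding \<xi>_def \<eta>_def X_def Y_def by (simp_all add: real)
  have height: "height v = max \<bar>X v\<bar> \<bar>Y v\<bar>" for v by (simp add: height_def \<xi> \<eta>)
  have F: "\<bar>X v ^ r - Y v ^ r\<bar> = of_int h" if "v \<in> solutions r F h" for v
    using norm_form_eval[OF that] unfolding \<xi> \<eta> by (metis norm_of_real of_real_diff of_real_power)
  have same: "norm (\<eta> v - 1 * \<xi> v) * height v ^ (r - 1) \<le> of_int h"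
    if v: "v \<in> solutions r F h" "X v * Y v \<ge> 0" for v
  proof -
    have "norm (\<eta> v - 1 * \<xi> v) = \<bar>X v - Y v\<bar>"
      unfolding \<xi> \<eta> by (metis abs_minus_commute mult_1 norm_of_real of_real_diff)
    then show ?thesis using diff_mult_power_le[of r "X v" "Y v"] v F[OF v(1)] r by (simp add: height)
  qed
  have opposite_even: "norm (\<eta> v - (- 1) * \<xi> v) * height v ^ (r - 1) \<le> of_int h"
    if v: "v \<in> solutions r F h" "\<not> X v * Y v \<ge> 0" "even r" for v
  proof -
    have "norm (\<eta> v - (- 1) * \<xi> v) = \<bar>X v - (- Y v)\<bar>"
      unfolding \<xi> \<eta> by (simp flip: of_real_add add: add.commute)
    then show ?thesis using diff_mult_power_le[of r "X v" "- Y v"] v F[OF v(1)] r by (simp add: height)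
  qed
  have opposite_odd: "height v ^ r \<le> of_int h"
    if v: "v \<in> solutions r F h" "\<not> X v * Y v \<ge> 0" "odd r" for v
  proof -
    have "\<bar>X v ^ r - Y v ^ r\<bar> = \<bar>X v\<bar> ^ r + \<bar>Y v\<bar> ^ r"
    proof -
      consider "X v > 0" "Y v < 0" | "X v < 0" "Y v > 0" using v(2) by (auto simp: not_le mult_less_0_iff)
      then show ?thesis
      proof cases
        case 1
        then have "Y v ^ r < 0" "X v ^ r > 0" using v(3) r by (auto simp: power_less_zero_eq)
        moreover have "\<bar>Y v\<bar> ^ r = - (Y v ^ r)" "\<bar>X v\<bar> ^ r = X v ^ r" using 1 v(3) by (simp_all add: power_minus_odd)
        ultimately show ?thesis by linarith
      next
        case 2
        then have "X v ^ r < 0" "Y v ^ r > 0" using v(3) r by (auto simp: power_less_zero_eq)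
        moreover have "\<bar>X v\<bar> ^ r = - (X v ^ r)" "\<bar>Y v\<bar> ^ r = Y v ^ r" using 2 v(3) by (simp_all add: power_minus_odd)
        ultimately show ?thesis by linarith
      qed
    qed
    with F[OF v(1)] have "\<bar>X v\<bar> ^ r + \<bar>Y v\<bar> ^ r = of_int h" by simp
    moreover have "0 \<le> \<bar>X v\<bar> ^ r" "0 \<le> \<bar>Y v\<bar> ^ r" by auto
    ultimately have "\<bar>X v\<bar> ^ r \<le> of_int h" "\<bar>Y v\<bar> ^ r \<le> of_int h" by linarith+
    then show ?thesis by (simp add: height max_def)
  qed
  let ?T = "prime_factors h \<rightarrow>\<^sub>E {..<r}"
  have fin: "finite ?T" by (auto intro!: finite_PiE)
  show ?thesis
  proof (cases "even r")
    case True
    have "finite (primitive_solutions r F h) \<and> card (primitive_solutions r F h) \<le> card (?T \<times> (UNIV :: bool set)) * 3"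
    proof (rule card_primitive_solutions_le[where lab = "\<lambda>v. (l v, X v * Y v \<ge> 0)"])
      show "finite (?T \<times> (UNIV :: bool set))" using fin by simp
      show "(l v, X v * Y v \<ge> 0) \<in> ?T \<times> UNIV" if "v \<in> solutions r F h" for v using label[OF that] by simp
      fix S t
      assume S: "S \<subseteq> solutions r F h" and t: "\<And>v. v \<in> S \<Longrightarrow> (l v, X v * Y v \<ge> 0) = t"
        and det: "\<And>v w. v \<in> S \<Longrightarrow> w \<in> S \<Longrightarrow> v \<noteq> w \<Longrightarrow> det2 v w \<noteq> 0"
      show "finite S \<and> card S \<le> 3"
      proof (rule card_rotated_near_le[OF S, of "fst t" "if snd t then 1 else - 1"])
        show "l v = fst t" if "v \<in> S" for v using t[OF that] by auto
        show "height v ^ r \<le> of_int h \<or> norm (\<eta> v - (if snd t then 1 else - 1) * \<xi> v) * height v ^ (r - 1) \<le> of_int h"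
          if "v \<in> S" for v
          using t[OF that] same[of v] opposite_even[of v] S that True by auto
      qed (use det True in auto)
    qed
    then show ?thesis using True by (simp add: card_cartesian_product card_labels)
  next
    case False
    have "finite (primitive_solutions r F h) \<and> card (primitive_solutions r F h) \<le> card ?T * 3"
    proof (rule card_primitive_solutions_le[where lab = l])
      show "finite ?T" by (rule fin)
      show "l v \<in> ?T" if "v \<in> solutions r F h" for v by (rule label[OF that])
      fix S t
      assume S: "S \<subseteq> solutions r F h" and t: "\<And>v. v \<in> S \<Longrightarrow> l v = t"
        and det: "\<And>v w. v \<in> S \<Longrightarrow> w \<in> S \<Longrightarrow> v \<noteq> w \<Longrightarrow> det2 v w \<noteq> 0"
      show "finite S \<and> card S \<le> 3"
      proof (rule card_rotated_near_le[OF S, of t 1])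
        show "height v ^ r \<le> of_int h \<or> norm (\<eta> v - 1 * \<xi> v) * height v ^ (r - 1) \<le> of_int h" if "v \<in> S" for v
          using same[of v] opposite_odd[of v] S that False by auto
      qed (use t det in auto)
    qed
    then show ?thesis using False by (simp add: card_labels)
  qed
qed

end

section \<open>Real diagonalizations for positive quadratic discriminant\<close>

lemma real_linear_form:
  fixes \<alpha> \<beta> :: complex and A B C :: int
  assumes nz: "\<alpha> \<noteq> 0 \<or> \<beta> \<noteq> 0"
    and root: "of_int A * \<beta>\<^sup>2 - of_int B * \<alpha> * \<beta> + of_int C * \<alpha>\<^sup>2 = 0"
    and D: "B\<^sup>2 - 4 * A * C > 0"
  shows "\<exists>c a b. norm c = 1 \<and> \<alpha> = c * of_real a \<and> \<beta> = c * of_real b \<and> (a \<noteq> 0 \<or> b \<noteq> 0)"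
proof (cases "\<alpha> = 0")
  case True
  then show ?thesis using nz
    by (intro exI[of _ "\<beta> / of_real (norm \<beta>)"]) (rule exI[of _ 0], rule exI[of _ "norm \<beta>"], simp add: norm_divide)
next
  case False
  define k where "k = \<beta> / \<alpha>"
  have "of_int A * k\<^sup>2 - of_int B * k + of_int C = (of_int A * \<beta>\<^sup>2 - of_int B * \<alpha> * \<beta> + of_int C * \<alpha>\<^sup>2) / \<alpha>\<^sup>2"
    using False by (simp add: k_def field_simps power2_eq_square)
  then have k: "of_int A * k\<^sup>2 - of_int B * k + of_int C = 0" using root by simp
  \<comment> \<open>The slope is a root of a polynomial with integer coefficients that is linear for
    \<open>A = 0\<close> and otherwise quadratic with positive discriminant.\<close>
  have "k \<in> \<real>"
  proof (cases "A = 0")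
    case True
    with D have "B \<noteq> 0" by auto
    with k True have "k = of_int C / of_int B" by (simp add: field_simps)
    then show ?thesis by simp
  next
    case False
    define d where "d = sqrt (of_int (B\<^sup>2 - 4 * A * C))"
    have "d\<^sup>2 = of_int (B\<^sup>2 - 4 * A * C)" unfolding d_def using D by (intro real_sqrt_pow2) (simp only: of_int_0_le_iff)
    have "(2 * of_int A * k - of_int B)\<^sup>2 = 4 * of_int A * (of_int A * k\<^sup>2 - of_int B * k + of_int C) + of_int (B\<^sup>2 - 4 * A * C)"
      by (simp add: power2_eq_square algebra_simps)
    also have "\<dots> = (of_real d)\<^sup>2"
      unfolding k by (metis \<open>d\<^sup>2 = _\<close> add_0 mult_zero_right of_real_of_int_eq of_real_power)
    finally have "2 * of_int A * k - of_int B \<in> \<real>" by (auto simp: power2_eq_iff)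
    then have "(2 * of_int A * k - of_int B + of_int B) / (2 * of_int A) \<in> \<real>"
      by (intro Reals_divide Reals_add) auto
    then show ?thesis using False by simp
  qed
  then have "k = of_real (Re k)" by simp
  then have "\<beta> = \<alpha> / of_real (norm \<alpha>) * of_real (Re k * norm \<alpha>)"
    using False by (simp add: k_def)
  then show ?thesis using False
    by (intro exI[of _ "\<alpha> / of_real (norm \<alpha>)"]) (rule exI[of _ "norm \<alpha>"], rule exI[of _ "Re k * norm \<alpha>"], simp add: norm_divide)
qed

lemma real_power_unit:
  fixes c :: complex and a :: real
  assumes "norm c = 1" "(c * of_real a) ^ r \<in> \<real>" "a \<noteq> 0"
  shows "\<exists>e :: real. (e = 1 \<or> e = - 1) \<and> c ^ r = of_real e"
proof -
  have "c ^ r = (c * of_real a) ^ r / of_real (a ^ r)" using assms(3) by (simp add: power_mult_distrib)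
  also have "\<dots> \<in> \<real>" using assms(2) by (intro Reals_divide) auto
  finally obtain e where e: "c ^ r = of_real e" by (auto elim: Reals_cases)
  have "norm (c ^ r) = 1" using assms(1) by (simp add: norm_power)
  then have "\<bar>e\<bar> = 1" unfolding e by simp
  then show ?thesis using e by (intro exI[of _ e]) auto
qed

text \<open>The linear factors of the quadratic form have real zeros, so each of \<xi>, \<eta> is a
  complex unit times a real linear form. The \<open>r\<close>-th powers of the coefficients are
  real, so the \<open>r\<close>-th powers of the units are the signs \<open>e\<close> and
  \<open>e'\<close>.\<close>

lemma (in diagonal_form) real_diagonalization:
  assumes D: "B\<^sup>2 - 4 * A * C > 0"
  shows "\<exists>a b c d e e' :: real. \<exists>\<kappa>'. (e = 1 \<or> e = - 1) \<and> (e' = 1 \<or> e' = - 1) \<and> \<bar>a * d - b * c\<bar> = norm j \<and>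
    (\<forall>x y :: complex. form_eval r F x y = of_real e * (of_real a * x + of_real b * y) ^ r - of_real e' * (of_real c * x + of_real d * y) ^ r) \<and>
    (\<forall>x y :: complex. (of_real a * x + of_real b * y) * (of_real c * x + of_real d * y) =
      \<kappa>' * (of_int A * x\<^sup>2 + of_int B * x * y + of_int C * y\<^sup>2)) \<and>
    (\<forall>v. height v = max \<bar>a * of_int (fst v) + b * of_int (snd v)\<bar> \<bar>c * of_int (fst v) + d * of_int (snd v)\<bar>)"
proof -
  have "\<kappa> * (of_int A * \<beta>\<^sup>2 - of_int B * \<alpha> * \<beta> + of_int C * \<alpha>\<^sup>2) = 0"
    using quad[of \<beta> "- \<alpha>"] by (simp add: algebra_simps)
  then have "of_int A * \<beta>\<^sup>2 - of_int B * \<alpha> * \<beta> + of_int C * \<alpha>\<^sup>2 = 0" using \<kappa>_nonzero by simp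
  then obtain u a b where 1: "norm u = 1" "\<alpha> = u * of_real a" "\<beta> = u * of_real b" "a \<noteq> 0 \<or> b \<noteq> 0"
    using real_linear_form[OF _ _ D] j_nonzero by (metis diff_self j_def mult_zero_left)
  have "\<kappa> * (of_int A * \<delta>\<^sup>2 - of_int B * \<gamma> * \<delta> + of_int C * \<gamma>\<^sup>2) = 0"
    using quad[of \<delta> "- \<gamma>"] by (simp add: algebra_simps)
  then have "of_int A * \<delta>\<^sup>2 - of_int B * \<gamma> * \<delta> + of_int C * \<gamma>\<^sup>2 = 0" using \<kappa>_nonzero by simp
  then obtain w c d where 2: "norm w = 1" "\<gamma> = w * of_real c" "\<delta> = w * of_real d" "c \<noteq> 0 \<or> d \<noteq> 0"
    using real_linear_form[OF _ _ D] j_nonzero by (metis diff_self j_def mult_zero_right)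
  have "\<alpha> ^ r \<in> \<real>" "\<beta> ^ r \<in> \<real>" "\<gamma> ^ r \<in> \<real>" "\<delta> ^ r \<in> \<real>"
    using powers_real_if_positive[OF D, of "(1, 0)"] powers_real_if_positive[OF D, of "(0, 1)"]
    by (simp_all add: \<xi>_def \<eta>_def)
  then have "\<exists>e. (e = 1 \<or> e = - 1) \<and> u ^ r = of_real e" "\<exists>e. (e = 1 \<or> e = - 1) \<and> w ^ r = of_real e"
    using 1 2 real_power_unit by metis+
  then obtain e e' where e: "e = 1 \<or> e = - 1" "u ^ r = of_real e" "e' = 1 \<or> e' = - 1" "w ^ r = of_real e'"
    by blast
  have lin: "\<alpha> * x + \<beta> * y = u * (of_real a * x + of_real b * y)" "\<gamma> * x + \<delta> * y = w * (of_real c * x + of_real d * y)" for x y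
    by (simp_all add: 1 2 algebra_simps)
  have uw: "u \<noteq> 0" "w \<noteq> 0" using 1 2 by auto
  show ?thesis
  proof (rule exI[of _ a], rule exI[of _ b], rule exI[of _ c], rule exI[of _ d], rule exI[of _ e], rule exI[of _ e'],
      rule exI[of _ "\<kappa> / (u * w)"], intro conjI allI e)
    have "j = u * w * of_real (a * d - b * c)" unfolding j_def by (simp add: 1 2 algebra_simps)
    then show "\<bar>a * d - b * c\<bar> = norm j" by (simp only: norm_mult 1 2 norm_of_real mult_1)
    fix x y :: complex
    show "form_eval r F x y = of_real e * (of_real a * x + of_real b * y) ^ r - of_real e' * (of_real c * x + of_real d * y) ^ r"
      unfolding form_eval_eq lin power_mult_distrib e ..
    have "u * w * ((of_real a * x + of_real b * y) * (of_real c * x + of_real d * y)) =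
        \<kappa> * (of_int A * x\<^sup>2 + of_int B * x * y + of_int C * y\<^sup>2)"
      unfolding quad[symmetric] lin by (simp only: mult_ac)
    then show "(of_real a * x + of_real b * y) * (of_real c * x + of_real d * y) =
        \<kappa> / (u * w) * (of_int A * x\<^sup>2 + of_int B * x * y + of_int C * y\<^sup>2)"
      using uw by (simp add: eq_divide_eq mult_ac)
  next
    fix v :: "int \<times> int"
    have "\<xi> v = u * of_real (a * of_int (fst v) + b * of_int (snd v))"
      "\<eta> v = w * of_real (c * of_int (fst v) + d * of_int (snd v))"
      unfolding \<xi>_def \<eta>_def lin by simp_all
    then show "height v = max \<bar>a * of_int (fst v) + b * of_int (snd v)\<bar> \<bar>c * of_int (fst v) + d * of_int (snd v)\<bar>"
      by (simp only: height_def norm_mult 1(1) 2(1) norm_of_real mult_1)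
  qed
qed

lemma of_real_form_eval: "complex_of_real (form_eval r F x y) = form_eval r F (of_real x) (of_real y)"
  by (simp add: form_eval_def)

lemma (in labelled_form) real_form_bounds:
  fixes a b c d :: real
  assumes F: "\<And>x y :: complex. form_eval r F x y = (of_real a * x + of_real b * y) ^ r - (of_real c * x + of_real d * y) ^ r"
    and det: "\<bar>a * d - b * c\<bar> = norm j"
    and quad': "\<And>x y :: complex. (of_real a * x + of_real b * y) * (of_real c * x + of_real d * y) =
      \<kappa>' * (of_int A * x\<^sup>2 + of_int B * x * y + of_int C * y\<^sup>2)"
  shows "finite (primitive_solutions r F h) \<and>
    card (primitive_solutions r F h) \<le> (if even r then 6 else 3) * r ^ omega h \<and> \<not> definite_form r F"
proof -
  have det': "of_real a * of_real d - of_real b * of_real c = complex_of_real (a * d - b * c)" by simp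
  have det0: "a * d - b * c \<noteq> 0" using det j_nonzero by auto
  interpret R: labelled_form r F "of_real a" "of_real b" "of_real c" "of_real d" \<kappa>' A B C h l
  proof
    show "diagonalization r F (of_real a) (of_real b) (of_real c) (of_real d)"
      unfolding diagonalization_def det' of_real_eq_0_iff by (intro conjI allI det0 F)
    show "real r ^ 7 \<le> (norm (complex_of_real a * of_real d - of_real b * of_real c) / 2) ^ (r - 4)"
      unfolding det' norm_of_real det using j_large by (simp only: j_def)
  qed (use r quad' h_pos label label_dvd in auto)
  \<comment> \<open>At this point both real linear forms take the value
    \<open>b * c - a * d\<close>, which exhibits a nontrivial real zero.\<close>
  have "form_eval r F (b - d) (c - a) = (0 :: real)"
  proof -
    have "a * (b - d) + b * (c - a) = c * (b - d) + d * (c - a)" by (simp add: algebra_simps)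
    then have eq: "complex_of_real a * of_real (b - d) + of_real b * of_real (c - a) =
       of_real c * of_real (b - d) + of_real d * of_real (c - a)"
      by (metis of_real_add of_real_mult)
    have "complex_of_real (form_eval r F (b - d) (c - a)) = 0"
      unfolding of_real_form_eval F eq by simp
    then show ?thesis by (simp only: of_real_eq_0_iff)
  qed
  moreover have "(b - d, c - a) \<noteq> (0, 0)" using det0 by auto
  ultimately have "\<not> definite_form r F" unfolding definite_form_def by (metis less_irrefl)
  then show ?thesis using R.card_primitive_solutions_real[of a b c d] by blast
qed

text \<open>
  A form \<open>u ^ r - v ^ r\<close> with real linear forms \<open>u\<close>, \<open>v\<close> has one real root of unity in play if \<open>r\<close>
  is odd and two if \<open>r\<close> is even; a form \<open>u ^ r + v ^ r\<close> with \<open>r\<close> even keeps \<open>u\<close> and \<open>v\<close> bounded.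
\<close>

lemma (in labelled_form) positive_discriminant_bounds:
  assumes D: "B\<^sup>2 - 4 * A * C > 0"
  shows "finite (primitive_solutions r F h) \<and>
    (card (primitive_solutions r F h) \<le> (if even r then 6 else 3) * r ^ omega h \<and> \<not> definite_form r F \<or>
     card (primitive_solutions r F h) \<le> r ^ omega h \<and> even r \<and> \<not> indefinite_form r F)"
proof -
  obtain a b c d e e' \<kappa>' where e: "e = 1 \<or> e = (- 1 :: real)" and e': "e' = 1 \<or> e' = (- 1 :: real)"
    and det: "\<bar>a * d - b * c\<bar> = norm j"
    and F: "\<And>x y :: complex. form_eval r F x y = of_real e * (of_real a * x + of_real b * y) ^ r - of_real e' * (of_real c * x + of_real d * y) ^ r"
    and quad': "\<And>x y :: complex. (of_real a * x + of_real b * y) * (of_real c * x + of_real d * y) =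
      \<kappa>' * (of_int A * x\<^sup>2 + of_int B * x * y + of_int C * y\<^sup>2)"
    and height: "\<And>v. height v = max \<bar>a * of_int (fst v) + b * of_int (snd v)\<bar> \<bar>c * of_int (fst v) + d * of_int (snd v)\<bar>"
    using real_diagonalization[OF D] by blast
  consider "odd r" | "e = 1" "e' = 1" | "e = - 1" "e' = - 1" | "even r" "e' = - e" using e e' by (cases "even r") auto
  then show ?thesis
  proof cases
    case 1
    \<comment> \<open>With odd exponent each sign is its own \<open>r\<close>-th power and can be
      moved into its linear form.\<close>
    have sq: "e * e = 1" "e' * e' = 1" "e ^ r = e" "e' ^ r = e'" using e e' 1 by auto
    have scale: "complex_of_real (s * a) * x + of_real (s * b) * y = of_real s * (of_real a * x + of_real b * y)" for s a b x y
      by (simp add: algebra_simps)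
    have "finite (primitive_solutions r F h) \<and>
      card (primitive_solutions r F h) \<le> (if even r then 6 else 3) * r ^ omega h \<and> \<not> definite_form r F"
    proof (rule real_form_bounds[of "e * a" "e * b" "e' * c" "e' * d" "of_real (e * e') * \<kappa>'"])
      have "(e * a) * (e' * d) - (e * b) * (e' * c) = (e * e') * (a * d - b * c)" by (simp add: algebra_simps)
      then show "\<bar>(e * a) * (e' * d) - (e * b) * (e' * c)\<bar> = norm j" using e e' det by (auto simp: abs_mult)
      fix x y :: complex
      show "form_eval r F x y = (of_real (e * a) * x + of_real (e * b) * y) ^ r - (of_real (e' * c) * x + of_real (e' * d) * y) ^ r"
        unfolding F scale power_mult_distrib of_real_power[symmetric] sq ..
      show "(of_real (e * a) * x + of_real (e * b) * y) * (of_real (e' * c) * x + of_real (e' * d) * y) =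
        of_real (e * e') * \<kappa>' * (of_int A * x\<^sup>2 + of_int B * x * y + of_int C * y\<^sup>2)"
      proof -
        have "(of_real (e * a) * x + of_real (e * b) * y) * (of_real (e' * c) * x + of_real (e' * d) * y) =
          of_real (e * e') * ((of_real a * x + of_real b * y) * (of_real c * x + of_real d * y))"
          unfolding scale by (simp add: mult_ac)
        then show ?thesis by (simp only: quad' mult.assoc)
      qed
    qed
    then show ?thesis by blast
  next
    case 2
    then show ?thesis using real_form_bounds[of a b c d \<kappa>'] F det quad' by simp
  next
    case 3
    have "\<bar>c * b - d * a\<bar> = norm j" using det by (simp add: abs_minus_commute mult.commute)
    moreover have "form_eval r F x y = (of_real c * x + of_real d * y) ^ r - (of_real a * x + of_real b * y) ^ r" for x y :: complex
      unfolding F 3 by simp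
    moreover have "(of_real c * x + of_real d * y) * (of_real a * x + of_real b * y) =
      \<kappa>' * (of_int A * x\<^sup>2 + of_int B * x * y + of_int C * y\<^sup>2)" for x y :: complex
      unfolding quad'[symmetric] by (rule mult.commute)
    ultimately show ?thesis using real_form_bounds[of c d a b \<kappa>'] by simp
  next
    case 4
    \<comment> \<open>With opposite signs and even exponent the form is \<open>e\<close> times a sum
      of two nonnegative powers, so it has no sign change and each power is at most \<open>h\<close>
      at a solution.\<close>
    have Freal: "form_eval r F x y = e * (\<bar>a * x + b * y\<bar> ^ r + \<bar>c * x + d * y\<bar> ^ r)" for x y :: real
    proof -
      have "complex_of_real (form_eval r F x y) = of_real (e * (a * x + b * y) ^ r - e' * (c * x + d * y) ^ r)"
        unfolding of_real_form_eval F by simp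
      then have "form_eval r F x y = e * (a * x + b * y) ^ r - e' * (c * x + d * y) ^ r" by (simp only: of_real_eq_iff)
      then show ?thesis using 4 by (simp add: power_even_abs algebra_simps)
    qed
    have "height v ^ r \<le> of_int h" if v: "v \<in> solutions r F h" for v
    proof -
      define X Y where "X = \<bar>a * of_int (fst v) + b * of_int (snd v)\<bar>" and "Y = \<bar>c * of_int (fst v) + d * of_int (snd v)\<bar>"
      have XY: "X ^ r \<ge> 0" "Y ^ r \<ge> 0" by (auto simp: X_def Y_def)
      have "of_int \<bar>form_eval r F (fst v) (snd v)\<bar> = real_of_int h" using v by (simp add: solutions_def)
      then have "\<bar>form_eval r F (real_of_int (fst v)) (of_int (snd v))\<bar> = of_int h"
        by (simp only: of_int_abs of_int_form_eval)
      then have "X ^ r + Y ^ r = of_int h" using e XY unfolding Freal X_def[symmetric] Y_def[symmetric] by (auto simp: abs_mult)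
      then have "X ^ r \<le> of_int h" "Y ^ r \<le> of_int h" using XY by linarith+
      then show ?thesis unfolding height X_def[symmetric] Y_def[symmetric] by (simp add: max_def)
    qed
    then have "finite (primitive_solutions r F h) \<and> card (primitive_solutions r F h) \<le> r ^ omega h"
      by (rule card_primitive_solutions_small)
    moreover have "\<not> indefinite_form r F"
    proof -
      have nonneg: "0 \<le> \<bar>a * x + b * y\<bar> ^ r + \<bar>c * x + d * y\<bar> ^ r" for x y :: real by simp
      have "e \<ge> 0 \<or> e \<le> 0" by auto
      then have "(\<forall>x y :: real. 0 \<le> form_eval r F x y) \<or> (\<forall>x y :: real. form_eval r F x y \<le> 0)"
        unfolding Freal using mult_nonneg_nonneg[OF _ nonneg] mult_nonpos_nonneg[OF _ nonneg] by blast
      then show ?thesis unfolding indefinite_form_def by (meson not_less)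
    qed
    ultimately show ?thesis using 4 by blast
  qed
qed

theorem theorem1p9:
  fixes r :: nat and F :: "nat \<Rightarrow> int" and \<Delta> D h :: int
  assumes "r \<ge> 5"
    and "diagonalizable r F"
    and "is_discriminant r F \<Delta>"
    and "is_quadratic_discriminant r F D"
    and "gcd h \<Delta> = 1"
    and "real_of_int \<bar>\<Delta>\<bar> \<ge>
           2 ^ (r\<^sup>2 - r) * real r powr (real r + 7 * real r * (real r - 1) / (real r - 4))"
  shows "finite (primitive_solutions r F h) \<and>
    (D < 0 \<longrightarrow>
       card (primitive_solutions r F h) \<le> 3 * r ^ (1 + omega h)) \<and>
    (D > 0 \<and> even r \<and> indefinite_form r F \<longrightarrow>
       card (primitive_solutions r F h) \<le> 6 * r ^ omega h) \<and>
    (D > 0 \<and> odd r \<and> indefinite_form r F \<longrightarrow>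
       card (primitive_solutions r F h) \<le> 3 * r ^ omega h) \<and>
    (D > 0 \<and> definite_form r F \<longrightarrow>
       card (primitive_solutions r F h) \<le> r ^ omega h)"
proof -
  obtain \<alpha> \<beta> \<gamma> \<delta> \<kappa> A B C where diag: "diagonalization r F \<alpha> \<beta> \<gamma> \<delta>"
    and quad: "\<And>x y. (\<alpha> * x + \<beta> * y) * (\<gamma> * x + \<delta> * y) =
                 \<kappa> * (of_int A * x\<^sup>2 + of_int B * x * y + of_int C * y\<^sup>2)"
    and D: "D = B\<^sup>2 - 4 * A * C"
    using assms(4) unfolding is_quadratic_discriminant_def by blast
  interpret diagonal_form r F \<alpha> \<beta> \<gamma> \<delta> \<kappa> A B C
    by unfold_locales (use assms(1) diag quad in auto)
  have disc: "real_of_int \<bar>\<Delta>\<bar> = real r ^ r * norm j ^ (r * (r - 1))"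
    unfolding j_def using assms(1,3) j_nonzero by (intro norm_discriminant[OF _ form_eval_eq]) (auto simp: j_def)
  have j_large: "real r ^ 7 \<le> (norm j / 2) ^ (r - 4)"
    by (rule norm_det_ge[OF assms(1) _ disc assms(6)]) simp
  have D0: "D \<noteq> 0" using s_square s_nonzero unfolding D[symmetric] by auto
  show ?thesis
  proof (cases "h > 0")
    case False
    \<comment> \<open>For \<open>h = 0\<close> coprimality would mean
      \<open>\<bar>\<Delta>\<bar> = 1\<close>, against the size of \<Delta>; for negative
      \<open>h\<close> there are no solutions.\<close>
    have "h \<noteq> 0"
    proof
      assume "h = 0"
      with assms(5) have "\<bar>\<Delta>\<bar> = 1" by simp
      have "norm j \<ge> 1" using half_norm_j_gt_1[OF j_large] by simp
      then have "1 \<le> norm j ^ (r * (r - 1))" by (rule one_le_power)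
      moreover have "1 < real r ^ r" using assms(1) by (intro one_less_power) auto
      ultimately have "1 * 1 < real r ^ r * norm j ^ (r * (r - 1))" by (intro mult_less_le_imp_less) auto
      with disc \<open>\<bar>\<Delta>\<bar> = 1\<close> show False by simp
    qed
    with False have "solutions r F h = {}" by (auto simp: solutions_def)
    then show ?thesis by (simp add: primitive_solutions_eq)
  next
    case True
    obtain a b :: "nat \<Rightarrow> complex" where factors: "\<And>x y. form_eval r F x y = (\<Prod>i<r. a i * x + b i * y)"
      and \<Delta>: "of_int \<Delta> = (\<Prod>j<r. \<Prod>i<j. (a i * b j - a j * b i)\<^sup>2)"
      using assms(3) unfolding is_discriminant_def by blast
    obtain l where l: "\<forall>v. coprime (fst v) (snd v) \<longrightarrow> h dvd form_eval r F (fst v) (snd v) \<longrightarrow>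
      l v \<in> prime_factors h \<rightarrow>\<^sub>E {..<r} \<and>
      (\<forall>w. coprime (fst w) (snd w) \<longrightarrow> h dvd form_eval r F (fst w) (snd w) \<longrightarrow> l v = l w \<longrightarrow> h dvd det2 v w)"
      using root_labels[OF _ _ assms(5) factors \<Delta>] assms(1) True by auto
    have sol: "coprime (fst v) (snd v)" "h dvd form_eval r F (fst v) (snd v)" if "v \<in> solutions r F h" for v
      using that by (auto simp: solutions_def)
    interpret labelled_form r F \<alpha> \<beta> \<gamma> \<delta> \<kappa> A B C h l
    proof
      show "h > 0" by (rule True)
      show "real r ^ 7 \<le> (norm (\<alpha> * \<delta> - \<beta> * \<gamma>) / 2) ^ (r - 4)" using j_large by (simp only: j_def)
      show "l v \<in> prime_factors h \<rightarrow>\<^sub>E {..<r}" if "v \<in> solutions r F h" for v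
        using l sol[OF that] by blast
      show "h dvd det2 v w" if "v \<in> solutions r F h" "w \<in> solutions r F h" "l v = l w" for v w
        using l sol[OF that(1)] sol[OF that(2)] that(3) by blast
    qed
    show ?thesis
    proof (cases "D < 0")
      case True
      then show ?thesis using card_primitive_solutions_negative by (simp add: D)
    next
      case False
      with D0 have "D > 0" by simp
      \<comment> \<open>An indefinite form falls under the first alternative, a definite one under
        the second.\<close>
      then show ?thesis using positive_discriminant_bounds unfolding D by auto
    qed
  qed
qed

end
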